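(* There exists a universal constant $c>0$ such that for every $n\ge1$ and all increasing functions $f,g:\mathbb{R}^n\to[0,1]$, $$ \mathrm{Cor}(f,g)\ \ge\ c\sum_{i=1}^n \min\left(\frac{\mathcal{M}_1(f)_i\,\mathcal{M}_1(g)_i}{\sqrt{\log\left(\frac{e}{\mathcal{M}_1(f)_i\,\mathcal{M}_1(g)_i}\right)}},\ \frac{\big(\mathcal{M}_1(f)_i\,\mathcal{M}_1(g)_i\big)^2}{|\langle \mathcal{M}_2(f)e_i,\mathcal{M}_2(g)e_i\rangle|}\right). $$
   Context: Let $\gamma$ be the standard Gaussian measure on $\mathbb{R}^n$, $\mathrm{I}_n$ the $n\times n$ identity matrix and $e_1,\dots,e_n$ the standard basis of $\mathbb{R}^n$. A function $f:\mathbb{R}^n\to\mathbb{R}$ is increasing if for each $i$ it is non-decreasing in the $i$-th coordinate when the other coordinates are kept fixed. Define the first and second degree Hermite tensors $$\mathcal{M}_1(f)=\int x f(x)\,d\gamma(x)\in\mathbb{R}^n,\qquad \mathcal{M}_2(f)=\int (x^{\otimes 2}-\mathrm{I}_n)f(x)\,d\gamma(x)\in\mathbb{R}^{n\times n},$$ where $x^{\otimes 2}=xx^{T}$. The correlation is $\mathrm{Cor}(f,g)=\int fg\,d\gamma-\left(\int f\,d\gamma\right)\left(\int g\,d\gamma\right)$. Here $\log$ is the natural logarithm. Conventions: the $i$-th summand is $0$ if $\mathcal{M}_1(f)_i\mathcal{M}_1(g)_i=0$; if $\mathcal{M}_1(f)_i\mathcal{M}_1(g)_i>0$ and $\langle \mathcal{M}_2(f)e_i,\mathcal{M}_2(g)e_i\rangle=0$,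 the second term of the minimum is $+\infty$. The constant $c$ does not depend on $n,f,g$. *)

theory Defs
  imports "HOL-Probability.Probability" "Jordan_Normal_Form.Matrix"
begin

text \<open>
  Points of \<open>\<real>\<^sup>n\<close> are the extensional functions in \<open>{..<n} \<rightarrow>\<^sub>E UNIV\<close> (coordinates counted from 0),
  so that a constant can be chosen before the dimension. The product measure is completed because
  a coordinatewise increasing function on \<open>\<real>\<^sup>n\<close> need not be Borel measurable when \<open>n \<ge> 2\<close>, whereas
  it is always measurable with respect to the completion; no measurability hypothesis is then needed.
\<close>

definition std_gaussian :: "nat \<Rightarrow> (nat \<Rightarrow> real) measure" where
  "std_gaussian n = completion (\<Pi>\<^sub>M i\<in>{..<n}. std_normal_distribution)"

definition increasing_fun :: "nat \<Rightarrow> ((nat \<Rightarrow> real) \<Rightarrow> real) \<Rightarrow> bool" where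
  "increasing_fun n f \<longleftrightarrow>
     (\<forall>x \<in> {..<n} \<rightarrow>\<^sub>E UNIV. \<forall>i<n. \<forall>t. x i \<le> t \<longrightarrow> f x \<le> f (x(i := t)))"

definition hermite1 :: "nat \<Rightarrow> ((nat \<Rightarrow> real) \<Rightarrow> real) \<Rightarrow> real vec" where
  "hermite1 n f = vec n (\<lambda>i. \<integral>x. x i * f x \<partial>std_gaussian n)"

definition hermite2 :: "nat \<Rightarrow> ((nat \<Rightarrow> real) \<Rightarrow> real) \<Rightarrow> real mat" where
  "hermite2 n f =
     mat n n (\<lambda>(i, j). \<integral>x. (x i * x j - (if i = j then 1 else 0)) * f x \<partial>std_gaussian n)"

definition gaussian_cor ::
  "nat \<Rightarrow> ((nat \<Rightarrow> real) \<Rightarrow> real) \<Rightarrow> ((nat \<Rightarrow> real) \<Rightarrow> real) \<Rightarrow> real" where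
  "gaussian_cor n f g =
     (\<integral>x. f x * g x \<partial>std_gaussian n) -
     (\<integral>x. f x \<partial>std_gaussian n) * (\<integral>x. g x \<partial>std_gaussian n)"

text \<open>
  With \<open>p\<close> the product of the degree-1 coefficients and \<open>q\<close> the inner product of the degree-2
  columns, this is \<open>min (p / sqrt (ln (e / p))) (p\<^sup>2 / \<bar>q\<bar>)\<close>, where the summand is 0 if \<open>p = 0\<close> and
  \<open>p\<^sup>2 / 0\<close> is read as \<open>+\<infinity>\<close> (rather than HOL's 0), so that the minimum is then its first argument.
  For increasing functions \<open>p\<close> is never negative.
\<close>

definition cor_bound_term :: "real \<Rightarrow> real \<Rightarrow> real" where
  "cor_bound_term p q =
     (if p = 0 then 0
      else if q = 0 then p / sqrt (ln (exp 1 / p))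
      else min (p / sqrt (ln (exp 1 / p))) (p\<^sup>2 / \<bar>q\<bar>))"

end

theory Submission
  imports Defs
begin

text \<open>
  Along the Ornstein--Uhlenbeck semigroup, \<open>Cor(f, g) = \<Sum>\<^sub>i \<integral>\<^sub>0\<^sup>1 \<phi>\<^sub>i(\<rho>) d\<rho>\<close>, where
  \<open>\<phi>\<^sub>i(\<rho>) = E \<partial>\<^sub>if(Y) \<partial>\<^sub>ig(Z) \<ge> 0\<close> for \<open>\<rho>\<close>-correlated Gaussian vectors \<open>Y\<close>, \<open>Z\<close>. So it suffices to
  bound \<open>\<phi>\<^sub>i(\<rho>)\<close> below by a multiple of \<open>\<phi>\<^sub>i(0) = p\<close>, the product of the degree-1 coefficients, for small
  \<open>\<rho>\<close>. The key estimate is that probability densities \<open>F\<close>, \<open>G\<close> with barycentres \<open>m\<close>, \<open>m'\<close> satisfy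
  \<open>E F(Y) G(Z) \<ge> exp (\<rho> \<langle>m, m'\<rangle> - 5 \<rho>\<^sup>2 (Ent F + Ent G))\<close>: by the Gibbs variational principle one
  needs a coupling of the two laws that is close to the \<open>\<rho>\<close>-correlated one. For \<open>F\<close>, \<open>G\<close> proportional to
  \<open>\<partial>\<^sub>if\<close>, \<open>\<partial>\<^sub>ig\<close> the inner product is \<open>q / p\<close>, with \<open>q\<close> that of the degree-2 columns, and after smoothing
  \<open>f\<close>, \<open>g\<close> the entropies are at most \<open>O(log (e / p))\<close>, so \<open>\<phi>\<^sub>i(\<rho>)\<close> stays comparable to \<open>p\<close> up to \<open>\<rho>\<close> of
  order \<open>min (1 / sqrt (log (e / p))) (p / \<bar>q\<bar>)\<close>.

  The key estimate is proved on the discrete cube, where it tensorizes to an explicit coupling of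
  two biased bits, and it is transferred to Gaussian space by the central limit theorem, with every
  Gaussian coordinate replaced by a normalized sum of \<open>N\<close> signs. Smoothing does not increase the correlation,
  by Harris' inequality for the conditional laws.
\<close>

section \<open>Noise on the discrete cube\<close>

text \<open>An increasing function may jump. On the cube its discrete derivative is then only
  bounded by a constant, while its mean is of order \<open>1 / sqrt N\<close>, so the entropy bound
  would grow like \<open>ln N\<close>. Smoothing removes this: for a Lipschitz function with
  constant \<open>L\<close> the derivative is at most \<open>L / sqrt N\<close>, and the ratio of
  its supremum to its mean stays near \<open>L / a\<close> for all \<open>N\<close>. A density
  bounded by \<open>L / a\<close> has entropy at most \<open>ln (L / a)\<close>.

  The induction over the coordinates closes because every error of the two-bit coupling is quadratic
  in the biases \<open>m\<close>, and the relative entropy of a bit with mean \<open>m\<close> is at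
  least \<open>m^2 / 2\<close>. Hence errors can be charged to the entropy, which is additive along
  the coordinates.

  The pair 3/5, 4/5 is a rational solution of \<open>r^2 + s^2 = 1\<close>, which makes the
  smoothing kernel symmetric with respect to the Gaussian measure; its Lipschitz constant is
  \<open>2 * r / s = 3/2\<close>. In the final constant \<open>9/100 * exp (-2)\<close>, the factor
  9/25 is the loss of the two degree-1 coefficients under smoothing, 1/4 comes from the length of
  the interval of noise levels, and \<open>exp (-2)\<close> from two errors of at most 1 in the
  exponent.\<close>

definition spin :: "'a set \<Rightarrow> 'a \<Rightarrow> real" where
  "spin A e = (if e \<in> A then 1 else - 1)"

definition cube_avg :: "'a set \<Rightarrow> ('a set \<Rightarrow> real) \<Rightarrow> real" where
  "cube_avg I F = (\<Sum>A\<in>Pow I. F A) / 2 ^ card I"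

text \<open>The weight is the joint law of two uniform points whose signs at each coordinate have
  correlation \<rho>, independently over the coordinates. For \<open>H A B = F A * G B\<close> this
  is the bilinear form of the noise operator.\<close>

definition noise_avg :: "real \<Rightarrow> 'a set \<Rightarrow> ('a set \<Rightarrow> 'a set \<Rightarrow> real) \<Rightarrow> real" where
  "noise_avg \<rho> I H =
     (\<Sum>A\<in>Pow I. \<Sum>B\<in>Pow I. (\<Prod>e\<in>I. (1 + \<rho> * spin A e * spin B e) / 4) * H A B)"

lemma sum_Pow_insert:
  fixes F :: "'a set \<Rightarrow> real"
  assumes "finite I" "e \<notin> I"
  shows "(\<Sum>A\<in>Pow (insert e I). F A) = (\<Sum>A\<in>Pow I. F A + F (insert e A))"
proof -
  have "inj_on (insert e) (Pow I)"
    using assms(2) by (auto simp: inj_on_def)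
  moreover have "Pow I \<inter> insert e ` Pow I = {}"
    using assms(2) by auto
  ultimately show ?thesis
    using assms by (simp add: Pow_insert sum.union_disjoint sum.reindex sum.distrib)
qed

lemma cube_avg_empty [simp]: "cube_avg {} F = F {}"
  by (simp add: cube_avg_def)

lemma noise_avg_empty [simp]: "noise_avg \<rho> {} H = H {} {}"
  by (simp add: noise_avg_def)

lemma cube_avg_insert:
  assumes "finite I" "e \<notin> I"
  shows "cube_avg (insert e I) F = cube_avg I (\<lambda>A. (F A + F (insert e A)) / 2)"
  using assms by (simp add: cube_avg_def sum_Pow_insert sum_divide_distrib[symmetric])

lemma cube_avg_cong:
  assumes "\<And>A. A \<subseteq> I \<Longrightarrow> F A = G A"
  shows "cube_avg I F = cube_avg I G"
  using assms by (auto simp: cube_avg_def intro!: sum.cong)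

lemma cube_avg_mono:
  assumes "\<And>A. A \<subseteq> I \<Longrightarrow> F A \<le> G A"
  shows "cube_avg I F \<le> cube_avg I G"
  using assms by (auto simp: cube_avg_def intro!: divide_right_mono sum_mono)

lemma cube_avg_add: "cube_avg I (\<lambda>A. F A + G A) = cube_avg I F + cube_avg I G"
  by (simp add: cube_avg_def sum.distrib add_divide_distrib)

lemma cube_avg_diff: "cube_avg I (\<lambda>A. F A - G A) = cube_avg I F - cube_avg I G"
  by (simp add: cube_avg_def sum_subtractf diff_divide_distrib)

lemma cube_avg_cmult: "cube_avg I (\<lambda>A. c * F A) = c * cube_avg I F"
  by (simp add: cube_avg_def sum_distrib_left)

lemma cube_avg_sum: "cube_avg I (\<lambda>A. \<Sum>k\<in>K. F k A) = (\<Sum>k\<in>K. cube_avg I (F k))"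
  by (simp add: cube_avg_def sum.swap[of _ K] sum_divide_distrib)

lemma cube_avg_const: "finite I \<Longrightarrow> cube_avg I (\<lambda>_. c) = c"
  by (simp add: cube_avg_def card_Pow)

text \<open>At the new coordinate the two signs agree with weight \<open>(1 + \<rho>) / 4\<close>
  each and disagree with weight \<open>(1 - \<rho>) / 4\<close> each. All inductions on the noise
  form rest on this recursion.\<close>

lemma noise_avg_insert:
  assumes "finite I" "e \<notin> I"
  shows "noise_avg \<rho> (insert e I) H = noise_avg \<rho> I (\<lambda>A B.
    (1 + \<rho>) / 4 * (H A B + H (insert e A) (insert e B)) +
    (1 - \<rho>) / 4 * (H A (insert e B) + H (insert e A) B))"
proof -
  have pr: "(\<Prod>i\<in>I. (1 + \<rho> * spin A' i * spin B' i) / 4) = (\<Prod>i\<in>I. (1 + \<rho> * spin A i * spin B i) / 4)"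
    if "A' = A \<or> A' = insert e A" "B' = B \<or> B' = insert e B" for A A' B B'
    using that assms(2) by (intro prod.cong) (auto simp: spin_def)
  have "noise_avg \<rho> (insert e I) H =
    (\<Sum>A\<in>Pow I. \<Sum>B\<in>Pow I.
       (\<Prod>i\<in>insert e I. (1 + \<rho> * spin A i * spin B i) / 4) * H A B
     + (\<Prod>i\<in>insert e I. (1 + \<rho> * spin A i * spin (insert e B) i) / 4) * H A (insert e B)
     + ((\<Prod>i\<in>insert e I. (1 + \<rho> * spin (insert e A) i * spin B i) / 4) * H (insert e A) B
     + (\<Prod>i\<in>insert e I. (1 + \<rho> * spin (insert e A) i * spin (insert e B) i) / 4) * H (insert e A) (insert e B)))"
    unfolding noise_avg_def
    by (subst sum_Pow_insert[OF assms], intro sum.cong refl,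
        subst (1 2) sum_Pow_insert[OF assms], simp add: sum.distrib)
  also have "\<dots> = noise_avg \<rho> I (\<lambda>A B.
    (1 + \<rho>) / 4 * (H A B + H (insert e A) (insert e B)) +
    (1 - \<rho>) / 4 * (H A (insert e B) + H (insert e A) B))"
    unfolding noise_avg_def
  proof (intro sum.cong refl)
    fix A B assume "A \<in> Pow I" "B \<in> Pow I"
    then have e: "e \<notin> A" "e \<notin> B" using assms(2) by auto
    show "(\<Prod>i\<in>insert e I. (1 + \<rho> * spin A i * spin B i) / 4) * H A B
     + (\<Prod>i\<in>insert e I. (1 + \<rho> * spin A i * spin (insert e B) i) / 4) * H A (insert e B)
     + ((\<Prod>i\<in>insert e I. (1 + \<rho> * spin (insert e A) i * spin B i) / 4) * H (insert e A) B
     + (\<Prod>i\<in>insert e I. (1 + \<rho> * spin (insert e A) i * spin (insert e B) i) / 4) * H (insert e A) (insert e B))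
     = (\<Prod>i\<in>I. (1 + \<rho> * spin A i * spin B i) / 4) *
       ((1 + \<rho>) / 4 * (H A B + H (insert e A) (insert e B)) +
        (1 - \<rho>) / 4 * (H A (insert e B) + H (insert e A) B))"
    proof -
      have s: "spin A e = - 1" "spin B e = - 1" "spin (insert e A) e = 1" "spin (insert e B) e = 1"
        using e by (auto simp: spin_def)
      define w where "w = (\<Prod>i\<in>I. (1 + \<rho> * spin A i * spin B i) / 4)"
      show ?thesis
        unfolding prod.insert[OF assms] s pr[of "insert e A" A B B, simplified]
          pr[of A A "insert e B" B, simplified] pr[of "insert e A" A "insert e B" B, simplified] w_def[symmetric]
        by (simp add: field_simps)
    qed
  qed
  finally show ?thesis .
qed

lemma noise_avg_mono:
  assumes "0 \<le> \<rho>" "\<rho> \<le> 1" "\<And>A B. A \<subseteq> I \<Longrightarrow> B \<subseteq> I \<Longrightarrow> H A B \<le> H' A B"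
  shows "noise_avg \<rho> I H \<le> noise_avg \<rho> I H'"
proof -
  have "0 \<le> 1 + \<rho> * spin A i * spin B i" for A B and i :: 'a
    using assms(1,2) by (auto simp: spin_def)
  then show ?thesis
    unfolding noise_avg_def using assms(3)
    by (intro sum_mono mult_left_mono prod_nonneg) auto
qed

lemma noise_avg_nonneg:
  assumes "0 \<le> \<rho>" "\<rho> \<le> 1" "\<And>A B. A \<subseteq> I \<Longrightarrow> B \<subseteq> I \<Longrightarrow> 0 \<le> H A B"
  shows "0 \<le> noise_avg \<rho> I H"
  using noise_avg_mono[OF assms(1,2), of I "\<lambda>_ _. 0" H] assms(3) by (simp add: noise_avg_def)

lemma noise_avg_cong:
  assumes "\<And>A B. A \<subseteq> I \<Longrightarrow> B \<subseteq> I \<Longrightarrow> H A B = H' A B"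
  shows "noise_avg \<rho> I H = noise_avg \<rho> I H'"
  using assms by (auto simp: noise_avg_def intro!: sum.cong)

lemma noise_avg_cmult: "noise_avg \<rho> I (\<lambda>A B. c * H A B) = c * noise_avg \<rho> I H"
  by (simp add: noise_avg_def sum_distrib_left mult_ac)

lemma noise_avg_0:
  assumes "finite I"
  shows "noise_avg 0 I (\<lambda>A B. F A * G B) = cube_avg I F * cube_avg I G"
proof -
  have "noise_avg 0 I (\<lambda>A B. F A * G B) = (\<Sum>A\<in>Pow I. \<Sum>B\<in>Pow I. (F A / 2 ^ card I) * (G B / 2 ^ card I))"
    by (simp add: noise_avg_def power_divide power_mult_distrib[symmetric])
  also have "\<dots> = cube_avg I F * cube_avg I G"
    by (simp add: cube_avg_def sum_product sum_divide_distrib)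
  finally show ?thesis .
qed

lemma noise_avg_1:
  assumes "finite I"
  shows "noise_avg 1 I H = cube_avg I (\<lambda>A. H A A)"
  using assms
  by (induction I arbitrary: H rule: finite_induct) (simp_all add: noise_avg_insert cube_avg_insert)

text \<open>
  The coupling with weights \<open>p y z = (1 + m y) (1 + m' z) (1 + \<rho> (y - m) (z - m')) / 4\<close> has the
  right marginals and is close to the noise weights \<open>(1 + \<rho> y z) / 4\<close>; the lemma is Jensen's
  inequality for it.
\<close>

lemma two_point_noise:
  fixes \<alpha> \<beta> :: "'k \<Rightarrow> real \<Rightarrow> real" and h k :: "real \<Rightarrow> real" and m m' \<rho> :: real
  assumes \<rho>: "0 \<le> \<rho>" "\<rho> \<le> 1/4" and m: "\<bar>m\<bar> \<le> 1" "\<bar>m'\<bar> \<le> 1" and K: "finite K"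
  defines "mean \<equiv> \<lambda>m a. (1 - m) / 2 * a (- 1) + (1 + m) / 2 * (a 1 :: real)"
  defines "var \<equiv> \<lambda>m a. mean m (\<lambda>y. (a y)\<^sup>2) - (mean m a)\<^sup>2"
  shows "exp (\<rho> * m * m' + \<rho> * (\<Sum>i\<in>K. mean m (\<alpha> i) * mean m' (\<beta> i)) - mean m h - mean m' k
      - \<rho>\<^sup>2 / 2 * (\<Sum>i\<in>K. var m (\<alpha> i) + var m' (\<beta> i)) - 2 * \<rho>\<^sup>2 * (m\<^sup>2 + m'\<^sup>2))
    \<le> (\<Sum>y\<in>{-1,1}. \<Sum>z\<in>{-1,1}. (1 + \<rho> * y * z) / 4 * ((1 + m * y) * (1 + m' * z))
        * exp (\<rho> * (\<Sum>i\<in>K. \<alpha> i y * \<beta> i z) - h y - k z))"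
proof -
  define p where "p y z = (1 + m * y) * (1 + m' * z) * (1 + \<rho> * (y - m) * (z - m')) / 4" for y z
  define \<Phi> where "\<Phi> y z = \<rho> * (\<Sum>i\<in>K. \<alpha> i y * \<beta> i z) - h y - k z" for y z
  \<comment> \<open>With \<open>u\<close> the ratio of \<open>p\<close> to the noise weight,
    \<open>R\<close> equals \<open>1 - u\<close>, a lower bound for \<open>- ln u\<close>. Since
    \<open>(y * z)^2 = 1\<close>, the denominator \<open>1 + \<rho> * y * z\<close> can be traded
    for \<open>1 - \<rho>^2\<close>; \<open>R\<close> becomes a polynomial in the signs and its mean
    is computed exactly.\<close>
  define R where "R y z = \<rho> * (m * z + m' * y - m * m') * (1 - \<rho> * y * z) / (1 - \<rho>\<^sup>2)" for y z
  define E where "E q = (\<Sum>y\<in>{-1,1}. \<Sum>z\<in>{-1,1}. p y z * q y z)" for q :: "real \<Rightarrow> real \<Rightarrow> real"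
  have E_expand: "E q = p (-1) (-1) * q (-1) (-1) + p (-1) 1 * q (-1) 1 + p 1 (-1) * q 1 (-1) + p 1 1 * q 1 1" for q
    by (simp add: E_def)
  have \<rho>2: "\<rho>\<^sup>2 \<le> 1/16" using \<rho> power_mono[of \<rho> "1/4" 2] by (simp add: power2_eq_square)
  \<comment> \<open>Both deviations are at most 2, so \<open>\<rho> \<le> 1/4\<close> is what keeps
    the weights of the coupling nonnegative.\<close>
  have yzb: "\<bar>\<rho> * (y - m) * (z - m')\<bar> \<le> 1" if "y \<in> {-1,1}" "z \<in> {-1,1}" for y z
  proof -
    have "\<bar>y - m\<bar> \<le> 2" "\<bar>z - m'\<bar> \<le> 2" using that m by auto
    then have "\<bar>\<rho>\<bar> * \<bar>y - m\<bar> * \<bar>z - m'\<bar> \<le> 1/4 * 2 * 2"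
      using \<rho> by (intro mult_mono) auto
    then show ?thesis by (simp add: abs_mult)
  qed
  have p_nonneg: "0 \<le> p y z" if "y \<in> {-1,1}" "z \<in> {-1,1}" for y z
  proof -
    have "0 \<le> 1 + m * y" "0 \<le> 1 + m' * z" using that m by auto
    moreover have "0 \<le> 1 + \<rho> * (y - m) * (z - m')" using yzb[OF that] by linarith
    ultimately show ?thesis by (simp add: p_def)
  qed
  have step: "p y z * exp (\<Phi> y z + R y z) \<le> (1 + \<rho> * y * z) / 4 * ((1 + m * y) * (1 + m' * z)) * exp (\<Phi> y z)"
    if yz: "y \<in> {-1,1}" "z \<in> {-1,1}" for y z
  proof -
    have pos: "0 < 1 + \<rho> * y * z" and pos': "0 < 1 - \<rho> * y * z" using \<rho> yz by auto
    have v: "0 \<le> 1 + \<rho> * (y - m) * (z - m')" using yzb[OF yz] by linarith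
    have sq: "(1 + \<rho> * y * z) * (1 - \<rho> * y * z) = 1 - \<rho>\<^sup>2"
      using yz by (auto simp: power2_eq_square algebra_simps)
    have R_eq: "R y z = 1 - (1 + \<rho> * (y - m) * (z - m')) / (1 + \<rho> * y * z)"
    proof -
      have "1 - (1 + \<rho> * (y - m) * (z - m')) / (1 + \<rho> * y * z) = \<rho> * (m * z + m' * y - m * m') / (1 + \<rho> * y * z)"
        using pos by (simp add: field_simps)
      also have "\<dots> = R y z"
        using pos pos' by (simp add: R_def sq[symmetric])
      finally show ?thesis by simp
    qed
    define u where "u = (1 + \<rho> * (y - m) * (z - m')) / (1 + \<rho> * y * z)"
    have "u * exp (1 - u) \<le> 1"
      using mult_right_mono[OF exp_ge_add_one_self[of "u - 1"], of "exp (1 - u)"]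
      by (simp add: exp_add[symmetric])
    then have "(1 + \<rho> * (y - m) * (z - m')) * exp (R y z) \<le> 1 + \<rho> * y * z"
      using pos by (simp add: R_eq u_def field_simps)
    then have "(1 + m * y) * (1 + m' * z) / 4 * exp (\<Phi> y z) * ((1 + \<rho> * (y - m) * (z - m')) * exp (R y z))
        \<le> (1 + m * y) * (1 + m' * z) / 4 * exp (\<Phi> y z) * (1 + \<rho> * y * z)"
      using yz m by (intro mult_left_mono) auto
    then show ?thesis by (simp add: p_def exp_add mult_ac)
  qed
  have E1: "E (\<lambda>_ _. 1) = 1"
    by (simp add: E_expand p_def) (simp add: field_simps)
  define M where "M = E (\<lambda>y z. \<Phi> y z + R y z)"
  have jensen: "exp M \<le> E (\<lambda>y z. exp (\<Phi> y z + R y z))"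
  proof -
    have "exp M = exp M * (E (\<lambda>_ _. 1) + M - M * E (\<lambda>_ _. 1))" by (simp add: E1)
    also have "\<dots> = E (\<lambda>y z. exp M * (1 + (\<Phi> y z + R y z - M)))"
      by (subst (2) M_def) (simp add: E_expand algebra_simps)
    also have "\<dots> \<le> E (\<lambda>y z. exp (\<Phi> y z + R y z))"
      unfolding E_def
    proof (intro sum_mono mult_left_mono p_nonneg)
      fix y z :: real
      have "exp M * (1 + (\<Phi> y z + R y z - M)) \<le> exp M * exp (\<Phi> y z + R y z - M)"
        by (intro mult_left_mono exp_ge_add_one_self) simp
      then show "exp M * (1 + (\<Phi> y z + R y z - M)) \<le> exp (\<Phi> y z + R y z)"
        by (simp add: exp_add[symmetric])
    qed auto
    finally show ?thesis .
  qed
  \<comment> \<open>Under \<open>p\<close> the marginals are the biased bits, and the covariance of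
    \<open>a y\<close> and \<open>b z\<close> is \<rho> times the product of the covariances of each
    function with its own sign.\<close>
  have Eab: "E (\<lambda>y z. a y * b z) = mean m a * mean m' b
      + \<rho> * mean m (\<lambda>y. a y * (y - m)) * mean m' (\<lambda>z. b z * (z - m'))" for a b
    by (simp add: E_expand p_def mean_def field_simps)
  \<comment> \<open>Cauchy-Schwarz, as the sign has variance \<open>1 - m^2 \<le> 1\<close>. On two
    points every function is affine, so both sides are explicit multiples of
    \<open>d\<close>.\<close>
  have cov: "(mean m (\<lambda>y. a y * (y - m)))\<^sup>2 \<le> var m a" if "\<bar>m\<bar> \<le> 1" for m a
  proof -
    define d where "d = a 1 - a (-1)"
    have m2: "0 \<le> 1 - m\<^sup>2" using that abs_square_le_1[of m] by simp
    have c: "mean m (\<lambda>y. a y * (y - m)) = (1 - m\<^sup>2) / 2 * d"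
      by (simp add: mean_def d_def field_simps power2_eq_square)
    have v: "var m a = (1 - m\<^sup>2) / 4 * d\<^sup>2"
      by (simp add: var_def mean_def d_def field_simps power2_eq_square)
    have "((1 - m\<^sup>2) / 2 * d)\<^sup>2 = (1 - m\<^sup>2) * ((1 - m\<^sup>2) / 4 * d\<^sup>2)"
      by (simp add: field_simps power2_eq_square)
    also have "\<dots> \<le> 1 * ((1 - m\<^sup>2) / 4 * d\<^sup>2)"
      using m2 by (intro mult_right_mono) auto
    finally show ?thesis unfolding c v by simp
  qed
  have Eab_ge: "mean m a * mean m' b - \<rho> / 2 * (var m a + var m' b) \<le> E (\<lambda>y z. a y * b z)" for a b
  proof -
    define s where "s = mean m (\<lambda>y. a y * (y - m))"
    define t where "t = mean m' (\<lambda>y. b y * (y - m'))"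
    have "- (s * t) \<le> (s\<^sup>2 + t\<^sup>2) / 2"
      using zero_le_power2[of "s + t"] by (simp add: power2_eq_square field_simps)
    also have "\<dots> \<le> (var m a + var m' b) / 2"
      using cov[OF m(1), of a] cov[OF m(2), of b] by (simp add: s_def t_def)
    finally have "\<rho> * - (s * t) \<le> \<rho> * ((var m a + var m' b) / 2)"
      using \<rho> by (intro mult_left_mono)
    then show ?thesis unfolding Eab by (simp add: s_def t_def algebra_simps)
  qed
  have E\<Phi>: "E \<Phi> = \<rho> * (\<Sum>i\<in>K. E (\<lambda>y z. \<alpha> i y * \<beta> i z)) - mean m h - mean m' k"
  proof -
    have "E (\<lambda>y z. \<Sum>i\<in>K. \<alpha> i y * \<beta> i z) = (\<Sum>i\<in>K. E (\<lambda>y z. \<alpha> i y * \<beta> i z))"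
      by (simp add: E_expand sum_distrib_left sum.distrib)
    moreover have "E \<Phi> = \<rho> * E (\<lambda>y z. \<Sum>i\<in>K. \<alpha> i y * \<beta> i z) - E (\<lambda>y z. h y * 1) - E (\<lambda>y z. 1 * k z)"
      by (simp add: \<Phi>_def E_expand algebra_simps)
    moreover have "E (\<lambda>y z. h y * 1) = mean m h" "E (\<lambda>y z. 1 * k z) = mean m' k"
      by (subst Eab; simp add: mean_def field_simps)+
    ultimately show ?thesis by simp
  qed
  have ER: "\<rho> * m * m' - 2 * \<rho>\<^sup>2 * (m\<^sup>2 + m'\<^sup>2) \<le> E R"
  proof -
    define e where "e = E (\<lambda>y z. y * z)"
    have eq: "E R = \<rho> * (m * m' - \<rho> * (m\<^sup>2 + m'\<^sup>2) + \<rho> * m * m' * e) / (1 - \<rho>\<^sup>2)"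
    proof -
      have a: "E (\<lambda>y z. 1 * z) = m'" "E (\<lambda>y z. y * 1) = m"
        by (subst Eab; simp add: mean_def field_simps)+
      have c: "E R = \<rho> / (1 - \<rho>\<^sup>2) * (m * E (\<lambda>y z. 1 * z) + m' * E (\<lambda>y z. y * 1) - m * m' * E (\<lambda>_ _. 1)
          - \<rho> * (m * E (\<lambda>y z. y * 1) + m' * E (\<lambda>y z. 1 * z) - m * m' * e))"
      proof -
        define C where "C = \<rho> / (1 - \<rho>\<^sup>2)"
        have R_eq: "R = (\<lambda>y z. C * ((m * z + m' * y - m * m') * (1 - \<rho> * y * z)))"
          by (simp add: R_def C_def fun_eq_iff)
        have "E R = C * E (\<lambda>y z. (m * z + m' * y - m * m') * (1 - \<rho> * y * z))"
          unfolding E_expand R_eq by (simp add: algebra_simps)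
        also have "E (\<lambda>y z. (m * z + m' * y - m * m') * (1 - \<rho> * y * z)) =
            m * E (\<lambda>y z. 1 * z) + m' * E (\<lambda>y z. y * 1) - m * m' * E (\<lambda>_ _. 1)
          - \<rho> * (m * E (\<lambda>y z. y * 1) + m' * E (\<lambda>y z. 1 * z) - m * m' * e)"
          by (simp add: E_expand e_def algebra_simps)
        finally show ?thesis by (simp add: C_def)
      qed
      show ?thesis unfolding c a E1 times_divide_eq_left
        by (rule arg_cong[where f = "\<lambda>x. x / (1 - \<rho>\<^sup>2)"]) (simp add: algebra_simps power2_eq_square)
    qed
    have e: "\<bar>e\<bar> \<le> 1"
    proof -
      have "\<bar>e\<bar> \<le> E (\<lambda>_ _. 1)"
        using p_nonneg[of "-1" "-1"] p_nonneg[of "-1" 1] p_nonneg[of 1 "-1"] p_nonneg[of 1 1]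
        by (simp add: e_def E_expand)
      then show ?thesis by (simp add: E1)
    qed
    have mm: "\<bar>m * m'\<bar> \<le> (m\<^sup>2 + m'\<^sup>2) / 2"
      using zero_le_power2[of "\<bar>m\<bar> - \<bar>m'\<bar>"] by (simp add: power2_eq_square abs_mult algebra_simps)
    have "\<bar>\<rho> * m * m' * e\<bar> = \<rho> * \<bar>m * m'\<bar> * \<bar>e\<bar>"
      using \<rho> by (simp add: abs_mult)
    also have "\<dots> \<le> \<rho> * ((m\<^sup>2 + m'\<^sup>2) / 2) * 1"
      using \<rho> e mm by (intro mult_mono) auto
    finally have "\<bar>\<rho> * m * m' * e\<bar> \<le> \<rho> * ((m\<^sup>2 + m'\<^sup>2) / 2) * 1" .
    then have 1: "m * m' - \<rho> * (3/2 * (m\<^sup>2 + m'\<^sup>2)) \<le> m * m' - \<rho> * (m\<^sup>2 + m'\<^sup>2) + \<rho> * m * m' * e"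
      by (simp add: abs_le_iff algebra_simps)
    \<comment> \<open>The gap between the coefficients 2 and 3/2 pays for the division by
      \<open>1 - \<rho>^2\<close>: what remains has sizes
      \<open>\<rho>^3 * \<bar>m * m'\<bar>\<close> and \<open>\<rho>^4 * X\<close>, and both are
      small against \<open>\<rho>^2 * X / 2\<close> when \<open>\<rho> \<le> 1/4\<close>.\<close>
    have 2: "(\<rho> * m * m' - 2 * \<rho>\<^sup>2 * (m\<^sup>2 + m'\<^sup>2)) * (1 - \<rho>\<^sup>2) \<le> \<rho> * (m * m' - \<rho> * (3/2 * (m\<^sup>2 + m'\<^sup>2)))"
    proof -
      define X where "X = m\<^sup>2 + m'\<^sup>2"
      have X: "0 \<le> X" by (simp add: X_def)
      have "- (m * m') \<le> X / 2" using mm by (simp add: X_def)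
      then have "\<rho>\<^sup>2 * (\<rho> * - (m * m')) \<le> \<rho>\<^sup>2 * (1/4 * (X / 2))"
      proof (intro mult_left_mono)
        show "\<rho> * - (m * m') \<le> 1/4 * (X/2)"
        proof (cases "- (m * m') \<le> 0")
          case True then have "\<rho> * - (m * m') \<le> 0" using \<rho> by (simp add: mult_nonneg_nonpos)
          then show ?thesis using X by simp
        next
          case False then show ?thesis using \<rho> mm by (intro mult_mono) (auto simp: X_def)
        qed
      qed simp
      moreover have "\<rho>\<^sup>2 * (2 * \<rho>\<^sup>2 * X) \<le> \<rho>\<^sup>2 * (2 * (1/16) * X)"
        using X \<rho>2 by (intro mult_left_mono mult_right_mono) auto
      moreover have "0 \<le> \<rho>\<^sup>2 * X" using X by simp
      ultimately have "- (\<rho>\<^sup>2 * (\<rho> * (m * m'))) + \<rho>\<^sup>2 * (2 * \<rho>\<^sup>2 * X) \<le> \<rho>\<^sup>2 * X / 2"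
        by (simp add: algebra_simps)
      then show ?thesis unfolding X_def[symmetric] by (simp add: algebra_simps power2_eq_square)
    qed
    also have "\<dots> \<le> \<rho> * (m * m' - \<rho> * (m\<^sup>2 + m'\<^sup>2) + \<rho> * m * m' * e)"
      using 1 \<rho> by (intro mult_left_mono)
    finally show ?thesis unfolding eq using \<rho>2 by (subst pos_le_divide_eq) auto
  qed
  have "\<rho> * m * m' + \<rho> * (\<Sum>i\<in>K. mean m (\<alpha> i) * mean m' (\<beta> i)) - mean m h - mean m' k
      - \<rho>\<^sup>2 / 2 * (\<Sum>i\<in>K. var m (\<alpha> i) + var m' (\<beta> i)) - 2 * \<rho>\<^sup>2 * (m\<^sup>2 + m'\<^sup>2) \<le> M" (is "?X \<le> M")
  proof -
    define V where "V i = var m (\<alpha> i) + var m' (\<beta> i)" for i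
    have "\<rho> * (\<Sum>i\<in>K. mean m (\<alpha> i) * mean m' (\<beta> i) - \<rho> / 2 * V i)
       \<le> \<rho> * (\<Sum>i\<in>K. E (\<lambda>y z. \<alpha> i y * \<beta> i z))"
      unfolding V_def using \<rho> by (intro mult_left_mono sum_mono Eab_ge)
    moreover have "(\<Sum>i\<in>K. mean m (\<alpha> i) * mean m' (\<beta> i) - \<rho> / 2 * V i)
       = (\<Sum>i\<in>K. mean m (\<alpha> i) * mean m' (\<beta> i)) - \<rho> / 2 * sum V K"
      by (simp only: sum_subtractf sum_distrib_left)
    moreover have "M = E \<Phi> + E R" by (simp add: M_def E_expand algebra_simps)
    ultimately show ?thesis
      using ER E\<Phi> unfolding V_def[symmetric] by (simp add: right_diff_distrib power2_eq_square)
  qed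
  then have "exp ?X \<le> exp M" by simp
  also note jensen
  also have "E (\<lambda>y z. exp (\<Phi> y z + R y z)) \<le> (\<Sum>y\<in>{-1,1}. \<Sum>z\<in>{-1,1}. (1 + \<rho> * y * z) / 4 * ((1 + m * y) * (1 + m' * z)) * exp (\<Phi> y z))"
    unfolding E_def by (intro sum_mono step)
  finally show ?thesis by (simp add: \<Phi>_def)
qed

text \<open>The right-hand side is twice the relative entropy of a bit with mean \<open>m\<close>
  with respect to a fair bit, so this is Pinsker's inequality on two points. The difference of the
  sides vanishes at 0 together with its first derivative, and its second derivative is
  \<open>2 * t^2 / (1 - t^2)\<close>.\<close>

lemma two_point_entropy:
  fixes m :: real
  assumes "\<bar>m\<bar> \<le> 1"
  shows "m\<^sup>2 \<le> (1 - m) * ln (1 - m) + (1 + m) * ln (1 + m)"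
proof -
  define g where "g m = (1 - m) * ln (1 - m) + (1 + m) * ln (1 + m) - m\<^sup>2" for m :: real
  have pos: "0 \<le> g m" if m: "0 \<le> m" "m < 1" for m
  proof -
    have "g 0 \<le> g m"
    proof (rule DERIV_nonneg_imp_nondecreasing[OF m(1)])
      fix x assume x: "0 \<le> x" "x \<le> m"
      then have x1: "x < 1" using m by simp
      have d: "DERIV g x :> ln (1 + x) - ln (1 - x) - 2 * x"
        unfolding g_def using x x1
        by (auto intro!: derivative_eq_intros)
      have "0 \<le> ln (1 + x) - ln (1 - x) - 2 * x"
      proof -
        define f where "f x = ln (1 + x) - ln (1 - x) - 2 * x" for x :: real
        have "f 0 \<le> f x"
        proof (rule DERIV_nonneg_imp_nondecreasing[OF x(1)])
          fix t assume t: "0 \<le> t" "t \<le> x"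
          then have t1: "t < 1" using x1 by simp
          have d: "DERIV f t :> 1 / (1 + t) + 1 / (1 - t) - 2"
            unfolding f_def using t t1
            by (auto intro!: derivative_eq_intros)
          have "1 / (1 + t) + 1 / (1 - t) - 2 = 2 * t\<^sup>2 / (1 - t\<^sup>2)"
          proof -
            define D where "D = 1 - t\<^sup>2"
            have D: "D = (1 + t) * (1 - t)" "D \<noteq> 0"
              using t t1 by (auto simp: D_def power2_eq_square algebra_simps square_eq_1_iff)
            have "1 / (1 + t) + 1 / (1 - t) = 2 / D"
              using t t1 by (simp add: D add_frac_eq)
            then have "1 / (1 + t) + 1 / (1 - t) - 2 = (2 - 2 * D) / D"
              using D(2) by (simp add: diff_divide_distrib)
            then show ?thesis by (simp add: D_def)
          qed
          moreover have "0 \<le> 2 * t\<^sup>2 / (1 - t\<^sup>2)"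
            using t t1 by (intro divide_nonneg_nonneg) (auto simp: power_le_one)
          ultimately show "\<exists>y. DERIV f t :> y \<and> y \<ge> 0" using d by metis
        qed
        then show ?thesis by (simp add: f_def)
      qed
      then show "\<exists>y. DERIV g x :> y \<and> y \<ge> 0" using d by blast
    qed
    then show ?thesis by (simp add: g_def)
  qed
  have "0 \<le> g \<bar>m\<bar>"
  proof (cases "\<bar>m\<bar> = 1")
    \<comment> \<open>At the endpoint the logarithm of 0 is multiplied by 0, and what is left is
      \<open>2 * ln 2 \<ge> 1\<close>.\<close>
    case True
    have "exp (1/2::real) \<le> 1 + 1/2 + (1/2)\<^sup>2" by (rule exp_bound) auto
    also have "\<dots> \<le> 2" by (simp add: power2_eq_square)
    finally have "1/2 \<le> ln (2::real)" using ln_le_cancel_iff[of "exp (1/2::real)" 2] by simp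
    then show ?thesis by (simp add: g_def True)
  qed (use pos[of "\<bar>m\<bar>"] assms in auto)
  then show ?thesis by (cases "0 \<le> m") (auto simp: g_def)
qed

section \<open>The entropic lower bound for the noise form\<close>

definition spin_corr :: "'a set \<Rightarrow> ('a set \<Rightarrow> real) \<Rightarrow> ('a set \<Rightarrow> real) \<Rightarrow> real" where
  "spin_corr I F G = (\<Sum>e\<in>I. cube_avg I (\<lambda>A. spin A e * F A) * cube_avg I (\<lambda>A. spin A e * G A))"

text \<open>The factor 5 is a balance: a bit with mean \<open>m\<close> has entropy at least
  \<open>m^2 / 2\<close>, so five entropies pay \<open>5/2 * m^2\<close> for each coordinate that is
  integrated out. Of this, \<open>2 * m^2\<close> covers the error of the coupling and
  \<open>m^2 / 2\<close> the new conditional mean that joins the last sum.\<close>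

definition noise_cost :: "real \<Rightarrow> 'a set \<Rightarrow> 'a set \<Rightarrow> ('a set \<Rightarrow> real) \<Rightarrow> ('a \<Rightarrow> 'a set \<Rightarrow> real) \<Rightarrow>
    ('a set \<Rightarrow> real) \<Rightarrow> real" where
  "noise_cost \<rho> I K F \<alpha> h = cube_avg I (\<lambda>A. F A * h A) + 5 * \<rho>\<^sup>2 * cube_avg I (\<lambda>A. F A * ln (F A))
     + \<rho>\<^sup>2 / 2 * (\<Sum>i\<in>K. cube_avg I (\<lambda>A. F A * (\<alpha> i A)\<^sup>2))"

text \<open>
  The auxiliary functions carry what the induction over the coordinates leaves behind when a
  coordinate is integrated out: \<open>\<alpha>\<close> and \<open>\<beta>\<close> are the conditional means, \<open>h\<close> and \<open>k\<close> the accumulated errors.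
\<close>

lemma noise_avg_ge_exp_aux:
  fixes F G :: "'a set \<Rightarrow> real" and \<alpha> \<beta> :: "'a \<Rightarrow> 'a set \<Rightarrow> real" and h k :: "'a set \<Rightarrow> real"
  assumes "finite I" "finite K" "K \<inter> I = {}" "0 \<le> \<rho>" "\<rho> \<le> 1/4"
    and "\<And>A. A \<subseteq> I \<Longrightarrow> 0 \<le> F A" "\<And>A. A \<subseteq> I \<Longrightarrow> 0 \<le> G A"
    and "cube_avg I F = 1" "cube_avg I G = 1"
  shows "exp (\<rho> * (spin_corr I F G + (\<Sum>i\<in>K. cube_avg I (\<lambda>A. F A * \<alpha> i A) * cube_avg I (\<lambda>A. G A * \<beta> i A)))
      - noise_cost \<rho> I K F \<alpha> h - noise_cost \<rho> I K G \<beta> k)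
    \<le> noise_avg \<rho> I (\<lambda>A B. F A * G B * exp (\<rho> * (\<Sum>i\<in>K. \<alpha> i A * \<beta> i B) - h A - k B))"
  using assms
proof (induction I arbitrary: F G \<alpha> \<beta> h k K rule: finite_induct)
  case empty
  have "0 \<le> \<rho>\<^sup>2 / 2 * (\<Sum>i\<in>K. (\<alpha> i {})\<^sup>2)" "0 \<le> \<rho>\<^sup>2 / 2 * (\<Sum>i\<in>K. (\<beta> i {})\<^sup>2)"
    by (intro mult_nonneg_nonneg sum_nonneg; simp)+
  with empty show ?case by (simp add: spin_corr_def noise_cost_def)
next
  case (insert e I)
  note fin = insert.hyps
  have eK: "e \<notin> K" and fK: "finite K" using insert.prems by auto
  define K' where "K' = insert e K"
  define avF where "avF F A = (F A + F (insert e A)) / 2" for F :: "'a set \<Rightarrow> real" and A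
  \<comment> \<open>On the two points over \<open>A\<close> the density is \<open>avF\<close> times
    \<open>1 - mF\<close> and \<open>1 + mF\<close>, so \<open>mF\<close> is the conditional mean of
    the spin at \<open>e\<close>. If \<open>avF\<close> is 0, both values of the nonnegative
    \<open>F\<close> are 0, and the default keeps these identities and the bound by 1.\<close>
  define mF where "mF F A = (if avF F A = 0 then 0 else (F (insert e A) - F A) / (2 * avF F A))"
    for F :: "'a set \<Rightarrow> real" and A
  define cm where "cm F A a = (1 - mF F A) / 2 * a A + (1 + mF F A) / 2 * a (insert e A)"
    for F a :: "'a set \<Rightarrow> real" and A
  define cv where "cv F A a = cm F A (\<lambda>B. (a B)\<^sup>2) - (cm F A a)\<^sup>2" for F a :: "'a set \<Rightarrow> real" and A
  have avm: "avF F A * mF F A = (F (insert e A) - F A) / 2"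
    if "0 \<le> F A" "0 \<le> F (insert e A)" for F :: "'a set \<Rightarrow> real" and A
    using that by (auto simp: mF_def) (auto simp: avF_def)
  have lo: "F A = avF F A * (1 - mF F A)" and hi: "F (insert e A) = avF F A * (1 + mF F A)"
    and av0: "0 \<le> avF F A" and m1: "\<bar>mF F A\<bar> \<le> 1"
    if "0 \<le> F A" "0 \<le> F (insert e A)" for F :: "'a set \<Rightarrow> real" and A
  proof -
    show lo: "F A = avF F A * (1 - mF F A)" and hi: "F (insert e A) = avF F A * (1 + mF F A)"
      using avm[of F A] that by (simp_all add: right_diff_distrib distrib_left) (simp_all add: avF_def field_simps)
    show av0: "0 \<le> avF F A" using that by (simp add: avF_def)
    show "\<bar>mF F A\<bar> \<le> 1"
    proof (cases "avF F A = 0")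
      case False
      then have "0 < avF F A" using av0 by simp
      then show ?thesis using lo hi that by (simp add: zero_le_mult_iff abs_le_iff)
    qed (simp add: mF_def)
  qed
  have cmF: "avF F A * cm F A a = avF (\<lambda>A. F A * a A) A"
    if "0 \<le> F A" "0 \<le> F (insert e A)" for F a A
    using lo[OF that] hi[OF that] by (simp add: cm_def avF_def[of "\<lambda>A. F A * a A"]) (simp add: field_simps)
  \<comment> \<open>Chain rule for the entropy: averaging over \<open>e\<close> leaves the entropy
    of \<open>avF\<close> plus the mean conditional entropy, and the latter is bounded below by
    \<open>two_point_entropy\<close>.\<close>
  have ent: "5 * (avF F A * ln (avF F A)) + 5/2 * (avF F A * (mF F A)\<^sup>2) \<le> 5 * avF (\<lambda>A. F A * ln (F A)) A"
    if F: "0 \<le> F A" "0 \<le> F (insert e A)" for F A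
  proof -
    define a where "a = avF F A"
    define m where "m = mF F A"
    have mul: "a * x * ln (a * x) = a * x * ln a + a * (x * ln x)" if "0 \<le> x" for x
      using that av0[OF F] by (cases "a = 0"; cases "x = 0") (auto simp: a_def ln_mult algebra_simps)
    have "avF (\<lambda>A. F A * ln (F A)) A = (a * (1 - m) * ln (a * (1 - m)) + a * (1 + m) * ln (a * (1 + m))) / 2"
      using lo[OF F] hi[OF F] by (simp add: avF_def[of "\<lambda>A. F A * ln (F A)"] a_def m_def)
    also have "\<dots> = a * ln a + a * ((1 - m) * ln (1 - m) + (1 + m) * ln (1 + m)) / 2"
      using m1[OF F] by (subst (1 2) mul) (auto simp: m_def abs_le_iff field_simps)
    finally have "avF (\<lambda>A. F A * ln (F A)) A = a * ln a + a * ((1 - m) * ln (1 - m) + (1 + m) * ln (1 + m)) / 2" .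
    moreover have "a * m\<^sup>2 \<le> a * ((1 - m) * ln (1 - m) + (1 + m) * ln (1 + m))"
      using av0[OF F] two_point_entropy[OF m1[OF F]] by (intro mult_left_mono) (auto simp: a_def m_def)
    ultimately show ?thesis by (simp add: a_def[symmetric] m_def[symmetric])
  qed
  \<comment> \<open>The integrated coordinate \<open>e\<close> becomes a new auxiliary index whose
    function is the conditional mean of its spin. Older auxiliary functions turn into their
    conditional means, and \<open>h'\<close> is charged with their conditional variances and with
    the coupling error.\<close>
  define \<alpha>' where "\<alpha>' F \<alpha> i A = (if i = e then mF F A else cm F A (\<alpha> i))"
    for F and \<alpha> :: "'a \<Rightarrow> 'a set \<Rightarrow> real" and i A
  define h' where "h' F \<alpha> h A = cm F A h + \<rho>\<^sup>2 / 2 * (\<Sum>i\<in>K. cv F A (\<alpha> i)) + 2 * \<rho>\<^sup>2 * (mF F A)\<^sup>2"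
    for F and \<alpha> :: "'a \<Rightarrow> 'a set \<Rightarrow> real" and h A
  have F0: "0 \<le> F A" "0 \<le> F (insert e A)" and G0: "0 \<le> G A" "0 \<le> G (insert e A)" if "A \<subseteq> I" for A
    using insert.prems(5,6) subset_insertI2[OF that, of e] Set.insert_mono[OF that, of e] by auto
  have ci: "cube_avg (insert e I) a = cube_avg I (avF a)" for a
    using cube_avg_insert[OF fin] by (simp add: avF_def[abs_def])
  have spin_old: "cube_avg I (\<lambda>A. spin A i * avF F A) = cube_avg (insert e I) (\<lambda>A. spin A i * F A)"
    if "i \<in> I" for i F
    unfolding ci using that fin by (intro cube_avg_cong) (auto simp: avF_def spin_def)
  have spin_new: "cube_avg I (\<lambda>A. avF F A * mF F A) = cube_avg (insert e I) (\<lambda>A. spin A e * F A)"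
    if "\<And>A. A \<subseteq> I \<Longrightarrow> 0 \<le> F A" "\<And>A. A \<subseteq> I \<Longrightarrow> 0 \<le> F (insert e A)" for F
    unfolding ci using that fin by (intro cube_avg_cong) (subst avm, auto simp: avF_def spin_def)
  have cm_new: "cube_avg I (\<lambda>A. avF F A * cm F A a) = cube_avg (insert e I) (\<lambda>A. F A * a A)"
    if "\<And>A. A \<subseteq> I \<Longrightarrow> 0 \<le> F A" "\<And>A. A \<subseteq> I \<Longrightarrow> 0 \<le> F (insert e A)" for F a
    unfolding ci using that fin by (intro cube_avg_cong) (auto simp: cmF)
  have corr: "spin_corr (insert e I) F G
      + (\<Sum>i\<in>K. cube_avg (insert e I) (\<lambda>A. F A * \<alpha> i A) * cube_avg (insert e I) (\<lambda>A. G A * \<beta> i A))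
    = spin_corr I (avF F) (avF G)
      + (\<Sum>i\<in>K'. cube_avg I (\<lambda>A. avF F A * \<alpha>' F \<alpha> i A) * cube_avg I (\<lambda>A. avF G A * \<alpha>' G \<beta> i A))"
  proof -
    have "(\<Sum>i\<in>K. cube_avg I (\<lambda>A. avF F A * \<alpha>' F \<alpha> i A) * cube_avg I (\<lambda>A. avF G A * \<alpha>' G \<beta> i A))
      = (\<Sum>i\<in>K. cube_avg (insert e I) (\<lambda>A. F A * \<alpha> i A) * cube_avg (insert e I) (\<lambda>A. G A * \<beta> i A))"
    proof (intro sum.cong refl)
      fix i assume "i \<in> K"
      then have "i \<noteq> e" using eK by auto
      then show "cube_avg I (\<lambda>A. avF F A * \<alpha>' F \<alpha> i A) * cube_avg I (\<lambda>A. avF G A * \<alpha>' G \<beta> i A)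
        = cube_avg (insert e I) (\<lambda>A. F A * \<alpha> i A) * cube_avg (insert e I) (\<lambda>A. G A * \<beta> i A)"
        using F0 G0 by (simp add: \<alpha>'_def cm_new)
    qed
    moreover have "cube_avg I (\<lambda>A. avF F A * \<alpha>' F \<alpha> e A) = cube_avg (insert e I) (\<lambda>A. spin A e * F A)"
      "cube_avg I (\<lambda>A. avF G A * \<alpha>' G \<beta> e A) = cube_avg (insert e I) (\<lambda>A. spin A e * G A)"
      using F0 G0 by (auto simp: \<alpha>'_def spin_new)
    ultimately show ?thesis
      using fin eK fK by (simp add: K'_def spin_corr_def spin_old)
  qed
  \<comment> \<open>By the law of total variance the variances charged to \<open>h'\<close> and the
    squares of the new conditional means add up to the old second moments, so the terms over
    \<open>K\<close> cancel exactly. The remaining loss \<open>5/2 * \<rho>^2\<close> times the mean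
    of \<open>(mF F A)^2\<close> is covered by the drop in entropy.\<close>
  have cost: "noise_cost \<rho> I K' (avF F) (\<alpha>' F \<alpha>) (h' F \<alpha> h) \<le> noise_cost \<rho> (insert e I) K F \<alpha> h"
    if F: "\<And>A. A \<subseteq> I \<Longrightarrow> 0 \<le> F A" "\<And>A. A \<subseteq> I \<Longrightarrow> 0 \<le> F (insert e A)" for F h \<alpha>
  proof -
    have "cube_avg I (\<lambda>A. avF F A * h' F \<alpha> h A)
      = cube_avg I (\<lambda>A. avF F A * cm F A h)
        + \<rho>\<^sup>2 / 2 * ((\<Sum>i\<in>K. cube_avg I (\<lambda>A. avF F A * cm F A (\<lambda>B. (\<alpha> i B)\<^sup>2)))
          - (\<Sum>i\<in>K. cube_avg I (\<lambda>A. avF F A * (cm F A (\<alpha> i))\<^sup>2)))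
        + 2 * \<rho>\<^sup>2 * cube_avg I (\<lambda>A. avF F A * (mF F A)\<^sup>2)"
      unfolding cube_avg_sum[symmetric] cube_avg_diff[symmetric] cube_avg_cmult[symmetric] cube_avg_add[symmetric]
      by (intro cube_avg_cong) (simp add: h'_def cv_def algebra_simps sum_distrib_left sum_subtractf)
    moreover have "5 * cube_avg I (\<lambda>A. avF F A * ln (avF F A)) + 5/2 * cube_avg I (\<lambda>A. avF F A * (mF F A)\<^sup>2)
      \<le> 5 * cube_avg (insert e I) (\<lambda>A. F A * ln (F A))"
      unfolding ci cube_avg_cmult[symmetric] cube_avg_add[symmetric]
      by (intro cube_avg_mono ent F)
    then have "\<rho>\<^sup>2 * (5 * cube_avg I (\<lambda>A. avF F A * ln (avF F A)) + 5/2 * cube_avg I (\<lambda>A. avF F A * (mF F A)\<^sup>2))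
      \<le> \<rho>\<^sup>2 * (5 * cube_avg (insert e I) (\<lambda>A. F A * ln (F A)))"
      by (intro mult_left_mono) auto
    moreover have "(\<Sum>i\<in>K. cube_avg I (\<lambda>A. avF F A * (\<alpha>' F \<alpha> i A)\<^sup>2))
      = (\<Sum>i\<in>K. cube_avg I (\<lambda>A. avF F A * (cm F A (\<alpha> i))\<^sup>2))"
      by (intro sum.cong refl cube_avg_cong) (metis \<alpha>'_def eK)
    then have "(\<Sum>i\<in>K'. cube_avg I (\<lambda>A. avF F A * (\<alpha>' F \<alpha> i A)\<^sup>2))
      = (\<Sum>i\<in>K. cube_avg I (\<lambda>A. avF F A * (cm F A (\<alpha> i))\<^sup>2)) + cube_avg I (\<lambda>A. avF F A * (mF F A)\<^sup>2)"
      using eK fK by (simp add: K'_def \<alpha>'_def)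
    ultimately show ?thesis
      by (simp add: noise_cost_def cm_new[where F = F, OF F] algebra_simps)
  qed
  have "exp (\<rho> * (spin_corr (insert e I) F G
      + (\<Sum>i\<in>K. cube_avg (insert e I) (\<lambda>A. F A * \<alpha> i A) * cube_avg (insert e I) (\<lambda>A. G A * \<beta> i A)))
      - noise_cost \<rho> (insert e I) K F \<alpha> h - noise_cost \<rho> (insert e I) K G \<beta> k)
    \<le> exp (\<rho> * (spin_corr I (avF F) (avF G)
      + (\<Sum>i\<in>K'. cube_avg I (\<lambda>A. avF F A * \<alpha>' F \<alpha> i A) * cube_avg I (\<lambda>A. avF G A * \<alpha>' G \<beta> i A)))
      - noise_cost \<rho> I K' (avF F) (\<alpha>' F \<alpha>) (h' F \<alpha> h) - noise_cost \<rho> I K' (avF G) (\<alpha>' G \<beta>) (h' G \<beta> k))"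
    unfolding corr exp_le_cancel_iff by (intro diff_mono cost order_refl F0 G0)
  also have "\<dots> \<le> noise_avg \<rho> I (\<lambda>A B. avF F A * avF G B *
      exp (\<rho> * (\<Sum>i\<in>K'. \<alpha>' F \<alpha> i A * \<alpha>' G \<beta> i B) - h' F \<alpha> h A - h' G \<beta> k B))"
    using insert.prems fin av0 F0 G0
    by (intro insert.IH) (auto simp: K'_def ci[symmetric])
  also have "\<dots> \<le> noise_avg \<rho> (insert e I)
      (\<lambda>A B. F A * G B * exp (\<rho> * (\<Sum>i\<in>K. \<alpha> i A * \<beta> i B) - h A - k B))"
    unfolding noise_avg_insert[OF fin]
  proof (rule noise_avg_mono)
    fix A B assume AB: "A \<subseteq> I" "B \<subseteq> I"
    note FA = F0[OF AB(1)] and GB = G0[OF AB(2)]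
    \<comment> \<open>Translates the sign used by \<open>two_point_noise\<close> into the presence
      of \<open>e\<close>.\<close>
    define \<sigma> where "\<sigma> A y = (if y = (1::real) then insert e A else A)" for A y
    define Q where "Q y z = exp (\<rho> * (\<Sum>i\<in>K. \<alpha> i (\<sigma> A y) * \<beta> i (\<sigma> B z)) - h (\<sigma> A y) - k (\<sigma> B z))" for y z
    have "(\<Sum>i\<in>K'. \<alpha>' F \<alpha> i A * \<alpha>' G \<beta> i B) = mF F A * mF G B + (\<Sum>i\<in>K. cm F A (\<alpha> i) * cm G B (\<beta> i))"
      using eK fK by (auto simp: K'_def \<alpha>'_def intro!: sum.cong)
    then have "avF F A * avF G B * exp (\<rho> * (\<Sum>i\<in>K'. \<alpha>' F \<alpha> i A * \<alpha>' G \<beta> i B) - h' F \<alpha> h A - h' G \<beta> k B)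
      = avF F A * avF G B * exp (\<rho> * mF F A * mF G B + \<rho> * (\<Sum>i\<in>K. cm F A (\<alpha> i) * cm G B (\<beta> i)) - cm F A h - cm G B k
      - \<rho>\<^sup>2 / 2 * (\<Sum>i\<in>K. cv F A (\<alpha> i) + cv G B (\<beta> i)) - 2 * \<rho>\<^sup>2 * ((mF F A)\<^sup>2 + (mF G B)\<^sup>2))"
      by (simp add: h'_def sum.distrib algebra_simps)
    also have "\<dots> \<le> avF F A * avF G B *
        (\<Sum>y\<in>{-1,1}. \<Sum>z\<in>{-1,1}. (1 + \<rho> * y * z) / 4 * ((1 + mF F A * y) * (1 + mF G B * z)) * Q y z)"
    proof (intro mult_left_mono)
      have cm_\<sigma>: "cm F A a = (1 - mF F A) / 2 * a (\<sigma> A (- 1)) + (1 + mF F A) / 2 * a (\<sigma> A 1)" for F A a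
        by (simp add: cm_def \<sigma>_def)
      show "exp (\<rho> * mF F A * mF G B + \<rho> * (\<Sum>i\<in>K. cm F A (\<alpha> i) * cm G B (\<beta> i)) - cm F A h - cm G B k
          - \<rho>\<^sup>2 / 2 * (\<Sum>i\<in>K. cv F A (\<alpha> i) + cv G B (\<beta> i)) - 2 * \<rho>\<^sup>2 * ((mF F A)\<^sup>2 + (mF G B)\<^sup>2))
        \<le> (\<Sum>y\<in>{-1,1}. \<Sum>z\<in>{-1,1}. (1 + \<rho> * y * z) / 4 * ((1 + mF F A * y) * (1 + mF G B * z)) * Q y z)"
        unfolding cv_def cm_\<sigma> Q_def
        by (rule two_point_noise[where \<alpha> = "\<lambda>i y. \<alpha> i (\<sigma> A y)" and \<beta> = "\<lambda>i z. \<beta> i (\<sigma> B z)"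
              and h = "\<lambda>y. h (\<sigma> A y)" and k = "\<lambda>y. k (\<sigma> B y)"])
          (use insert.prems m1[OF FA] m1[OF GB] in auto)
    qed (use av0[OF FA] av0[OF GB] in auto)
    also have "\<dots> = (1 + \<rho>) / 4 * (F A * G B * Q (-1) (-1) + F (insert e A) * G (insert e B) * Q 1 1) +
        (1 - \<rho>) / 4 * (F A * G (insert e B) * Q (-1) 1 + F (insert e A) * G B * Q 1 (-1))"
      unfolding lo[OF FA] lo[OF GB] hi[OF FA] hi[OF GB]
      by (simp add: algebra_simps add_divide_distrib diff_divide_distrib)
    finally show "avF F A * avF G B * exp (\<rho> * (\<Sum>i\<in>K'. \<alpha>' F \<alpha> i A * \<alpha>' G \<beta> i B) - h' F \<alpha> h A - h' G \<beta> k B) \<le>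
       (1 + \<rho>) / 4 * (F A * G B * exp (\<rho> * (\<Sum>i\<in>K. \<alpha> i A * \<beta> i B) - h A - k B) +
          F (insert e A) * G (insert e B) * exp (\<rho> * (\<Sum>i\<in>K. \<alpha> i (insert e A) * \<beta> i (insert e B)) - h (insert e A) - k (insert e B))) +
       (1 - \<rho>) / 4 * (F A * G (insert e B) * exp (\<rho> * (\<Sum>i\<in>K. \<alpha> i A * \<beta> i (insert e B)) - h A - k (insert e B)) +
          F (insert e A) * G B * exp (\<rho> * (\<Sum>i\<in>K. \<alpha> i (insert e A) * \<beta> i B) - h (insert e A) - k B))"
      by (simp add: Q_def \<sigma>_def)
  qed (use insert.prems in auto)
  finally show ?case .
qed

text \<open>The case without auxiliary functions. As \<open>spin_corr\<close> is the inner product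
  of the barycentres of the two densities, this is the cube version of the key estimate.\<close>

lemma noise_avg_ge_exp:
  fixes F G :: "'a set \<Rightarrow> real"
  assumes "finite I" "0 \<le> \<rho>" "\<rho> \<le> 1/4"
    and "\<And>A. A \<subseteq> I \<Longrightarrow> 0 \<le> F A" "\<And>A. A \<subseteq> I \<Longrightarrow> 0 \<le> G A"
    and "cube_avg I F = 1" "cube_avg I G = 1"
  shows "exp (\<rho> * spin_corr I F G
      - 5 * \<rho>\<^sup>2 * (cube_avg I (\<lambda>A. F A * ln (F A)) + cube_avg I (\<lambda>A. G A * ln (G A))))
    \<le> noise_avg \<rho> I (\<lambda>A B. F A * G B)"
  using noise_avg_ge_exp_aux[where K = "{}" and \<alpha> = "\<lambda>_ _. 0" and \<beta> = "\<lambda>_ _. 0"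
      and h = "\<lambda>_. 0" and k = "\<lambda>_. 0", OF assms(1) finite.emptyI _ assms(2-7)]
  by (simp add: noise_cost_def cube_avg_const[OF assms(1)] algebra_simps)

section \<open>Correlation of increasing functions on the cube\<close>

text \<open>The derivative in direction \<open>e\<close> of the multilinear extension. Removing
  \<open>e\<close> explicitly makes the value independent of whether \<open>e\<close> lies in
  \<open>A\<close>.\<close>

definition flip_diff :: "'a \<Rightarrow> ('a set \<Rightarrow> real) \<Rightarrow> 'a set \<Rightarrow> real" where
  "flip_diff e f A = (f (insert e A) - f (A - {e})) / 2"

section \<open>Interpolation in the noise level\<close>

lemma noise_avg_add: "noise_avg \<rho> I (\<lambda>A B. H A B + H' A B) = noise_avg \<rho> I H + noise_avg \<rho> I H'"
  by (simp add: noise_avg_def sum.distrib distrib_left)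

lemma noise_avg_diff: "noise_avg \<rho> I (\<lambda>A B. H A B - H' A B) = noise_avg \<rho> I H - noise_avg \<rho> I H'"
  by (simp add: noise_avg_def sum_subtractf right_diff_distrib)

lemma continuous_on_noise_avg: "continuous_on S (\<lambda>\<rho>. noise_avg \<rho> I H)"
  unfolding noise_avg_def by (intro continuous_intros) auto

text \<open>By the product rule one coordinate is differentiated at a time, and its weight
  \<open>(1 + \<rho> * y * z) / 4\<close> has derivative \<open>y * z / 4\<close>. The resulting
  signed sum no longer depends on the spins at \<open>e\<close>, so it may again be averaged under
  the full noise.\<close>

lemma DERIV_noise_avg:
  fixes H :: "'a set \<Rightarrow> 'a set \<Rightarrow> real"
  assumes "finite I"
  shows "((\<lambda>\<rho>. noise_avg \<rho> I H) has_real_derivative (\<Sum>e\<in>I. noise_avg \<rho> I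
    (\<lambda>A B. (H (insert e A) (insert e B) + H (A - {e}) (B - {e})
      - H (insert e A) (B - {e}) - H (A - {e}) (insert e B)) / 4))) (at \<rho>)"
  using assms
proof (induction I arbitrary: H rule: finite_induct)
  case (insert e I)
  define D where "D e H A B = (H (insert e A) (insert e B) + H (A - {e}) (B - {e})
      - H (insert e A) (B - {e}) - H (A - {e}) (insert e B)) / 4"
    for e and H :: "'a set \<Rightarrow> 'a set \<Rightarrow> real" and A B
  \<comment> \<open>\<open>X\<close> collects the pairs that agree at \<open>e\<close> and
    \<open>Y\<close> those that disagree; their weights have derivatives 1/4 and -1/4.\<close>
  define X where "X H A B = H A B + H (insert e A) (insert e B)" for H :: "'a set \<Rightarrow> 'a set \<Rightarrow> real" and A B
  define Y where "Y H A B = H A (insert e B) + H (insert e A) B" for H :: "'a set \<Rightarrow> 'a set \<Rightarrow> real" and A B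
  have split: "noise_avg \<rho> (insert e I) H = (1 + \<rho>) / 4 * noise_avg \<rho> I (X H) + (1 - \<rho>) / 4 * noise_avg \<rho> I (Y H)" for \<rho> H
    unfolding noise_avg_insert[OF insert.hyps] noise_avg_add noise_avg_cmult X_def Y_def ..
  have IH: "((\<lambda>\<rho>. noise_avg \<rho> I H) has_real_derivative (\<Sum>i\<in>I. noise_avg \<rho> I (D i H))) (at \<rho>)" for H
    using insert.IH by (simp add: D_def[abs_def])
  have new: "noise_avg \<rho> (insert e I) (D e H) = (noise_avg \<rho> I (X H) - noise_avg \<rho> I (Y H)) / 4"
  proof -
    have *: "X (D e H) A B = 1/2 * (X H A B - Y H A B)" "Y (D e H) A B = 1/2 * (X H A B - Y H A B)"
      if "A \<subseteq> I" "B \<subseteq> I" for A B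
    proof -
      have "e \<notin> A" "e \<notin> B" using that insert.hyps by auto
      then show "X (D e H) A B = 1/2 * (X H A B - Y H A B)" "Y (D e H) A B = 1/2 * (X H A B - Y H A B)"
        by (simp_all add: D_def X_def Y_def)
    qed
    have XD: "noise_avg \<rho> I (X (D e H)) = noise_avg \<rho> I (\<lambda>A B. 1/2 * (X H A B - Y H A B))"
     and YD: "noise_avg \<rho> I (Y (D e H)) = noise_avg \<rho> I (\<lambda>A B. 1/2 * (X H A B - Y H A B))"
      by (intro noise_avg_cong *; assumption)+
    show ?thesis unfolding split XD YD noise_avg_cmult noise_avg_diff by (simp add: field_simps)
  qed
  have old: "noise_avg \<rho> (insert e I) (D i H)
      = (1 + \<rho>) / 4 * noise_avg \<rho> I (D i (X H)) + (1 - \<rho>) / 4 * noise_avg \<rho> I (D i (Y H))"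
    if "i \<in> I" for i
  proof -
    have "i \<noteq> e" using that insert.hyps by auto
    then have d: "insert e A - {i} = insert e (A - {i})" for A by auto
    have "X (D i H) = D i (X H)" "Y (D i H) = D i (Y H)"
      by (auto simp: fun_eq_iff X_def Y_def D_def d insert_commute add_divide_distrib diff_divide_distrib)
    then show ?thesis unfolding split by simp
  qed
  have fe: "(\<lambda>\<rho>. noise_avg \<rho> (insert e I) H)
      = (\<lambda>\<rho>. (1 + \<rho>) / 4 * noise_avg \<rho> I (X H) + (1 - \<rho>) / 4 * noise_avg \<rho> I (Y H))"
    by (simp only: split)
  have d: "((\<lambda>\<rho>. (1 + \<rho>) / 4) has_real_derivative 1/4) (at \<rho>)"
    "((\<lambda>\<rho>. (1 - \<rho>) / 4) has_real_derivative - (1/4)) (at \<rho>)" for \<rho> :: real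
    by (auto intro!: derivative_eq_intros)
  have sums: "(\<Sum>i\<in>insert e I. noise_avg \<rho> (insert e I) (D i H)) =
     1/4 * noise_avg \<rho> I (X H) + (\<Sum>i\<in>I. noise_avg \<rho> I (D i (X H))) * ((1 + \<rho>) / 4)
   + (- (1/4) * noise_avg \<rho> I (Y H) + (\<Sum>i\<in>I. noise_avg \<rho> I (D i (Y H))) * ((1 - \<rho>) / 4))"
    using insert.hyps by (simp add: new old sum.distrib sum_distrib_right sum_distrib_left mult.commute cong: sum.cong)
  have "((\<lambda>\<rho>. noise_avg \<rho> (insert e I) H) has_real_derivative
     (\<Sum>i\<in>insert e I. noise_avg \<rho> (insert e I) (D i H))) (at \<rho>)"
    unfolding fe sums by (intro DERIV_add DERIV_mult IH d)
  then show ?case unfolding D_def .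
qed simp

text \<open>The noise form is the product of the averages at level 0 and the average of the product
  at level 1, so the correlation is the integral of the derivative. Its summands are nonnegative for
  increasing functions, and each integral can be cut off at its own level
  \<open>r e\<close>.\<close>

lemma cube_cor_ge_sum:
  fixes f g :: "'a set \<Rightarrow> real"
  assumes I: "finite I"
    and pos: "\<And>e A. e \<in> I \<Longrightarrow> A \<subseteq> I \<Longrightarrow> 0 \<le> flip_diff e f A" "\<And>e A. e \<in> I \<Longrightarrow> A \<subseteq> I \<Longrightarrow> 0 \<le> flip_diff e g A"
    and r: "\<And>e. e \<in> I \<Longrightarrow> 0 \<le> r e \<and> r e \<le> 1"
    and \<kappa>: "\<And>e \<rho>. e \<in> I \<Longrightarrow> 0 \<le> \<rho> \<Longrightarrow> \<rho> \<le> r e \<Longrightarrow>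
      \<kappa> e \<le> noise_avg \<rho> I (\<lambda>A B. flip_diff e f A * flip_diff e g B)"
  shows "(\<Sum>e\<in>I. r e * \<kappa> e) \<le> cube_avg I (\<lambda>A. f A * g A) - cube_avg I f * cube_avg I g"
proof -
  define \<phi> where "\<phi> e \<rho> = noise_avg \<rho> I (\<lambda>A B. flip_diff e f A * flip_diff e g B)" for e \<rho>
  have cont: "continuous_on S (\<phi> e)" for S e
    unfolding \<phi>_def[abs_def] by (rule continuous_on_noise_avg)
  have int: "\<phi> e integrable_on {a..b}" for e a b
    by (intro integrable_continuous_interval cont)
  have D: "((\<lambda>\<rho>. noise_avg \<rho> I (\<lambda>A B. f A * g B)) has_real_derivative (\<Sum>e\<in>I. \<phi> e \<rho>)) (at \<rho>)" for \<rho>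
  proof -
    have "(\<lambda>A B. (f (insert e A) * g (insert e B) + f (A - {e}) * g (B - {e})
      - f (insert e A) * g (B - {e}) - f (A - {e}) * g (insert e B)) / 4)
      = (\<lambda>A B. flip_diff e f A * flip_diff e g B)" for e
      by (auto simp: flip_diff_def fun_eq_iff field_simps)
    then show ?thesis using DERIV_noise_avg[OF I, of "\<lambda>A B. f A * g B" \<rho>] by (simp add: \<phi>_def)
  qed
  have "((\<lambda>\<rho>. \<Sum>e\<in>I. \<phi> e \<rho>) has_integral
      (noise_avg 1 I (\<lambda>A B. f A * g B) - noise_avg 0 I (\<lambda>A B. f A * g B))) {0..1}"
    by (intro fundamental_theorem_of_calculus)
      (auto intro!: has_field_derivative_at_within D simp: has_real_derivative_iff_has_vector_derivative[symmetric])
  moreover have "((\<lambda>\<rho>. \<Sum>e\<in>I. \<phi> e \<rho>) has_integral (\<Sum>e\<in>I. integral {0..1} (\<phi> e))) {0..1}"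
    using I int by (intro has_integral_sum) (auto simp: has_integral_integral[symmetric])
  ultimately have "noise_avg 1 I (\<lambda>A B. f A * g B) - noise_avg 0 I (\<lambda>A B. f A * g B)
      = (\<Sum>e\<in>I. integral {0..1} (\<phi> e))"
    by (rule has_integral_unique)
  then have eq: "cube_avg I (\<lambda>A. f A * g A) - cube_avg I f * cube_avg I g = (\<Sum>e\<in>I. integral {0..1} (\<phi> e))"
    by (simp only: noise_avg_0[OF I] noise_avg_1[OF I])
  show ?thesis unfolding eq
  proof (rule sum_mono)
    fix e assume e: "e \<in> I"
    have re: "0 \<le> r e" "r e \<le> 1" using r[OF e] by auto
    have nn: "0 \<le> \<phi> e \<rho>" if "\<rho> \<in> {0..1}" for \<rho>
      unfolding \<phi>_def using that pos e by (intro noise_avg_nonneg mult_nonneg_nonneg) auto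
    have "r e * \<kappa> e = integral {0..r e} (\<lambda>_. \<kappa> e)" using re by simp
    also have "\<dots> \<le> integral {0..r e} (\<phi> e)"
      using \<kappa>[OF e] by (intro integral_le int) (auto simp: \<phi>_def)
    also have "\<dots> \<le> integral {0..1} (\<phi> e)"
      using re nn by (intro integral_subset_le int) auto
    finally show "r e * \<kappa> e \<le> integral {0..1} (\<phi> e)" .
  qed
qed

text \<open>A lower bound for the noise form of two derivatives at all levels up to
  \<open>r\<close>, where \<open>a\<close>, \<open>b\<close> are their means, \<open>L\<close> is an
  upper bound for both and \<open>q\<close> is the inner product of their degree-1 coefficients. The
  absolute value is there because \<open>q\<close> may be negative. Scaling \<open>L\<close>,
  \<open>a\<close>, \<open>b\<close> by \<open>t\<close> and \<open>q\<close> by \<open>t^2\<close>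
  multiplies the value by \<open>t^2\<close>, for \<open>t > 0\<close>; this lets the block size
  drop out later.\<close>

definition cor_gain :: "real \<Rightarrow> real \<Rightarrow> real \<Rightarrow> real \<Rightarrow> real \<Rightarrow> real" where
  "cor_gain r L a b q = (if 0 < a \<and> 0 < b
     then a * b * exp (- (r * (\<bar>q\<bar> / (a * b))) - 5 * r\<^sup>2 * (ln (L / a) + ln (L / b))) else 0)"

lemma noise_avg_mult_ge:
  fixes F G :: "'a set \<Rightarrow> real"
  assumes I: "finite I" and \<rho>: "0 \<le> \<rho>" "\<rho> \<le> r" "r \<le> 1/4"
    and F: "\<And>A. A \<subseteq> I \<Longrightarrow> 0 \<le> F A" "\<And>A. A \<subseteq> I \<Longrightarrow> F A \<le> M"
    and G: "\<And>A. A \<subseteq> I \<Longrightarrow> 0 \<le> G A" "\<And>A. A \<subseteq> I \<Longrightarrow> G A \<le> M"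
    and a: "0 < a" "cube_avg I F = a" and b: "0 < b" "cube_avg I G = b"
    and q: "spin_corr I F G = q"
  shows "cor_gain r M a b q \<le> noise_avg \<rho> I (\<lambda>A B. F A * G B)"
proof -
  \<comment> \<open>The logarithm of a density bounded by \<open>M / a\<close> is at most
    \<open>ln (M / a)\<close> wherever the density is positive, hence so is its entropy.\<close>
  have ent: "cube_avg I (\<lambda>A. F A / a * ln (F A / a)) \<le> ln (M / a)" and lnM: "0 \<le> ln (M / a)"
    if "\<And>A. A \<subseteq> I \<Longrightarrow> 0 \<le> F A" "\<And>A. A \<subseteq> I \<Longrightarrow> F A \<le> M" "0 < a" "cube_avg I F = a"
    for F :: "'a set \<Rightarrow> real" and a
  proof -
    have "a \<le> M" using cube_avg_mono[of I F "\<lambda>_. M"] that by (simp add: cube_avg_const[OF I])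
    then have M: "0 < M" "1 \<le> M / a" using that by auto
    then show "0 \<le> ln (M / a)" by simp
    have "cube_avg I (\<lambda>A. F A / a * ln (F A / a)) \<le> cube_avg I (\<lambda>A. ln (M / a) / a * F A)"
    proof (rule cube_avg_mono)
      fix A assume A: "A \<subseteq> I"
      show "F A / a * ln (F A / a) \<le> ln (M / a) / a * F A"
      proof (cases "F A = 0")
        case False
        then have "0 < F A" using that(1)[OF A] by simp
        moreover have "F A / a \<le> M / a" using that(2)[OF A] that(3) by (simp add: divide_right_mono)
        ultimately have "F A / a * ln (F A / a) \<le> F A / a * ln (M / a)"
          using that(3) M by (intro mult_left_mono) auto
        then show ?thesis by (simp add: mult.commute)
      qed simp
    qed
    also have "\<dots> = ln (M / a)" using that by (subst cube_avg_cmult) simp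
    finally show "cube_avg I (\<lambda>A. F A / a * ln (F A / a)) \<le> ln (M / a)" .
  qed
  have sc: "cube_avg I (\<lambda>A. spin A e * (F A / a)) = cube_avg I (\<lambda>A. spin A e * F A) / a" for e a and F
    using cube_avg_cmult[of I "1 / a" "\<lambda>A. spin A e * F A"] by simp
  have av: "cube_avg I (\<lambda>A. F A / a) = cube_avg I F / a" for a and F
    using cube_avg_cmult[of I "1 / a" F] by simp
  have s: "spin_corr I (\<lambda>A. F A / a) (\<lambda>A. G A / b) = q / (a * b)"
    by (simp only: spin_corr_def sc q[symmetric] sum_divide_distrib times_divide_times_eq)
  have key: "exp (\<rho> * (q / (a * b)) - 5 * \<rho>\<^sup>2 * (cube_avg I (\<lambda>A. F A / a * ln (F A / a)) + cube_avg I (\<lambda>A. G A / b * ln (G A / b))))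
    \<le> noise_avg \<rho> I (\<lambda>A B. (F A / a) * (G B / b))"
    unfolding s[symmetric] using F G a b \<rho> by (intro noise_avg_ge_exp I) (auto simp: av)
  have "- (r * (\<bar>q\<bar> / (a * b))) \<le> \<rho> * (q / (a * b))"
  proof -
    have "- (\<rho> * (q / (a * b))) \<le> \<rho> * \<bar>q / (a * b)\<bar>"
      using \<rho> by (metis abs_ge_minus_self minus_mult_right mult_left_mono)
    also have "\<dots> \<le> r * \<bar>q / (a * b)\<bar>" using \<rho> by (intro mult_right_mono) auto
    finally show ?thesis using a b by (simp add: abs_mult)
  qed
  moreover have "5 * \<rho>\<^sup>2 * (cube_avg I (\<lambda>A. F A / a * ln (F A / a)) + cube_avg I (\<lambda>A. G A / b * ln (G A / b)))
    \<le> 5 * r\<^sup>2 * (ln (M / a) + ln (M / b))"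
  proof -
    have "5 * \<rho>\<^sup>2 * (cube_avg I (\<lambda>A. F A / a * ln (F A / a)) + cube_avg I (\<lambda>A. G A / b * ln (G A / b)))
      \<le> 5 * \<rho>\<^sup>2 * (ln (M / a) + ln (M / b))"
      using F G a b by (intro mult_left_mono add_mono ent) auto
    also have "\<dots> \<le> 5 * r\<^sup>2 * (ln (M / a) + ln (M / b))"
      using \<rho> lnM[OF F a] lnM[OF G b] by (intro mult_right_mono mult_left_mono power_mono) auto
    finally show ?thesis .
  qed
  ultimately have "exp (- (r * (\<bar>q\<bar> / (a * b))) - 5 * r\<^sup>2 * (ln (M / a) + ln (M / b)))
     \<le> noise_avg \<rho> I (\<lambda>A B. (F A / a) * (G B / b))"
    by (intro order_trans[OF _ key]) simp
  also have "\<dots> = noise_avg \<rho> I (\<lambda>A B. F A * G B) / (a * b)"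
    using noise_avg_cmult[of \<rho> I "1 / (a * b)" "\<lambda>A B. F A * G B"] by simp
  finally show ?thesis using a b by (simp add: cor_gain_def pos_le_divide_eq mult.commute)
qed

section \<open>Low-degree coefficients and exchangeability of coordinates\<close>

lemma spin_square [simp]: "spin A e * spin A e = 1"
  by (simp add: spin_def)

lemma cube_avg_reduce:
  assumes "finite I" "e \<in> I"
  shows "cube_avg I F = cube_avg (I - {e}) (\<lambda>A. (F A + F (insert e A)) / 2)"
  using cube_avg_insert[of "I - {e}" e F] assms by (simp add: insert_absorb)

lemma cube_avg_flip_diff:
  assumes "finite I" "e \<in> I"
  shows "cube_avg I (flip_diff e f) = cube_avg I (\<lambda>A. spin A e * f A)"
  unfolding cube_avg_reduce[OF assms]
proof (rule cube_avg_cong)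
  fix A assume "A \<subseteq> I - {e}"
  then have "e \<notin> A" by auto
  then show "(flip_diff e f A + flip_diff e f (insert e A)) / 2
    = (spin A e * f A + spin (insert e A) e * f (insert e A)) / 2"
    by (simp add: flip_diff_def spin_def)
qed

text \<open>Degree-1 coefficients of a derivative are degree-2 coefficients of the function. The
  coefficient at \<open>e\<close> itself vanishes since the derivative does not depend on that spin;
  this missing term is the discrete origin of the subtracted identity matrix in the second Hermite
  tensor.\<close>

lemma cube_avg_spin_flip_diff:
  assumes "finite I" "e \<in> I" "e' \<in> I"
  shows "cube_avg I (\<lambda>A. spin A e' * flip_diff e f A)
    = (if e' = e then 0 else cube_avg I (\<lambda>A. spin A e * (spin A e' * f A)))"
proof -
  have "cube_avg I (\<lambda>A. spin A e' * flip_diff e f A)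
    = cube_avg I (\<lambda>A. if e' = e then 0 else spin A e * (spin A e' * f A))"
    unfolding cube_avg_reduce[OF assms(1,2)]
  proof (rule cube_avg_cong)
    fix A assume "A \<subseteq> I - {e}"
    then have "e \<notin> A" by auto
    then show "(spin A e' * flip_diff e f A + spin (insert e A) e' * flip_diff e f (insert e A)) / 2
      = ((if e' = e then 0 else spin A e * (spin A e' * f A)) +
         (if e' = e then 0 else spin (insert e A) e * (spin (insert e A) e' * f (insert e A)))) / 2"
      by (auto simp: flip_diff_def spin_def)
  qed
  then show ?thesis using cube_avg_const[OF assms(1), of 0] by auto
qed

lemma cube_avg_transpose:
  assumes "e \<in> I" "e' \<in> I"
  shows "cube_avg I (\<lambda>A. F (Transposition.transpose e e' ` A)) = cube_avg I F"
proof -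
  have tr: "Transposition.transpose e e' x \<in> I" if "x \<in> I" for x
    using assms that by (cases "x = e"; cases "x = e'") auto
  have "bij_betw (image (Transposition.transpose e e')) (Pow I) (Pow I)"
    by (rule bij_betwI[of _ _ _ "image (Transposition.transpose e e')"])
      (use assms in \<open>auto simp: image_image tr subset_iff\<close>)
  then show ?thesis
    unfolding cube_avg_def by (subst sum.reindex_bij_betw) auto
qed

lemma spin_transpose: "spin (Transposition.transpose e e' ` A) x = spin A (Transposition.transpose e e' x)"
proof -
  have "x \<in> Transposition.transpose e e' ` A \<longleftrightarrow> Transposition.transpose e e' x \<in> A"
    by (metis image_iff transpose_involutory)
  then show ?thesis by (simp add: spin_def)
qed

text \<open>Exchanging two coordinates preserves the uniform measure and the given \<open>f\<close>,
  but moves one spin to the other.\<close>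

lemma cube_avg_spin_swap:
  assumes "e \<in> I" "e' \<in> I" "\<And>A. A \<subseteq> I \<Longrightarrow> f (Transposition.transpose e e' ` A) = f A"
  shows "cube_avg I (\<lambda>A. spin A e * f A) = cube_avg I (\<lambda>A. spin A e' * f A)"
  using cube_avg_transpose[OF assms(1,2), of "\<lambda>A. spin A e * f A"]
    cube_avg_cong[of I "\<lambda>A. spin (Transposition.transpose e e' ` A) e * f (Transposition.transpose e e' ` A)" "\<lambda>A. spin A e' * f A"] assms(3)
  by (simp add: spin_transpose)

section \<open>Blocks of signs as approximate Gaussian coordinates\<close>

definition block_sum :: "nat \<Rightarrow> (nat \<times> nat) set \<Rightarrow> nat \<Rightarrow> real" where
  "block_sum N A i = (\<Sum>j<N. spin A (i, j)) / sqrt (real N)"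

lemma block_sum_transpose:
  assumes "j < N" "l < N"
  shows "block_sum N (Transposition.transpose (i, j) (i, l) ` A) k = block_sum N A k"
proof -
  have "(\<Sum>j'<N. spin (Transposition.transpose (i, j) (i, l) ` A) (k, j')) = (\<Sum>j'<N. spin A (k, j'))"
  proof (cases "k = i")
    case True
    have "bij_betw (Transposition.transpose j l) {..<N} {..<N}"
      by (rule bij_betwI[of _ _ _ "Transposition.transpose j l"])
        (use assms in \<open>auto simp: Transposition.transpose_def\<close>)
    moreover have "Transposition.transpose (i, j) (i, l) (i, j') = (i, Transposition.transpose j l j')" for j'
      by (auto simp: Transposition.transpose_def)
    ultimately show ?thesis
      unfolding spin_transpose True by (simp add: sum.reindex_bij_betw[where g = "\<lambda>j'. spin A (i, j')"])
  next
    case False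
    then have "Transposition.transpose (i, j) (i, l) (k, j') = (k, j')" for j'
      by (auto simp: Transposition.transpose_def)
    then show ?thesis unfolding spin_transpose by simp
  qed
  then show ?thesis by (simp add: block_sum_def)
qed

lemma block_sum_insert:
  assumes "j < N"
  shows "block_sum N (insert (i, j) A) k = block_sum N (A - {(i, j)}) k + (if k = i then 2 / sqrt N else 0)"
proof -
  have "spin (insert (i, j) A) (k, j') = spin (A - {(i, j)}) (k, j') + (if j' = j then if k = i then 2 else 0 else 0)" for j'
    by (auto simp: spin_def)
  then have "(\<Sum>j'<N. spin (insert (i, j) A) (k, j')) = (\<Sum>j'<N. spin (A - {(i, j)}) (k, j')) + (if k = i then 2 else 0)"
    using assms by (simp add: sum.distrib)
  then show ?thesis by (simp add: block_sum_def add_divide_distrib)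
qed

text \<open>By exchangeability the \<open>N\<close> coefficients of a block coincide, so each is the
  \<open>N\<close>-th part of their sum, and the spins of the block add up to \<open>sqrt N\<close>
  times the block sum.\<close>

lemma cube_avg_spin_block:
  assumes "i < n" "j < N"
    and f: "\<And>l A. l < N \<Longrightarrow> f (Transposition.transpose (i, j) (i, l) ` A) = f A"
  shows "sqrt N * cube_avg ({..<n} \<times> {..<N}) (\<lambda>A. spin A (i, j) * f A)
    = cube_avg ({..<n} \<times> {..<N}) (\<lambda>A. block_sum N A i * f A)"
proof -
  define I where "I = {..<n} \<times> {..<N}"
  have "cube_avg I (\<lambda>A. block_sum N A i * f A) = cube_avg I (\<lambda>A. (1 / sqrt N) * (\<Sum>l<N. spin A (i, l) * f A))"
    by (simp add: block_sum_def sum_distrib_right)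
  also have "\<dots> = (1 / sqrt N) * (\<Sum>l<N. cube_avg I (\<lambda>A. spin A (i, l) * f A))"
    by (simp only: cube_avg_cmult cube_avg_sum)
  also have "(\<Sum>l<N. cube_avg I (\<lambda>A. spin A (i, l) * f A)) = (\<Sum>l<N. cube_avg I (\<lambda>A. spin A (i, j) * f A))"
    using assms by (intro sum.cong refl cube_avg_spin_swap[symmetric]) (auto simp: I_def)
  finally have "cube_avg I (\<lambda>A. block_sum N A i * f A) = real N / sqrt N * cube_avg I (\<lambda>A. spin A (i, j) * f A)"
    by simp
  then show ?thesis by (simp add: I_def real_div_sqrt)
qed

text \<open>Expanding one block sum in the average of its square leaves \<open>N - 1\<close> equal
  mixed coefficients and one diagonal term, where the two spins cancel and the plain average of
  \<open>f\<close> remains.\<close>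

lemma cube_avg_spin_spin_block:
  assumes "i < n" "j < N" "l < N" "l \<noteq> j"
    and f: "\<And>j l A. j < N \<Longrightarrow> l < N \<Longrightarrow> f (Transposition.transpose (i, j) (i, l) ` A) = f A"
  shows "(real N - 1) * cube_avg ({..<n} \<times> {..<N}) (\<lambda>A. spin A (i, j) * (spin A (i, l) * f A))
    = cube_avg ({..<n} \<times> {..<N}) (\<lambda>A. (block_sum N A i)\<^sup>2 * f A) - cube_avg ({..<n} \<times> {..<N}) f"
proof -
  define I where "I = {..<n} \<times> {..<N}"
  define c where "c = cube_avg I (\<lambda>A. spin A (i, j) * (spin A (i, l) * f A))"
  have "cube_avg I (\<lambda>A. (block_sum N A i)\<^sup>2 * f A) = sqrt N * cube_avg I (\<lambda>A. spin A (i, j) * (block_sum N A i * f A))"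
    unfolding I_def using assms
    by (subst cube_avg_spin_block) (auto simp: block_sum_transpose power2_eq_square mult.assoc)
  also have "\<dots> = cube_avg I (\<lambda>A. \<Sum>l'<N. spin A (i, j) * (spin A (i, l') * f A))"
    unfolding cube_avg_cmult[symmetric]
  proof (rule cube_avg_cong)
    fix A
    have "sqrt N * (spin A (i, j) * (block_sum N A i * f A)) = spin A (i, j) * ((\<Sum>l'<N. spin A (i, l')) * f A)"
      using assms by (simp add: block_sum_def)
    then show "sqrt N * (spin A (i, j) * (block_sum N A i * f A)) = (\<Sum>l'<N. spin A (i, j) * (spin A (i, l') * f A))"
      by (simp add: sum_distrib_right sum_distrib_left)
  qed
  also have "\<dots> = (\<Sum>l'<N. cube_avg I (\<lambda>A. spin A (i, l') * (spin A (i, j) * f A)))"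
    by (simp add: cube_avg_sum mult.left_commute)
  also have "\<dots> = cube_avg I (\<lambda>A. spin A (i, j) * (spin A (i, j) * f A))
      + (\<Sum>l'\<in>{..<N} - {j}. cube_avg I (\<lambda>A. spin A (i, l') * (spin A (i, j) * f A)))"
    using assms by (intro sum.remove) auto
  also have "(\<Sum>l'\<in>{..<N} - {j}. cube_avg I (\<lambda>A. spin A (i, l') * (spin A (i, j) * f A)))
      = (\<Sum>l'\<in>{..<N} - {j}. c)"
  proof (intro sum.cong refl)
    fix l' assume l': "l' \<in> {..<N} - {j}"
    have "cube_avg I (\<lambda>A. spin A (i, l') * (spin A (i, j) * f A)) = cube_avg I (\<lambda>A. spin A (i, l) * (spin A (i, j) * f A))"
      using assms l' by (intro cube_avg_spin_swap) (auto simp: I_def spin_transpose Transposition.transpose_def[of _ _ "(i, j)"])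
    then show "cube_avg I (\<lambda>A. spin A (i, l') * (spin A (i, j) * f A)) = c"
      by (simp add: c_def mult.left_commute)
  qed
  also have "(\<Sum>l'\<in>{..<N} - {j}. c) = (real N - 1) * c"
    using assms by simp
  also have "cube_avg I (\<lambda>A. spin A (i, j) * (spin A (i, j) * f A)) = cube_avg I f"
    by (simp add: mult.assoc[symmetric])
  finally show ?thesis by (simp add: c_def I_def)
qed

definition grid_avg :: "nat \<Rightarrow> nat \<Rightarrow> ((nat \<Rightarrow> real) \<Rightarrow> real) \<Rightarrow> real" where
  "grid_avg n N u = cube_avg ({..<n} \<times> {..<N}) (\<lambda>A. u (restrict (block_sum N A) {..<n}))"

definition lipschitz_incr :: "nat \<Rightarrow> real \<Rightarrow> ((nat \<Rightarrow> real) \<Rightarrow> real) \<Rightarrow> bool" where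
  "lipschitz_incr n L u \<longleftrightarrow> (\<forall>x \<in> {..<n} \<rightarrow>\<^sub>E UNIV. \<forall>i<n. \<forall>t. x i \<le> t \<longrightarrow>
     u x \<le> u (x(i := t)) \<and> u (x(i := t)) \<le> u x + L * (t - x i))"

text \<open>A flip moves one block sum by \<open>2 / sqrt N\<close>, and \<open>flip_diff\<close>
  halves the increment.\<close>

lemma flip_diff_grid:
  assumes w: "lipschitz_incr n L w" and ij: "i < n" "j < N"
  defines "f \<equiv> \<lambda>A. w (restrict (block_sum N A) {..<n})"
  shows "0 \<le> flip_diff (i, j) f A" and "flip_diff (i, j) f A \<le> L / sqrt N"
proof -
  define X where "X A = restrict (block_sum N A) {..<n}" for A
  define z where "z = X (A - {(i, j)})"
  have "X (insert (i, j) A) = z(i := z i + 2 / sqrt N)"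
    using ij by (auto simp: z_def X_def fun_eq_iff block_sum_insert)
  moreover have "z \<in> {..<n} \<rightarrow>\<^sub>E UNIV" "z i \<le> z i + 2 / sqrt N" by (auto simp: z_def X_def)
  ultimately have "w z \<le> w (X (insert (i, j) A)) \<and> w (X (insert (i, j) A)) \<le> w z + L * (z i + 2 / sqrt N - z i)"
    using w ij(1) unfolding lipschitz_incr_def by metis
  then show "0 \<le> flip_diff (i, j) f A" "flip_diff (i, j) f A \<le> L / sqrt N"
    by (simp_all add: flip_diff_def f_def X_def[symmetric] z_def[symmetric])
qed

lemma grid_avg_coord_nonneg:
  assumes w: "lipschitz_incr n L w" and i: "i < n"
  shows "0 \<le> grid_avg n N (\<lambda>x. x i * w x)"
proof (cases "N = 0")
  \<comment> \<open>For empty blocks the block sum is 0 divided by 0, which is 0, so the integrand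
    vanishes.\<close>
  case True
  then show ?thesis using i by (simp add: grid_avg_def block_sum_def)
next
  case False
  define f where "f A = w (restrict (block_sum N A) {..<n})" for A
  have "f (Transposition.transpose (i, 0) (i, l) ` A) = f A" if "l < N" for l A
    using that False by (auto simp: f_def restrict_def block_sum_transpose intro!: arg_cong[of _ _ w])
  then have "grid_avg n N (\<lambda>x. x i * w x) = sqrt N * cube_avg ({..<n} \<times> {..<N}) (\<lambda>A. spin A (i, 0) * f A)"
    using i False by (subst cube_avg_spin_block) (auto simp: grid_avg_def f_def)
  also have "\<dots> = sqrt N * cube_avg ({..<n} \<times> {..<N}) (flip_diff (i, 0) f)"
    using i False by (subst cube_avg_flip_diff) auto
  also have "0 \<le> cube_avg ({..<n} \<times> {..<N}) (flip_diff (i, 0) f)"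
    using flip_diff_grid(1)[OF w i, of 0 N] False
    by (auto simp: cube_avg_def f_def[abs_def] intro!: divide_nonneg_nonneg sum_nonneg)
  then have "0 \<le> sqrt N * cube_avg ({..<n} \<times> {..<N}) (flip_diff (i, 0) f)" by simp
  finally show ?thesis .
qed

definition grid_coeff2 :: "nat \<Rightarrow> nat \<Rightarrow> ((nat \<Rightarrow> real) \<Rightarrow> real) \<Rightarrow> nat \<Rightarrow> nat \<Rightarrow> real" where
  "grid_coeff2 n N w i k = (if k = i then grid_avg n N (\<lambda>x. (x i)\<^sup>2 * w x) - grid_avg n N w
     else grid_avg n N (\<lambda>x. x i * (x k * w x)))"

text \<open>Each of the \<open>N\<close> coordinates of block \<open>i\<close> yields the
  \<open>N\<close>-th part of the term for \<open>i\<close>: the means and bounds of the derivatives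
  carry a factor \<open>1 / sqrt N\<close>, their inner product \<open>1 / N\<close>, and
  \<open>cor_gain\<close> is homogeneous. The factor \<open>N / (N - 1)\<close> arises because only
  \<open>N - 1\<close> coordinates of block \<open>i\<close> differ from \<open>(i, j)\<close>, each
  with a coefficient divided by \<open>N - 1\<close> instead of \<open>N\<close>.\<close>

lemma grid_cor_ge:
  fixes u v :: "(nat \<Rightarrow> real) \<Rightarrow> real" and r :: "nat \<Rightarrow> real"
  assumes N: "2 \<le> N" and u: "lipschitz_incr n L u" and v: "lipschitz_incr n L v"
    and r: "\<And>i. i < n \<Longrightarrow> 0 \<le> r i \<and> r i \<le> 1/4"
  defines "a \<equiv> \<lambda>i. grid_avg n N (\<lambda>x. x i * u x)" and "b \<equiv> \<lambda>i. grid_avg n N (\<lambda>x. x i * v x)"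
  defines "q \<equiv> \<lambda>i. \<Sum>k<n. (if k = i then real N / (real N - 1) else 1) * (grid_coeff2 n N u i k * grid_coeff2 n N v i k)"
  shows "(\<Sum>i<n. r i * cor_gain (r i) L (a i) (b i) (q i))
    \<le> grid_avg n N (\<lambda>x. u x * v x) - grid_avg n N u * grid_avg n N v"
proof -
  define I where "I = {..<n} \<times> {..<N}"
  have I: "finite I" by (simp add: I_def)
  define X where "X A = restrict (block_sum N A) {..<n}" for A
  have ga: "grid_avg n N h = cube_avg I (\<lambda>A. h (X A))" for h
    by (simp add: grid_avg_def I_def X_def)
  have N0: "0 < real N" and sN: "sqrt N * sqrt N = real N" using N by auto
  define f where "f A = u (X A)" for A
  define g where "g A = v (X A)" for A
  have Xi: "X A i = block_sum N A i" if "i < n" for A i using that by (simp add: X_def)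
  have Xtr: "X (Transposition.transpose (i, j) (i, l) ` A) = X A" if "j < N" "l < N" for i j l A
    using that by (auto simp: X_def restrict_def fun_eq_iff block_sum_transpose)
  have f_flip: "0 \<le> flip_diff e f A" "flip_diff e f A \<le> L / sqrt N"
    and g_flip: "0 \<le> flip_diff e g A" "flip_diff e g A \<le> L / sqrt N" if "e \<in> I" for e A
    using flip_diff_grid[OF u, of "fst e" "snd e" N A] flip_diff_grid[OF v, of "fst e" "snd e" N A] that
    by (auto simp: f_def[abs_def] g_def[abs_def] X_def[abs_def] I_def)
  have a_eq: "cube_avg I (flip_diff (i, j) (\<lambda>A. w (X A))) = grid_avg n N (\<lambda>x. x i * w x) / sqrt N"
    if "i < n" "j < N" for i j w
  proof -
    have "cube_avg I (flip_diff (i, j) (\<lambda>A. w (X A))) = cube_avg I (\<lambda>A. spin A (i, j) * w (X A))"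
      using that I by (intro cube_avg_flip_diff) (auto simp: I_def)
    moreover have "sqrt N * cube_avg I (\<lambda>A. spin A (i, j) * w (X A)) = grid_avg n N (\<lambda>x. x i * w x)"
      unfolding ga using that cube_avg_spin_block[of i n j N "\<lambda>A. w (X A)"] by (simp add: Xtr I_def Xi)
    ultimately show ?thesis using N0 by (simp add: field_simps)
  qed
  have s2: "cube_avg I (\<lambda>A. spin A (k, l) * flip_diff (i, j) (\<lambda>A. w (X A)) A) =
      (if (k, l) = (i, j) then 0 else grid_coeff2 n N w i k / (if k = i then real N - 1 else real N))"
    if ij: "i < n" "j < N" "k < n" "l < N" for i j k l w
  proof -
    have "cube_avg I (\<lambda>A. spin A (k, l) * flip_diff (i, j) (\<lambda>A. w (X A)) A)
        = (if (k, l) = (i, j) then 0 else cube_avg I (\<lambda>A. spin A (i, j) * (spin A (k, l) * w (X A))))"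
      using that I by (intro cube_avg_spin_flip_diff) (auto simp: I_def)
    moreover have "cube_avg I (\<lambda>A. spin A (i, j) * (spin A (i, l) * w (X A)))
        = (grid_avg n N (\<lambda>x. (x i)\<^sup>2 * w x) - grid_avg n N w) / (real N - 1)" if "l \<noteq> j"
      using cube_avg_spin_spin_block[of i n j N l "\<lambda>A. w (X A)"] ij that N
      by (simp add: Xtr I_def[symmetric] ga Xi field_simps)
    moreover have "cube_avg I (\<lambda>A. spin A (i, j) * (spin A (k, l) * w (X A)))
        = grid_avg n N (\<lambda>x. x i * (x k * w x)) / real N" if "k \<noteq> i"
    proof -
      have tr: "spin (Transposition.transpose (i, j) (i, l') ` A) (k, l) = spin A (k, l)" for l' A
        unfolding spin_transpose using that by (simp add: Transposition.transpose_def)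
      have "sqrt N * cube_avg I (\<lambda>A. spin A (i, j) * (spin A (k, l) * w (X A)))
          = cube_avg I (\<lambda>A. block_sum N A i * (spin A (k, l) * w (X A)))"
        unfolding I_def using ij by (intro cube_avg_spin_block) (auto simp: Xtr tr)
      moreover have "sqrt N * cube_avg I (\<lambda>A. spin A (k, l) * (block_sum N A i * w (X A)))
          = cube_avg I (\<lambda>A. block_sum N A k * (block_sum N A i * w (X A)))"
        unfolding I_def using ij by (intro cube_avg_spin_block) (auto simp: Xtr block_sum_transpose)
      ultimately have "sqrt N * (sqrt N * cube_avg I (\<lambda>A. spin A (i, j) * (spin A (k, l) * w (X A))))
          = grid_avg n N (\<lambda>x. x i * (x k * w x))"
        using ij by (simp add: ga Xi mult.left_commute)
      then have "real N * cube_avg I (\<lambda>A. spin A (i, j) * (spin A (k, l) * w (X A)))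
          = grid_avg n N (\<lambda>x. x i * (x k * w x))"
        by (simp only: mult.assoc[symmetric] sN)
      then show ?thesis using N0 by (simp add: eq_divide_eq mult.commute)
    qed
    ultimately show ?thesis by (auto simp: grid_coeff2_def)
  qed
  have q_eq: "spin_corr I (flip_diff (i, j) f) (flip_diff (i, j) g) = q i / real N" if ij: "i < n" "j < N" for i j
  proof -
    have "spin_corr I (flip_diff (i, j) f) (flip_diff (i, j) g)
      = (\<Sum>k<n. \<Sum>l<N. cube_avg I (\<lambda>A. spin A (k, l) * flip_diff (i, j) f A) * cube_avg I (\<lambda>A. spin A (k, l) * flip_diff (i, j) g A))"
      unfolding I_def spin_corr_def by (simp add: sum.cartesian_product)
    also have "\<dots> = (\<Sum>k<n. (if k = i then real N / (real N - 1) else 1) * (grid_coeff2 n N u i k * grid_coeff2 n N v i k) / real N)"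
    proof (rule sum.cong[OF refl])
      fix k assume k: "k \<in> {..<n}"
      define c where "c = (if k = i then real N - 1 else real N)"
      define S where "S l = cube_avg I (\<lambda>A. spin A (k, l) * flip_diff (i, j) f A) * cube_avg I (\<lambda>A. spin A (k, l) * flip_diff (i, j) g A)" for l
      define T where "T = grid_coeff2 n N u i k / c * (grid_coeff2 n N v i k / c)"
      have c: "c \<noteq> 0" using N by (simp add: c_def)
      have Sl: "S l = (if (k, l) = (i, j) then 0 else T)" if "l < N" for l
        unfolding S_def f_def[abs_def] g_def[abs_def] T_def c_def
        using that ij k s2[of i j k l u] s2[of i j k l v] by auto
      have "sum S {..<N} = c * T"
      proof (cases "k = i")
        case True
        have "sum S {..<N} = S j + sum S ({..<N} - {j})" using ij by (intro sum.remove) auto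
        also have "sum S ({..<N} - {j}) = (\<Sum>l\<in>{..<N} - {j}. T)"
          using True by (intro sum.cong) (auto simp: Sl)
        finally show ?thesis using True ij by (simp add: Sl c_def)
      next
        case False
        then have "sum S {..<N} = (\<Sum>l<N. T)" by (intro sum.cong) (auto simp: Sl)
        then show ?thesis using False by (simp add: c_def)
      qed
      then show "sum S {..<N} = (if k = i then real N / (real N - 1) else 1) * (grid_coeff2 n N u i k * grid_coeff2 n N v i k) / real N"
        using c N by (auto simp: T_def c_def)
    qed
    finally show ?thesis by (simp add: q_def sum_divide_distrib)
  qed
  define \<kappa> where "\<kappa> i = cor_gain (r i) L (a i) (b i) (q i)" for i
  have "(\<Sum>e\<in>I. r (fst e) * (\<kappa> (fst e) / real N)) \<le> cube_avg I (\<lambda>A. f A * g A) - cube_avg I f * cube_avg I g"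
  proof (rule cube_cor_ge_sum[OF I])
    fix e \<rho> assume e: "e \<in> I" and \<rho>: "0 \<le> \<rho>" "\<rho> \<le> r (fst e)"
    obtain i j where ij: "e = (i, j)" "i < n" "j < N" using e by (auto simp: I_def)
    show "\<kappa> (fst e) / real N \<le> noise_avg \<rho> I (\<lambda>A B. flip_diff e f A * flip_diff e g B)"
    proof (cases "0 < a i \<and> 0 < b i")
      case True
      have "cor_gain (r i) (L / sqrt N) (a i / sqrt N) (b i / sqrt N) (q i / real N)
        \<le> noise_avg \<rho> I (\<lambda>A B. flip_diff e f A * flip_diff e g B)"
      proof (rule noise_avg_mult_ge[OF I \<rho>(1)])
        show "\<rho> \<le> r i" "r i \<le> 1/4" using \<rho> r[of i] ij by auto
        show "cube_avg I (flip_diff e f) = a i / sqrt N" "cube_avg I (flip_diff e g) = b i / sqrt N"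
          using a_eq[OF ij(2,3), of u] a_eq[OF ij(2,3), of v] by (simp_all add: ij(1) a_def b_def f_def[abs_def] g_def[abs_def])
        show "spin_corr I (flip_diff e f) (flip_diff e g) = q i / real N"
          using q_eq[OF ij(2,3)] by (simp add: ij(1))
      qed (use True N0 f_flip[OF e] g_flip[OF e] in auto)
      moreover have "\<bar>q i / real N\<bar> / (a i / sqrt N * (b i / sqrt N)) = \<bar>q i\<bar> / (a i * b i)"
        using N0 sN by simp
      ultimately show ?thesis using True N0 by (simp add: \<kappa>_def cor_gain_def ij(1))
    next
      case False
      have "0 \<le> noise_avg \<rho> I (\<lambda>A B. flip_diff e f A * flip_diff e g B)"
        using \<rho> r[of i] ij f_flip[OF e] g_flip[OF e] by (intro noise_avg_nonneg) auto
      with False show ?thesis by (auto simp: \<kappa>_def cor_gain_def ij(1))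
    qed
  next
    fix e assume "e \<in> I"
    then show "0 \<le> r (fst e) \<and> r (fst e) \<le> 1" using r[of "fst e"] by (auto simp: I_def)
  qed (use f_flip g_flip in auto)
  moreover have "(\<Sum>e\<in>I. r (fst e) * (\<kappa> (fst e) / real N)) = (\<Sum>i<n. \<Sum>j<N. r i * (\<kappa> i / real N))"
    unfolding I_def by (subst sum.cartesian_product) (auto intro: sum.cong)
  ultimately show ?thesis using N0 by (simp add: ga f_def[abs_def] g_def[abs_def] \<kappa>_def)
qed

section \<open>The central limit theorem on product spaces\<close>

abbreviation gauss :: "nat \<Rightarrow> (nat \<Rightarrow> real) measure" where
  "gauss n \<equiv> (\<Pi>\<^sub>M i\<in>{..<n}. std_normal_distribution)"

definition rademacher_law :: "nat \<Rightarrow> real measure" where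
  "rademacher_law N = distr (measure_pmf (pmf_of_set (Pow {..<N}))) borel (\<lambda>A. (\<Sum>j<N. spin A j) / sqrt (real N))"

lemma integral_pmf_of_set_Pow:
  assumes "finite I"
  shows "integral\<^sup>L (measure_pmf (pmf_of_set (Pow I))) f = cube_avg I f"
  using assms by (subst integral_pmf_of_set) (auto simp: cube_avg_def card_Pow)

lemma integral_rademacher_law:
  assumes "h \<in> borel_measurable borel"
  shows "integral\<^sup>L (rademacher_law N) h = cube_avg {..<N} (\<lambda>A. h ((\<Sum>j<N. spin A j) / sqrt (real N)))"
  using assms by (simp add: rademacher_law_def integral_distr integral_pmf_of_set_Pow)

lemma sets_rademacher_law [simp, measurable_cong]: "sets (rademacher_law N) = sets borel"
  and space_rademacher_law [simp]: "space (rademacher_law N) = UNIV"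
  by (simp_all add: rademacher_law_def)

lemma prob_space_rademacher_law: "prob_space (rademacher_law N)"
  unfolding rademacher_law_def by (intro prob_space.prob_space_distr prob_space_measure_pmf) simp

lemma real_distribution_rademacher_law: "real_distribution (rademacher_law N)"
  using prob_space_rademacher_law[of N]
  by (simp add: real_distribution_def real_distribution_axioms_def)

lemma char_rademacher_law: "char (rademacher_law N) t = complex_of_real (cos (t / sqrt (real N)) ^ N)"
proof -
  define c where "c = t / sqrt (real N)"
  have fin: "finite (Pow {..<N})" "Pow {..<N} \<noteq> {}" by auto
  have "char (rademacher_law N) t
      = (CLINT A|measure_pmf (pmf_of_set (Pow {..<N})). iexp (t * ((\<Sum>j<N. spin A j) / sqrt (real N))))"
    unfolding char_def rademacher_law_def by (subst integral_distr) auto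
  also have "\<dots> = (\<Sum>A\<in>Pow {..<N}. (1 / 2 ^ N) *\<^sub>R iexp (t * ((\<Sum>j<N. spin A j) / sqrt (real N))))"
    using fin by (subst integral_measure_pmf[of "Pow {..<N}"]) (auto simp: card_Pow intro!: sum.cong)
  also have "\<dots> = (1 / 2 ^ N) *\<^sub>R (\<Sum>A\<in>Pow {..<N}. iexp (t * ((\<Sum>j<N. spin A j) / sqrt (real N))))"
    by (simp only: scaleR_sum_right)
  also have "(\<Sum>A\<in>Pow {..<N}. iexp (t * ((\<Sum>j<N. spin A j) / sqrt (real N))))
      = (\<Sum>A\<in>Pow {..<N}. (\<Prod>j\<in>A. iexp c) * (\<Prod>j\<in>{..<N} - A. iexp (- c)))"
  proof (intro sum.cong refl)
    fix A assume A: "A \<in> Pow {..<N}"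
    have "iexp (t * ((\<Sum>j<N. spin A j) / sqrt (real N))) = exp (\<Sum>j<N. \<i> * complex_of_real (c * spin A j))"
      by (simp add: c_def sum_distrib_left sum_divide_distrib)
    also have "\<dots> = (\<Prod>j<N. iexp (c * spin A j))"
      by (simp add: exp_sum)
    also have "\<dots> = (\<Prod>j\<in>{..<N} - A. iexp (c * spin A j)) * (\<Prod>j\<in>A. iexp (c * spin A j))"
      using A by (intro prod.subset_diff) auto
    also have "(\<Prod>j\<in>{..<N} - A. iexp (c * spin A j)) = (\<Prod>j\<in>{..<N} - A. iexp (- c))"
      by (intro prod.cong) (auto simp: spin_def)
    also have "(\<Prod>j\<in>A. iexp (c * spin A j)) = (\<Prod>j\<in>A. iexp c)"
      by (intro prod.cong) (auto simp: spin_def)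
    finally show "iexp (t * ((\<Sum>j<N. spin A j) / sqrt (real N))) = (\<Prod>j\<in>A. iexp c) * (\<Prod>j\<in>{..<N} - A. iexp (- c))"
      by (simp only: mult.commute)
  qed
  also have "\<dots> = (\<Prod>j<N. iexp c + iexp (- c))"
    by (subst prod_add) auto
  also have "iexp c + iexp (- c) = complex_of_real (2 * cos c)"
  proof -
    have "iexp c = cis c" "iexp (- c) = cis (- c)" by (simp_all add: cis_conv_exp)
    then show ?thesis by (simp add: complex_eq_iff)
  qed
  finally show ?thesis
    by (simp add: c_def power_mult_distrib scaleR_conv_of_real)
qed

text \<open>The cosine is compared with \<open>1 - x^2 / 2\<close>, whose powers have the classical
  exponential limit. For numbers of modulus at most 1 the \<open>N\<close>-th powers differ by at
  most \<open>N\<close> times the difference of the bases, here \<open>N * x^4 / 24\<close>, which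
  is of order \<open>1 / N\<close>.\<close>

lemma cos_power_tendsto: "(\<lambda>N. cos (t / sqrt (real N)) ^ N) \<longlonglongrightarrow> exp (- t\<^sup>2 / 2)"
proof -
  have lim: "(\<lambda>N. (1 + (- t\<^sup>2 / 2) / real N) ^ N) \<longlonglongrightarrow> exp (- t\<^sup>2 / 2)"
    by (rule tendsto_exp_limit_sequentially)
  have "(\<lambda>N. cos (t / sqrt (real N)) ^ N - (1 + (- t\<^sup>2 / 2) / real N) ^ N) \<longlonglongrightarrow> 0"
  proof (rule Lim_null_comparison)
    show "(\<lambda>N. t ^ 4 / 24 * inverse (real N)) \<longlonglongrightarrow> 0"
      by (intro tendsto_mult_right_zero LIMSEQ_inverse_real_of_nat lim_inverse_n)
    \<comment> \<open>Beyond \<open>N0\<close> the base \<open>1 - x^2 / 2\<close> lies between -1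
      and 1, as the comparison of powers requires.\<close>
    obtain N0 :: nat where N0: "t\<^sup>2 \<le> real N0" using real_arch_simple by blast
    have "norm (cos (t / sqrt (real N)) ^ N - (1 + (- t\<^sup>2 / 2) / real N) ^ N) \<le> t ^ 4 / 24 * inverse (real N)"
      if N: "N \<ge> max 1 N0" for N
    proof -
      have N': "0 < real N" "t\<^sup>2 \<le> real N" using N N0 by auto
      define x where "x = t / sqrt (real N)"
      have x2: "x\<^sup>2 = t\<^sup>2 / real N" using N' by (simp add: x_def power_divide)
      have x4: "x ^ 4 = t ^ 4 / (real N)\<^sup>2"
      proof -
        have "x ^ 4 = (x\<^sup>2)\<^sup>2" by simp
        then show ?thesis unfolding x2 by (simp add: power_divide)
      qed
      obtain s where s: "cos x = (\<Sum>m<4. cos_coeff m * x ^ m) + (cos (s + 1/2 * real (4::nat) * pi) / fact 4) * x ^ 4"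
        using Maclaurin_cos_expansion[of x 4] by auto
      have "(\<Sum>m<4. cos_coeff m * x ^ m) = 1 - x\<^sup>2 / 2"
      proof -
        have "{..<4} = {0, 1, 2, 3 :: nat}" by auto
        then show ?thesis by (simp add: cos_coeff_def)
      qed
      with s have "cos x - (1 - x\<^sup>2 / 2) = (cos (s + 1/2 * real (4::nat) * pi) / fact 4) * x ^ 4" by simp
      also have "\<bar>\<dots>\<bar> \<le> 1 / 24 * x ^ 4"
        using mult_right_mono[OF abs_cos_le_one[of s], of "x ^ 4"] by (simp add: abs_mult fact_numeral)
      finally have b: "\<bar>cos x - (1 - x\<^sup>2 / 2)\<bar> \<le> x ^ 4 / 24" by simp
      have "norm (1 - x\<^sup>2 / 2) \<le> 1"
        using N' by (simp add: x2 abs_le_iff)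
      then have "norm (cos x ^ N - (1 - x\<^sup>2 / 2) ^ N) \<le> real N * norm (cos x - (1 - x\<^sup>2 / 2))"
        by (intro norm_power_diff) auto
      also have "\<dots> \<le> real N * (x ^ 4 / 24)"
        using b by (intro mult_left_mono) auto
      also have "\<dots> = t ^ 4 / 24 * inverse (real N)"
        unfolding x4 using N' by (simp add: field_simps power2_eq_square)
      finally have "norm (cos x ^ N - (1 - x\<^sup>2 / 2) ^ N) \<le> t ^ 4 / 24 * inverse (real N)" .
      moreover have "1 - x\<^sup>2 / 2 = 1 + (- t\<^sup>2 / 2) / real N"
        by (simp add: x2)
      ultimately show ?thesis by (simp only: x_def)
    qed
    then show "\<forall>\<^sub>F N in sequentially. norm (cos (t / sqrt (real N)) ^ N - (1 + (- t\<^sup>2 / 2) / real N) ^ N)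
        \<le> t ^ 4 / 24 * inverse (real N)"
      by (intro eventually_sequentiallyI[of "max 1 N0"])
  qed
  from tendsto_add[OF this lim] show ?thesis by simp
qed

lemma rademacher_law_weak_conv: "weak_conv_m rademacher_law std_normal_distribution"
proof (rule levy_continuity[OF real_distribution_rademacher_law real_dist_normal_dist])
  fix t
  show "(\<lambda>N. char (rademacher_law N) t) \<longlonglongrightarrow> char std_normal_distribution t"
    unfolding char_rademacher_law char_std_normal_distribution
    by (intro tendsto_of_real) (use cos_power_tendsto[of t] in simp)
qed

lemma cube_avg_union_mult:
  assumes "finite I" "finite J" "I \<inter> J = {}"
  shows "cube_avg (I \<union> J) (\<lambda>A. F (A \<inter> I) * G (A \<inter> J)) = cube_avg I F * cube_avg J G"
proof -
  have "bij_betw (\<lambda>(A, B). A \<union> B) (Pow I \<times> Pow J) (Pow (I \<union> J))"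
    by (rule bij_betwI[of _ _ _ "\<lambda>A. (A \<inter> I, A \<inter> J)"]) (use assms in auto)
  then have "(\<Sum>A\<in>Pow (I \<union> J). F (A \<inter> I) * G (A \<inter> J))
      = (\<Sum>p\<in>Pow I \<times> Pow J. F ((case p of (A, B) \<Rightarrow> A \<union> B) \<inter> I) * G ((case p of (A, B) \<Rightarrow> A \<union> B) \<inter> J))"
    by (rule sum.reindex_bij_betw[symmetric])
  also have "\<dots> = (\<Sum>(A, B)\<in>Pow I \<times> Pow J. F A * G B)"
  proof (intro sum.cong refl, clarify)
    fix A B assume "A \<subseteq> I" "B \<subseteq> J"
    then have "(A \<union> B) \<inter> I = A" "(A \<union> B) \<inter> J = B" using assms(3) by auto
    then show "F ((A \<union> B) \<inter> I) * G ((A \<union> B) \<inter> J) = F A * G B" by simp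
  qed
  also have "\<dots> = sum F (Pow I) * sum G (Pow J)"
    by (simp add: sum_product sum.cartesian_product)
  finally show ?thesis
    using assms by (simp add: cube_avg_def card_Un_disjoint power_add)
qed

lemma cube_avg_image:
  assumes "inj_on h I"
  shows "cube_avg (h ` I) F = cube_avg I (\<lambda>A. F (h ` A))"
proof -
  have "inj_on (image h) (Pow I)"
    using assms by (rule inj_on_image_Pow)
  then have "(\<Sum>A\<in>image h ` Pow I. F A) = (\<Sum>A\<in>Pow I. F (h ` A))"
    by (simp add: sum.reindex)
  then show ?thesis
    using assms by (simp add: cube_avg_def card_image image_Pow_surj)
qed

lemma cube_avg_prod_block:
  "cube_avg ({..<n} \<times> {..<N}) (\<lambda>A. \<Prod>i<n. h i (block_sum N A i))
    = (\<Prod>i<n. cube_avg {..<N} (\<lambda>A. h i ((\<Sum>j<N. spin A j) / sqrt (real N))))"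
proof (induction n)
  case (Suc n)
  define I where "I = {..<n} \<times> {..<N}"
  define J where "J = Pair n ` {..<N}"
  have IJ: "{..<Suc n} \<times> {..<N} = I \<union> J" "finite I" "finite J" "I \<inter> J = {}"
    by (auto simp: I_def J_def lessThan_Suc)
  have bI: "block_sum N A i = block_sum N (A \<inter> I) i" if "i < n" for A i
    using that by (auto simp: block_sum_def spin_def I_def intro!: sum.cong)
  have bJ: "block_sum N A n = block_sum N (A \<inter> J) n" for A
    by (auto simp: block_sum_def spin_def J_def intro!: sum.cong)
  have "cube_avg ({..<Suc n} \<times> {..<N}) (\<lambda>A. \<Prod>i<Suc n. h i (block_sum N A i))
      = cube_avg (I \<union> J) (\<lambda>A. (\<Prod>i<n. h i (block_sum N (A \<inter> I) i)) * h n (block_sum N (A \<inter> J) n))"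
    unfolding IJ(1)
    by (intro cube_avg_cong) (auto simp: bI[symmetric] bJ[symmetric] intro!: prod.cong)
  also have "\<dots> = cube_avg I (\<lambda>A. \<Prod>i<n. h i (block_sum N A i)) * cube_avg J (\<lambda>A. h n (block_sum N A n))"
    using IJ by (intro cube_avg_union_mult)
  also have "cube_avg J (\<lambda>A. h n (block_sum N A n)) = cube_avg {..<N} (\<lambda>A. h n ((\<Sum>j<N. spin A j) / sqrt (real N)))"
  proof -
    have "spin (Pair n ` A) (n, j) = spin A j" for A :: "nat set" and j
      by (auto simp: spin_def)
    then show ?thesis
      unfolding J_def by (subst cube_avg_image) (auto simp: inj_on_def block_sum_def)
  qed
  finally show ?case using Suc by (simp add: I_def)
qed simp

text \<open>Different blocks read disjoint sets of fair signs, so the probability of a box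
  factorizes, and boxes determine a product measure.\<close>

lemma grid_law:
  "distr (measure_pmf (pmf_of_set (Pow ({..<n} \<times> {..<N})))) (\<Pi>\<^sub>M i\<in>{..<n}. borel)
     (\<lambda>A. restrict (block_sum N A) {..<n}) = (\<Pi>\<^sub>M i\<in>{..<n}. rademacher_law N)"
proof -
  interpret R: prob_space "rademacher_law N" by (rule prob_space_rademacher_law)
  interpret P: product_prob_space "\<lambda>_ :: nat. rademacher_law N" by unfold_locales
  define P where "P = measure_pmf (pmf_of_set (Pow ({..<n} \<times> {..<N})))"
  define X where "X A = restrict (block_sum N A) {..<n}" for A
  have X: "X \<in> measurable P (\<Pi>\<^sub>M i\<in>{..<n}. borel)"
    unfolding P_def X_def by (auto simp: space_PiM)
  have "distr P (\<Pi>\<^sub>M i\<in>{..<n}. borel) X = (\<Pi>\<^sub>M i\<in>{..<n}. rademacher_law N)"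
  proof (rule P.PiM_eqI)
    show "sets (distr P (\<Pi>\<^sub>M i\<in>{..<n}. borel) X) = sets (\<Pi>\<^sub>M i\<in>{..<n}. rademacher_law N)"
      by (auto intro!: sets_PiM_cong)
  next
    fix B :: "nat \<Rightarrow> real set" assume "\<And>i. i \<in> {..<n} \<Longrightarrow> B i \<in> sets (rademacher_law N)"
    then have B: "B i \<in> sets borel" if "i < n" for i using that by auto
    have box: "Pi\<^sub>E {..<n} B \<in> sets (\<Pi>\<^sub>M i\<in>{..<n}. borel)"
      using B by (intro sets_PiM_I_finite) auto
    have "emeasure (distr P (\<Pi>\<^sub>M i\<in>{..<n}. borel) X) (Pi\<^sub>E {..<n} B)
        = ennreal (measure P {A. X A \<in> Pi\<^sub>E {..<n} B})"
      using X box by (subst emeasure_distr) (auto simp: P_def vimage_def measure_pmf.emeasure_eq_measure)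
    also have "measure P {A. X A \<in> Pi\<^sub>E {..<n} B} = (\<integral>A. indicator {A. X A \<in> Pi\<^sub>E {..<n} B} A \<partial>P)"
      by (simp add: P_def)
    also have "\<dots> = cube_avg ({..<n} \<times> {..<N}) (indicator {A. X A \<in> Pi\<^sub>E {..<n} B})"
      unfolding P_def by (rule integral_pmf_of_set_Pow) simp
    also have "\<dots> = cube_avg ({..<n} \<times> {..<N}) (\<lambda>A. \<Prod>i<n. indicator (B i) (block_sum N A i))"
      by (intro cube_avg_cong) (auto simp: indicator_def X_def Pi_iff PiE_iff)
    also have "\<dots> = (\<Prod>i<n. cube_avg {..<N} (\<lambda>A. indicator (B i) ((\<Sum>j<N. spin A j) / sqrt (real N))))"
      by (rule cube_avg_prod_block)
    also have "\<dots> = (\<Prod>i<n. measure (rademacher_law N) (B i))"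
      using B by (intro prod.cong refl) (simp add: integral_rademacher_law[symmetric])
    also have "ennreal \<dots> = (\<Prod>i<n. emeasure (rademacher_law N) (B i))"
      by (simp add: R.emeasure_eq_measure prod_ennreal)
    finally show "emeasure (distr P (\<Pi>\<^sub>M i\<in>{..<n}. borel) X) (Pi\<^sub>E {..<n} B)
      = (\<Prod>i\<in>{..<n}. emeasure (rademacher_law N) (B i))" .
  qed auto
  then show ?thesis by (simp add: P_def X_def[abs_def])
qed

lemma grid_avg_eq_integral:
  assumes "u \<in> borel_measurable (\<Pi>\<^sub>M i\<in>{..<n}. borel)"
  shows "grid_avg n N u = integral\<^sup>L (\<Pi>\<^sub>M i\<in>{..<n}. rademacher_law N) u"
  unfolding grid_law[symmetric] using assms
  by (subst integral_distr) (auto simp: grid_avg_def integral_pmf_of_set_Pow space_PiM)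

section \<open>Convergence of averages of functions with quadratic growth\<close>

lemma cube_avg_spin_sum_square:
  assumes "N > 0"
  shows "cube_avg {..<N} (\<lambda>A. ((\<Sum>j<N. spin A j) / sqrt (real N))\<^sup>2) = 1"
proof -
  have ne: "cube_avg {..<N} (\<lambda>A. spin A j * spin A l) = (if j = l then 1 else 0)" if "j < N" "l < N" for j l
  proof (cases "j = l")
    case False
    have "cube_avg {..<N} (\<lambda>A. spin A j * spin A l) = cube_avg ({..<N} - {j}) (\<lambda>A. 0)"
      unfolding cube_avg_reduce[OF finite_lessThan, of j] using that False
      by (subst cube_avg_reduce[of _ j]) (auto simp: spin_def intro!: cube_avg_cong)
    then show ?thesis using False by (simp add: cube_avg_const)
  qed (simp add: cube_avg_const)
  have "cube_avg {..<N} (\<lambda>A. ((\<Sum>j<N. spin A j) / sqrt (real N))\<^sup>2)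
      = cube_avg {..<N} (\<lambda>A. (1 / real N) * (\<Sum>j<N. \<Sum>l<N. spin A j * spin A l))"
    by (intro cube_avg_cong) (simp add: power_divide power2_eq_square sum_product)
  also have "\<dots> = (1 / real N) * (\<Sum>j<N. \<Sum>l<N. cube_avg {..<N} (\<lambda>A. spin A j * spin A l))"
    by (simp only: cube_avg_cmult cube_avg_sum)
  also have "(\<Sum>j<N. \<Sum>l<N. cube_avg {..<N} (\<lambda>A. spin A j * spin A l)) = (\<Sum>j<N. \<Sum>l<N. if j = l then 1 else 0)"
    by (intro sum.cong refl ne) auto
  also have "\<dots> = real N" by simp
  finally show ?thesis using assms by simp
qed

text \<open>Dominated convergence with moving majorants. Scheffe's lemma gives convergence of
  \<open>v N\<close> to \<open>v0\<close> in mean. After clamping \<open>f N\<close> between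
  \<open>- v0\<close> and \<open>v0\<close> the usual theorem applies, and clamping changes
  \<open>f N\<close> by at most \<open>\<bar>v N x - v0 x\<bar>\<close>. The majorants of the
  application have exactly equal integrals for positive \<open>N\<close>.\<close>

lemma integral_tendsto_dominated_varying:
  fixes f v :: "nat \<Rightarrow> 'a \<Rightarrow> real"
  assumes f: "\<And>N. f N \<in> borel_measurable M" "f0 \<in> borel_measurable M"
    and v: "\<And>N. integrable M (v N)" "integrable M v0"
    and dom: "\<And>N x. x \<in> space M \<Longrightarrow> \<bar>f N x\<bar> \<le> v N x"
    and lim: "\<And>x. x \<in> space M \<Longrightarrow> (\<lambda>N. f N x) \<longlonglongrightarrow> f0 x" "\<And>x. x \<in> space M \<Longrightarrow> (\<lambda>N. v N x) \<longlonglongrightarrow> v0 x"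
    and int: "\<forall>\<^sub>F N in sequentially. integral\<^sup>L M (v N) = integral\<^sup>L M v0"
  shows "(\<lambda>N. integral\<^sup>L M (f N)) \<longlonglongrightarrow> integral\<^sup>L M f0"
proof -
  have v0: "0 \<le> v N x" if "x \<in> space M" for N x using dom[OF that, of N] by linarith
  have v00: "0 \<le> v0 x" if "x \<in> space M" for x
    using lim(2)[OF that] v0[OF that] by (intro LIMSEQ_le_const) auto
  have nn: "(\<integral>\<^sup>+x. norm (v N x) \<partial>M) = ennreal (integral\<^sup>L M (v N))" for N
    using v v0 by (subst nn_integral_eq_integral[symmetric]) (auto intro!: nn_integral_cong AE_I2)
  have nn0: "(\<integral>\<^sup>+x. norm (v0 x) \<partial>M) = ennreal (integral\<^sup>L M v0)"
    using v v00 by (subst nn_integral_eq_integral[symmetric]) (auto intro!: nn_integral_cong AE_I2)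
  have "limsup (\<lambda>N. \<integral>\<^sup>+x. norm (v N x) \<partial>M) \<le> (\<integral>\<^sup>+x. norm (v0 x) \<partial>M)"
    unfolding nn nn0 by (intro Limsup_bounded eventually_mono[OF int]) simp
  then have sch: "(\<lambda>N. \<integral>\<^sup>+x. norm (v N x - v0 x) \<partial>M) \<longlonglongrightarrow> 0"
    using lim v by (intro Scheffe_lemma1) auto
  have d_int: "integrable M (\<lambda>x. \<bar>v N x - v0 x\<bar>)" for N using v by auto
  have "(\<integral>\<^sup>+x. norm (v N x - v0 x) \<partial>M) = ennreal (\<integral>x. \<bar>v N x - v0 x\<bar> \<partial>M)" for N
    using d_int by (subst nn_integral_eq_integral[symmetric]) auto
  with sch have d0: "(\<lambda>N. \<integral>x. \<bar>v N x - v0 x\<bar> \<partial>M) \<longlonglongrightarrow> 0"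
    by (simp add: ennreal_0[symmetric] del: ennreal_0)
  have clamp: "\<bar>max (- a) (min a b)\<bar> \<le> a" if "0 \<le> a" for a b :: real
    using that by (auto simp: max_def min_def)
  define w where "w N x = max (- v0 x) (min (v0 x) (f N x))" for N x
  have f0b: "\<bar>f0 x\<bar> \<le> v0 x" if "x \<in> space M" for x
    using tendsto_rabs[OF lim(1)[OF that]] lim(2)[OF that] dom[OF that]
    by (intro LIMSEQ_le) auto
  have [measurable]: "f N \<in> borel_measurable M" "f0 \<in> borel_measurable M" "v0 \<in> borel_measurable M" "v N \<in> borel_measurable M" for N
    using f v by auto
  have w: "(\<lambda>N. integral\<^sup>L M (w N)) \<longlonglongrightarrow> integral\<^sup>L M f0"
  proof (rule integral_dominated_convergence[where w = v0])
    show "AE x in M. (\<lambda>N. w N x) \<longlonglongrightarrow> f0 x"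
    proof (rule AE_I2)
      fix x assume x: "x \<in> space M"
      have "(\<lambda>N. w N x) \<longlonglongrightarrow> max (- v0 x) (min (v0 x) (f0 x))"
        unfolding w_def by (intro tendsto_intros lim x)
      moreover have "max (- v0 x) (min (v0 x) (f0 x)) = f0 x"
        using f0b[OF x] by (auto simp: abs_le_iff max_def min_def)
      ultimately show "(\<lambda>N. w N x) \<longlonglongrightarrow> f0 x" by simp
    qed
    show "AE x in M. norm (w N x) \<le> v0 x" for N
      using v00 by (intro AE_I2) (simp add: w_def clamp)
    show "w N \<in> borel_measurable M" for N
      unfolding w_def[abs_def] by measurable
  qed (use v f in auto)
  have wint: "integrable M (w N)" for N
    by (rule Bochner_Integration.integrable_bound[OF v(2)]) (use v00 in \<open>auto simp: w_def[abs_def] clamp intro!: AE_I2\<close>)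
  have fint: "integrable M (f N)" for N
    by (rule Bochner_Integration.integrable_bound[OF v(1)[of N]])
      (use dom v0 in \<open>auto intro!: AE_I2 simp: abs_of_nonneg\<close>)
  have diff: "(\<lambda>N. integral\<^sup>L M (f N) - integral\<^sup>L M (w N)) \<longlonglongrightarrow> 0"
  proof (rule Lim_null_comparison[OF always_eventually d0], intro allI)
    fix N
    have "norm (integral\<^sup>L M (f N) - integral\<^sup>L M (w N)) = norm (\<integral>x. f N x - w N x \<partial>M)"
      using fint wint by simp
    also have "\<dots> \<le> (\<integral>x. norm (f N x - w N x) \<partial>M)"
      by (rule integral_norm_bound)
    also have "\<dots> \<le> (\<integral>x. \<bar>v N x - v0 x\<bar> \<partial>M)"
    proof (rule integral_mono)
      show "norm (f N x - w N x) \<le> \<bar>v N x - v0 x\<bar>" if "x \<in> space M" for x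
        using dom[OF that, of N] v00[OF that] by (auto simp: w_def max_def min_def abs_le_iff abs_if split: if_splits)
    qed (use fint wint d_int in auto)
    finally show "norm (integral\<^sup>L M (f N) - integral\<^sup>L M (w N)) \<le> (\<integral>x. \<bar>v N x - v0 x\<bar> \<partial>M)" .
  qed
  from tendsto_add[OF diff w] show ?thesis by simp
qed

lemma prob_space_std_normal: "prob_space std_normal_distribution"
  using real_dist_normal_dist by (simp add: real_distribution_def)

lemma integral_PiM_component:
  assumes "\<And>i. i \<in> I \<Longrightarrow> prob_space (M i)" "finite I" "i \<in> I" "h \<in> borel_measurable (M i)"
  shows "integral\<^sup>L (Pi\<^sub>M I M) (\<lambda>x. h (x i)) = (integral\<^sup>L (M i) h :: real)"
    and "integrable (M i) h \<Longrightarrow> integrable (Pi\<^sub>M I M) (\<lambda>x. h (x i) :: real)"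
proof -
  have d: "distr (Pi\<^sub>M I M) (M i) (\<lambda>x. x i) = M i"
    using assms by (intro distr_PiM_component) auto
  have m: "(\<lambda>x. x i) \<in> measurable (Pi\<^sub>M I M) (M i)"
    using assms(3) by measurable
  have "integral\<^sup>L (distr (Pi\<^sub>M I M) (M i) (\<lambda>x. x i)) h = integral\<^sup>L (Pi\<^sub>M I M) (\<lambda>x. h (x i))"
    by (rule integral_distr[OF m assms(4)])
  then show "integral\<^sup>L (Pi\<^sub>M I M) (\<lambda>x. h (x i)) = integral\<^sup>L (M i) h"
    by (simp only: d)
  have "integrable (distr (Pi\<^sub>M I M) (M i) (\<lambda>x. x i)) h \<longleftrightarrow> integrable (Pi\<^sub>M I M) (\<lambda>x. h (x i))"
    by (rule integrable_distr_eq[OF m assms(4)])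
  then show "integrable (M i) h \<Longrightarrow> integrable (Pi\<^sub>M I M) (\<lambda>x. h (x i))"
    by (simp only: d)
qed

text \<open>Weak convergence by itself handles bounded continuous functions only. Skorohod's
  representation turns it into pointwise convergence of each coordinate, and the quadratic majorants
  all have mean 3, because the sums of signs have second moment 1 just like the Gaussian.\<close>

lemma grid_avg_tendsto:
  assumes u: "u \<in> borel_measurable (\<Pi>\<^sub>M i\<in>{..<n}. borel)"
    and cont: "\<And>X x. (\<And>N. X N \<in> {..<n} \<rightarrow>\<^sub>E UNIV) \<Longrightarrow> x \<in> {..<n} \<rightarrow>\<^sub>E UNIV \<Longrightarrow>
      (\<And>i. i < n \<Longrightarrow> (\<lambda>N. X N i) \<longlonglongrightarrow> x i) \<Longrightarrow> (\<lambda>N. u (X N)) \<longlonglongrightarrow> u x"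
    and bound: "\<And>x. x \<in> {..<n} \<rightarrow>\<^sub>E UNIV \<Longrightarrow> \<bar>u x\<bar> \<le> 1 + (x i)\<^sup>2 + (x k)\<^sup>2" and ik: "i < n" "k < n"
  shows "(\<lambda>N. grid_avg n N u) \<longlonglongrightarrow> integral\<^sup>L (gauss n) u"
proof -
  obtain \<Omega> :: "real measure" and Y_seq Y where \<Omega>: "prob_space \<Omega>"
    and Ys: "\<And>N. Y_seq N \<in> measurable \<Omega> borel" "\<And>N. distr \<Omega> borel (Y_seq N) = rademacher_law N"
    and Y: "Y \<in> measurable \<Omega> lborel" "distr \<Omega> borel Y = std_normal_distribution"
    and conv: "\<And>x. x \<in> space \<Omega> \<Longrightarrow> (\<lambda>N. Y_seq N x) \<longlonglongrightarrow> Y x"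
    using Skorohod[OF real_distribution_rademacher_law real_dist_normal_dist rademacher_law_weak_conv] by blast
  have Y': "Y \<in> measurable \<Omega> borel" using Y(1) by simp
  define P where "P = (\<Pi>\<^sub>M i\<in>{..<n}. \<Omega>)"
  \<comment> \<open>\<open>rademacher_law 1\<close> merely supplies a probability measure on the
    Borel sets to serve as target space in \<open>D\<close>; the image measure depends on the target
    only through its measurable sets.\<close>
  have borel_prob: "prob_space (rademacher_law 1)" by (rule prob_space_rademacher_law)
  have D: "distr P (\<Pi>\<^sub>M i\<in>{..<n}. rademacher_law 1) (compose {..<n} Z) = (\<Pi>\<^sub>M i\<in>{..<n}. distr \<Omega> (rademacher_law 1) Z)"
    if "Z \<in> measurable \<Omega> borel" for Z
    unfolding P_def using that \<Omega> borel_prob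
    by (intro distr_PiM_finite_prob_space') (auto simp: measurable_cong_sets[OF refl sets_rademacher_law])
  have sP: "sets (\<Pi>\<^sub>M i\<in>{..<n}. rademacher_law 1) = sets (\<Pi>\<^sub>M i\<in>{..<n}. borel)"
    by (intro sets_PiM_cong) auto
  have cm: "compose {..<n} Z \<in> measurable P (\<Pi>\<^sub>M i\<in>{..<n}. borel)" if "Z \<in> measurable \<Omega> borel" for Z
    unfolding P_def compose_def using that by measurable
  have I: "integral\<^sup>L (\<Pi>\<^sub>M i\<in>{..<n}. distr \<Omega> borel Z) u = (\<integral>\<omega>. u (compose {..<n} Z \<omega>) \<partial>P)"
    if Z: "Z \<in> measurable \<Omega> borel" for Z
  proof -
    have "(\<Pi>\<^sub>M i\<in>{..<n}. distr \<Omega> borel Z) = (\<Pi>\<^sub>M i\<in>{..<n}. distr \<Omega> (rademacher_law 1) Z)"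
      by (intro PiM_cong refl distr_cong) auto
    also have "\<dots> = distr P (\<Pi>\<^sub>M i\<in>{..<n}. borel) (compose {..<n} Z)"
      unfolding D[OF Z, symmetric] by (intro distr_cong sP refl)
    finally show ?thesis using cm[OF Z] u by (simp add: integral_distr)
  qed
  have sq: "integrable \<Omega> (\<lambda>x. (Z x)\<^sup>2)" "(\<integral>x. (Z x)\<^sup>2 \<partial>\<Omega>) = integral\<^sup>L D (\<lambda>x. x\<^sup>2)"
    if "Z \<in> measurable \<Omega> borel" "distr \<Omega> borel Z = D" "integrable D (\<lambda>x. x\<^sup>2)" for Z :: "real \<Rightarrow> real" and D
  proof -
    have "integrable (distr \<Omega> borel Z) (\<lambda>x. x\<^sup>2)" using that by simp
    then show "integrable \<Omega> (\<lambda>x. (Z x)\<^sup>2)"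
      using integrable_distr_eq[OF that(1), where f = "\<lambda>x. x\<^sup>2"] by simp
    show "(\<integral>x. (Z x)\<^sup>2 \<partial>\<Omega>) = integral\<^sup>L D (\<lambda>x. x\<^sup>2)"
      unfolding that(2)[symmetric] by (subst integral_distr[OF that(1)]) auto
  qed
  have rl_int: "integrable (rademacher_law N) (\<lambda>x. x\<^sup>2)" for N
  proof -
    have "finite (set_pmf (pmf_of_set (Pow {..<N})))" by (subst set_pmf_of_set) auto
    then show ?thesis
      unfolding rademacher_law_def by (subst integrable_distr_eq) (auto intro!: integrable_measure_pmf_finite)
  qed
  have rl2: "integral\<^sup>L (rademacher_law N) (\<lambda>x. x\<^sup>2) = 1" if "N > 0" for N
    using cube_avg_spin_sum_square[OF that] by (subst integral_rademacher_law) auto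
  have sn_int: "integrable std_normal_distribution (\<lambda>x. x\<^sup>2)"
    by (rule integrable_std_normal_distribution_moment)
  have sn2: "integral\<^sup>L std_normal_distribution (\<lambda>x. x\<^sup>2) = 1"
    using std_normal_distribution_even_moments(1)[of 1] by (simp add: fact_numeral)
  define v where "v Z \<omega> = 1 + (Z (\<omega> i))\<^sup>2 + (Z (\<omega> k))\<^sup>2" for Z :: "real \<Rightarrow> real" and \<omega> :: "nat \<Rightarrow> real"
  interpret O: prob_space \<Omega> by (rule \<Omega>)
  interpret PP: prob_space P unfolding P_def by (intro prob_space_PiM \<Omega>)
  have comp: "integrable P (\<lambda>\<omega>. (Z (\<omega> j))\<^sup>2)" "(\<integral>\<omega>. (Z (\<omega> j))\<^sup>2 \<partial>P) = (\<integral>x. (Z x)\<^sup>2 \<partial>\<Omega>)"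
    if "Z \<in> measurable \<Omega> borel" "integrable \<Omega> (\<lambda>x. (Z x)\<^sup>2)" "j < n" for Z :: "real \<Rightarrow> real" and j
  proof -
    have m: "(\<lambda>x. (Z x)\<^sup>2) \<in> borel_measurable \<Omega>" and j: "j \<in> {..<n}"
      using that(1,3) by simp_all
    show "integrable P (\<lambda>\<omega>. (Z (\<omega> j))\<^sup>2)"
      unfolding P_def by (rule integral_PiM_component(2)[OF \<Omega> finite_lessThan j m that(2)])
    show "(\<integral>\<omega>. (Z (\<omega> j))\<^sup>2 \<partial>P) = (\<integral>x. (Z x)\<^sup>2 \<partial>\<Omega>)"
      unfolding P_def by (rule integral_PiM_component(1)[OF \<Omega> finite_lessThan j m])
  qed
  have v_int: "integrable P (v Z)" "integral\<^sup>L P (v Z) = 1 + (\<integral>x. (Z x)\<^sup>2 \<partial>\<Omega>) + (\<integral>x. (Z x)\<^sup>2 \<partial>\<Omega>)"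
    if "Z \<in> measurable \<Omega> borel" "integrable \<Omega> (\<lambda>x. (Z x)\<^sup>2)" for Z :: "real \<Rightarrow> real"
    using comp[OF that ik(1)] comp[OF that ik(2)] by (simp_all add: v_def[abs_def] PP.prob_space)
  have cE: "compose {..<n} Z \<omega> \<in> {..<n} \<rightarrow>\<^sub>E UNIV" for Z and \<omega> :: "nat \<Rightarrow> real" by (auto simp: compose_def)
  have "(\<lambda>N. \<integral>\<omega>. u (compose {..<n} (Y_seq N) \<omega>) \<partial>P) \<longlonglongrightarrow> (\<integral>\<omega>. u (compose {..<n} Y \<omega>) \<partial>P)"
  proof (rule integral_tendsto_dominated_varying[where v = "\<lambda>N. v (Y_seq N)" and ?v0.0 = "v Y"])
    show "(\<lambda>\<omega>. u (compose {..<n} (Y_seq N) \<omega>)) \<in> borel_measurable P" for N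
      using measurable_compose[OF cm[OF Ys(1)] u] .
    show "(\<lambda>\<omega>. u (compose {..<n} Y \<omega>)) \<in> borel_measurable P"
      using measurable_compose[OF cm[OF Y'] u] .
    show "integrable P (v (Y_seq N))" for N
      by (rule v_int(1)[OF Ys(1) sq(1)[OF Ys(1) Ys(2) rl_int]])
    show "integrable P (v Y)"
      by (rule v_int(1)[OF Y' sq(1)[OF Y' Y(2) sn_int]])
    have "integral\<^sup>L P (v (Y_seq N)) = integral\<^sup>L P (v Y)" if "N > 0" for N
      unfolding v_int(2)[OF Ys(1) sq(1)[OF Ys(1) Ys(2) rl_int]] v_int(2)[OF Y' sq(1)[OF Y' Y(2) sn_int]]
        sq(2)[OF Ys(1) Ys(2) rl_int] sq(2)[OF Y' Y(2) sn_int] rl2[OF that] sn2 ..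
    then show "\<forall>\<^sub>F N in sequentially. integral\<^sup>L P (v (Y_seq N)) = integral\<^sup>L P (v Y)"
      by (auto intro!: eventually_sequentiallyI[of 1])
    show "\<bar>u (compose {..<n} (Y_seq N) \<omega>)\<bar> \<le> v (Y_seq N) \<omega>" for N \<omega>
      using bound[OF cE, of "Y_seq N" \<omega>] ik by (simp add: v_def compose_def)
    fix \<omega> assume "\<omega> \<in> space P"
    then have \<omega>: "\<omega> i \<in> space \<Omega>" if "i < n" for i using that by (auto simp: P_def space_PiM)
    show "(\<lambda>N. u (compose {..<n} (Y_seq N) \<omega>)) \<longlonglongrightarrow> u (compose {..<n} Y \<omega>)"
      by (intro cont cE) (auto simp: compose_def intro!: conv \<omega>)
    show "(\<lambda>N. v (Y_seq N) \<omega>) \<longlonglongrightarrow> v Y \<omega>"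
      unfolding v_def using ik by (intro tendsto_intros conv \<omega>) auto
  qed
  moreover have "(\<integral>\<omega>. u (compose {..<n} (Y_seq N) \<omega>) \<partial>P) = grid_avg n N u" for N
    unfolding grid_avg_eq_integral[OF u] Ys(2)[symmetric] I[OF Ys(1)] ..
  moreover have "(\<integral>\<omega>. u (compose {..<n} Y \<omega>) \<partial>P) = integral\<^sup>L (gauss n) u"
    unfolding Y(2)[symmetric] I[OF Y'] ..
  ultimately show ?thesis by simp
qed

section \<open>Correlation of Lipschitz increasing functions\<close>

lemma lipschitz_incrD:
  assumes "lipschitz_incr n L u" "x \<in> {..<n} \<rightarrow>\<^sub>E UNIV" "i < n" "x i \<le> t"
  shows "u x \<le> u (x(i := t)) \<and> u (x(i := t)) \<le> u x + L * (t - x i)"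
  using assms unfolding lipschitz_incr_def by blast

text \<open>The path \<open>z\<close> changes one coordinate at a time. As
  \<open>lipschitz_incr\<close> speaks of increases only, a decreasing step is read
  backwards.\<close>

lemma lipschitz_incr_abs_le:
  assumes u: "lipschitz_incr n L u" and xy: "x \<in> {..<n} \<rightarrow>\<^sub>E UNIV" "y \<in> {..<n} \<rightarrow>\<^sub>E UNIV"
  shows "\<bar>u y - u x\<bar> \<le> L * (\<Sum>i<n. \<bar>y i - x i\<bar>)"
proof -
  define z where "z m i = (if i < m then y i else x i)" for m i
  have zE: "z m \<in> {..<n} \<rightarrow>\<^sub>E UNIV" if "m \<le> n" for m
    using xy that by (auto simp: z_def PiE_iff extensional_def)
  have "\<bar>u (z m) - u x\<bar> \<le> L * (\<Sum>i<m. \<bar>y i - x i\<bar>)" if "m \<le> n" for m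
    using that
  proof (induction m)
    case (Suc m)
    have z: "z (Suc m) = (z m)(m := y m)" "z m = (z (Suc m))(m := x m)" "z m m = x m" "z (Suc m) m = y m"
      by (auto simp: z_def fun_eq_iff)
    have "\<bar>u (z (Suc m)) - u (z m)\<bar> \<le> L * \<bar>y m - x m\<bar>"
    proof (cases "x m \<le> y m")
      case True
      then have "u (z m) \<le> u (z (Suc m)) \<and> u (z (Suc m)) \<le> u (z m) + L * (y m - x m)"
        using lipschitz_incrD[OF u zE[of m], of m "y m"] Suc.prems z(1,3) by simp
      then show ?thesis using True by simp
    next
      case False
      then have "u (z (Suc m)) \<le> u (z m) \<and> u (z m) \<le> u (z (Suc m)) + L * (x m - y m)"
        using lipschitz_incrD[OF u zE[of "Suc m"], of m "x m"] Suc.prems z(2,4) by simp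
      then show ?thesis using False by simp
    qed
    then show ?case using Suc by (simp add: distrib_left)
  next
    case 0
    have "z 0 = x" by (simp add: z_def fun_eq_iff)
    then show ?case by simp
  qed
  from this[of n] have "\<bar>u (z n) - u x\<bar> \<le> L * (\<Sum>i<n. \<bar>y i - x i\<bar>)" by simp
  moreover have "z n = y" using xy by (auto simp: z_def fun_eq_iff PiE_iff extensional_def)
  ultimately show ?thesis by simp
qed

lemma lipschitz_incr_tendsto:
  assumes u: "lipschitz_incr n L u" and "\<And>N. X N \<in> {..<n} \<rightarrow>\<^sub>E UNIV" "x \<in> {..<n} \<rightarrow>\<^sub>E UNIV"
    and lim: "\<And>i. i < n \<Longrightarrow> (\<lambda>N. X N i) \<longlonglongrightarrow> x i"
  shows "(\<lambda>N. u (X N)) \<longlonglongrightarrow> u x"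
proof -
  have "(\<lambda>N. u (X N) - u x) \<longlonglongrightarrow> 0"
  proof (rule Lim_null_comparison)
    show "\<forall>\<^sub>F N in sequentially. norm (u (X N) - u x) \<le> L * (\<Sum>i<n. \<bar>X N i - x i\<bar>)"
      using assms by (auto intro!: always_eventually lipschitz_incr_abs_le)
    have "(\<lambda>N. L * (\<Sum>i<n. \<bar>X N i - x i\<bar>)) \<longlonglongrightarrow> L * (\<Sum>i<n. \<bar>x i - x i\<bar>)"
      by (intro tendsto_intros lim) auto
    then show "(\<lambda>N. L * (\<Sum>i<n. \<bar>X N i - x i\<bar>)) \<longlonglongrightarrow> 0" by simp
  qed
  then show ?thesis by (simp add: LIM_zero_iff)
qed

lemma integrable_std_normal_powers:
  "integrable std_normal_distribution (\<lambda>x. x)" "integrable std_normal_distribution (\<lambda>x. x\<^sup>2)"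
  using integrable_std_normal_distribution_moment[of 1] integrable_std_normal_distribution_moment[of 2] by auto

lemma integral_std_normal_powers:
  "integral\<^sup>L std_normal_distribution (\<lambda>x. x) = 0" "integral\<^sup>L std_normal_distribution (\<lambda>x. x\<^sup>2) = 1"
  using integral_std_normal_distribution_moment_odd[of 1] std_normal_distribution_even_moments(1)[of 1]
  by (auto simp: fact_numeral)

lemma abs_mult_le_sum_squares: "\<bar>a * b\<bar> \<le> a\<^sup>2 + b\<^sup>2" for a b :: real
proof -
  have "0 \<le> (\<bar>a\<bar> - \<bar>b\<bar>)\<^sup>2" by simp
  then have "2 * \<bar>a * b\<bar> \<le> a\<^sup>2 + b\<^sup>2" by (simp add: power2_diff abs_mult)
  then show ?thesis using abs_ge_zero[of "a * b"] by linarith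
qed

lemma sets_gauss: "sets (gauss n) = sets (\<Pi>\<^sub>M i\<in>{..<n}. borel)"
  by (intro sets_PiM_cong) auto

lemma space_gauss: "space (gauss n) = {..<n} \<rightarrow>\<^sub>E UNIV"
  by (simp add: space_PiM)

lemma prob_space_gauss: "prob_space (gauss n)"
  by (intro prob_space_PiM prob_space_std_normal)

lemma measurable_gauss_component [measurable]:
  "i < n \<Longrightarrow> (\<lambda>x. x i) \<in> borel_measurable (gauss n)"
  using measurable_component_singleton[of i "{..<n}" "\<lambda>_. borel"]
  by (simp add: measurable_cong_sets[OF sets_gauss refl])

lemma integrable_gauss_quadratic:
  assumes "h \<in> borel_measurable (gauss n)" "i < n" "k < n"
    and "\<And>x. x \<in> {..<n} \<rightarrow>\<^sub>E UNIV \<Longrightarrow> \<bar>h x\<bar> \<le> 1 + (x i)\<^sup>2 + (x k)\<^sup>2"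
  shows "integrable (gauss n) h"
proof (rule Bochner_Integration.integrable_bound[of _ "\<lambda>x. 1 + (x i)\<^sup>2 + (x k)\<^sup>2"])
  interpret prob_space "gauss n" by (rule prob_space_gauss)
  have "integrable (gauss n) (\<lambda>x. (x j)\<^sup>2)" if "j < n" for j
    using that by (intro integral_PiM_component(2)) (auto intro!: prob_space_std_normal integrable_std_normal_powers)
  then show "integrable (gauss n) (\<lambda>x. 1 + (x i)\<^sup>2 + (x k)\<^sup>2)"
    using assms by auto
qed (use assms in \<open>auto simp: space_gauss intro!: AE_I2\<close>)

definition gauss_coeff1 :: "nat \<Rightarrow> ((nat \<Rightarrow> real) \<Rightarrow> real) \<Rightarrow> nat \<Rightarrow> real" where
  "gauss_coeff1 n w i = (\<integral>x. x i * w x \<partial>gauss n)"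

definition gauss_coeff2 :: "nat \<Rightarrow> ((nat \<Rightarrow> real) \<Rightarrow> real) \<Rightarrow> nat \<Rightarrow> nat \<Rightarrow> real" where
  "gauss_coeff2 n w i k = (\<integral>x. (x i * x k - (if i = k then 1 else 0)) * w x \<partial>gauss n)"

lemma abs_le_one_plus_square: "\<bar>a\<bar> \<le> 1 + a\<^sup>2" for a :: real
  using abs_mult_le_sum_squares[of 1 a] by simp

lemma grid_limits:
  assumes n: "0 < n" and w: "w \<in> borel_measurable (gauss n)" "lipschitz_incr n L w"
    "\<And>x. x \<in> {..<n} \<rightarrow>\<^sub>E UNIV \<Longrightarrow> 0 \<le> w x \<and> w x \<le> 1"
  shows "(\<lambda>N. grid_avg n N w) \<longlonglongrightarrow> (\<integral>x. w x \<partial>gauss n)"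
    and "i < n \<Longrightarrow> (\<lambda>N. grid_avg n N (\<lambda>x. x i * w x)) \<longlonglongrightarrow> gauss_coeff1 n w i"
    and "i < n \<Longrightarrow> k < n \<Longrightarrow> (\<lambda>N. grid_coeff2 n N w i k) \<longlonglongrightarrow> gauss_coeff2 n w i k"
    and "v \<in> borel_measurable (gauss n) \<Longrightarrow> lipschitz_incr n L v \<Longrightarrow>
      (\<And>x. x \<in> {..<n} \<rightarrow>\<^sub>E UNIV \<Longrightarrow> 0 \<le> v x \<and> v x \<le> 1) \<Longrightarrow>
      (\<lambda>N. grid_avg n N (\<lambda>x. v x * w x)) \<longlonglongrightarrow> (\<integral>x. v x * w x \<partial>gauss n)"
proof -
  have to_borel: "h \<in> borel_measurable (\<Pi>\<^sub>M i\<in>{..<n}. borel)" if "h \<in> borel_measurable (gauss n)"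
    for h :: "(nat \<Rightarrow> real) \<Rightarrow> real"
    using that by (simp only: measurable_cong_sets[OF sets_gauss refl])
  have conv: "(\<lambda>N. grid_avg n N (\<lambda>x. h x * w x)) \<longlonglongrightarrow> (\<integral>x. h x * w x \<partial>gauss n)"
    if h: "h \<in> borel_measurable (gauss n)"
      "\<And>X x. (\<And>N. X N \<in> {..<n} \<rightarrow>\<^sub>E UNIV) \<Longrightarrow> x \<in> {..<n} \<rightarrow>\<^sub>E UNIV \<Longrightarrow>
      (\<And>i. i < n \<Longrightarrow> (\<lambda>N. X N i) \<longlonglongrightarrow> x i) \<Longrightarrow> (\<lambda>N. h (X N)) \<longlonglongrightarrow> h x"
      "\<And>x. x \<in> {..<n} \<rightarrow>\<^sub>E UNIV \<Longrightarrow> \<bar>h x\<bar> \<le> 1 + (x i)\<^sup>2 + (x k)\<^sup>2" "i < n" "k < n" for h i k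
  proof (rule grid_avg_tendsto[OF _ _ _ h(4,5)])
    show "(\<lambda>x. h x * w x) \<in> borel_measurable (\<Pi>\<^sub>M i\<in>{..<n}. borel)"
      by (intro borel_measurable_times to_borel w h)
    show "(\<lambda>N. h (X N) * w (X N)) \<longlonglongrightarrow> h x * w x"
      if "\<And>N. X N \<in> {..<n} \<rightarrow>\<^sub>E UNIV" "x \<in> {..<n} \<rightarrow>\<^sub>E UNIV" "\<And>i. i < n \<Longrightarrow> (\<lambda>N. X N i) \<longlonglongrightarrow> x i" for X x
      by (intro tendsto_mult h(2) lipschitz_incr_tendsto[OF w(2)] that)
    show "\<bar>h x * w x\<bar> \<le> 1 + (x i)\<^sup>2 + (x k)\<^sup>2" if "x \<in> {..<n} \<rightarrow>\<^sub>E UNIV" for x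
      using mult_mono[OF h(3)[OF that], of "\<bar>w x\<bar>" 1] w(3)[OF that] by (simp add: abs_mult)
  qed
  have lim0: "(\<lambda>N. grid_avg n N w) \<longlonglongrightarrow> (\<integral>x. w x \<partial>gauss n)"
    using conv[of "\<lambda>_. 1" 0 0] n by simp
  then show "(\<lambda>N. grid_avg n N w) \<longlonglongrightarrow> (\<integral>x. w x \<partial>gauss n)" .
  show "(\<lambda>N. grid_avg n N (\<lambda>x. x i * w x)) \<longlonglongrightarrow> gauss_coeff1 n w i" if i: "i < n"
    unfolding gauss_coeff1_def
  proof (rule conv[where i = i and k = i])
    show "\<bar>x i\<bar> \<le> 1 + (x i)\<^sup>2 + (x i)\<^sup>2" for x :: "nat \<Rightarrow> real"
      using abs_le_one_plus_square[of "x i"] zero_le_power2[of "x i"] by linarith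
  qed (use i in auto)
  have lim2: "(\<lambda>N. grid_avg n N (\<lambda>x. x i * x k * w x)) \<longlonglongrightarrow> (\<integral>x. x i * x k * w x \<partial>gauss n)"
    if ik: "i < n" "k < n" for i k
  proof (rule conv[where i = i and k = k])
    show "\<bar>x i * x k\<bar> \<le> 1 + (x i)\<^sup>2 + (x k)\<^sup>2" for x :: "nat \<Rightarrow> real"
      using abs_mult_le_sum_squares[of "x i" "x k"] by simp
  qed (use ik in \<open>auto intro: tendsto_mult\<close>)
  show "(\<lambda>N. grid_coeff2 n N w i k) \<longlonglongrightarrow> gauss_coeff2 n w i k" if ik: "i < n" "k < n"
  proof -
    have "integrable (gauss n) w"
    proof (rule integrable_gauss_quadratic[OF w(1) ik])
      show "\<bar>w x\<bar> \<le> 1 + (x i)\<^sup>2 + (x k)\<^sup>2" if "x \<in> {..<n} \<rightarrow>\<^sub>E UNIV" for x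
        using w(3)[OF that] zero_le_power2[of "x i"] zero_le_power2[of "x k"] by linarith
    qed
    moreover have "integrable (gauss n) (\<lambda>x. x i * x k * w x)"
    proof (rule integrable_gauss_quadratic[OF _ ik])
      show "\<bar>x i * x k * w x\<bar> \<le> 1 + (x i)\<^sup>2 + (x k)\<^sup>2" if "x \<in> {..<n} \<rightarrow>\<^sub>E UNIV" for x
        using mult_mono[OF abs_mult_le_sum_squares[of "x i" "x k"], of "\<bar>w x\<bar>" 1] w(3)[OF that] by (simp add: abs_mult)
    qed (intro borel_measurable_times measurable_gauss_component w ik)
    ultimately have "gauss_coeff2 n w i k
      = (\<integral>x. x i * x k * w x \<partial>gauss n) - (if i = k then 1 else 0) * (\<integral>x. w x \<partial>gauss n)"
      by (simp add: gauss_coeff2_def left_diff_distrib)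
    then show ?thesis
      using tendsto_diff[OF lim2[OF ik] lim0] lim2[OF ik]
      by (cases "k = i") (simp_all add: grid_coeff2_def power2_eq_square mult.assoc)
  qed
  show "(\<lambda>N. grid_avg n N (\<lambda>x. v x * w x)) \<longlonglongrightarrow> (\<integral>x. v x * w x \<partial>gauss n)"
    if v: "v \<in> borel_measurable (gauss n)" "lipschitz_incr n L v" "\<And>x. x \<in> {..<n} \<rightarrow>\<^sub>E UNIV \<Longrightarrow> 0 \<le> v x \<and> v x \<le> 1"
  proof (rule conv[where i = 0 and k = 0])
    show "\<bar>v x\<bar> \<le> 1 + (x 0)\<^sup>2 + (x 0)\<^sup>2" if "x \<in> {..<n} \<rightarrow>\<^sub>E UNIV" for x
      using v(3)[OF that] zero_le_power2[of "x 0"] by linarith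
  qed (use v(1) n lipschitz_incr_tendsto[OF v(2)] in auto)
qed

lemma gauss_cor_ge:
  fixes u v :: "(nat \<Rightarrow> real) \<Rightarrow> real" and r :: "nat \<Rightarrow> real"
  assumes n: "0 < n"
    and u: "u \<in> borel_measurable (gauss n)" "lipschitz_incr n L u" "\<And>x. x \<in> {..<n} \<rightarrow>\<^sub>E UNIV \<Longrightarrow> 0 \<le> u x \<and> u x \<le> 1"
    and v: "v \<in> borel_measurable (gauss n)" "lipschitz_incr n L v" "\<And>x. x \<in> {..<n} \<rightarrow>\<^sub>E UNIV \<Longrightarrow> 0 \<le> v x \<and> v x \<le> 1"
    and r: "\<And>i. i < n \<Longrightarrow> 0 \<le> r i \<and> r i \<le> 1/4" and L: "0 < L"
  defines "a \<equiv> gauss_coeff1 n u" and "b \<equiv> gauss_coeff1 n v"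
    and "q \<equiv> \<lambda>i. \<Sum>k<n. gauss_coeff2 n u i k * gauss_coeff2 n v i k"
  shows "(\<Sum>i<n. r i * cor_gain (r i) L (a i) (b i) (q i))
    \<le> (\<integral>x. u x * v x \<partial>gauss n) - (\<integral>x. u x \<partial>gauss n) * (\<integral>x. v x \<partial>gauss n)"
proof -
  define aN where "aN N i = grid_avg n N (\<lambda>x. x i * u x)" for N i
  define bN where "bN N i = grid_avg n N (\<lambda>x. x i * v x)" for N i
  define qN where "qN N i = (\<Sum>k<n. (if k = i then real N / (real N - 1) else 1)
    * (grid_coeff2 n N u i k * grid_coeff2 n N v i k))" for N i
  note lu = grid_limits[OF n u] and lv = grid_limits[OF n v]
  have a: "(\<lambda>N. aN N i) \<longlonglongrightarrow> a i" and b: "(\<lambda>N. bN N i) \<longlonglongrightarrow> b i" if "i < n" for i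
    unfolding aN_def bN_def a_def b_def using lu(2) lv(2) that by auto
  have NN: "(\<lambda>N. if k = i then real N / (real N - 1) else 1) \<longlonglongrightarrow> 1" for i k :: nat
  proof (cases "k = i")
    case True
    have "(\<lambda>N. real N / (real N - 1)) \<longlonglongrightarrow> 1"
      by (rule LIMSEQ_imp_Suc) (use LIMSEQ_Suc_n_over_n in simp)
    then show ?thesis using True by simp
  qed simp
  have q: "(\<lambda>N. qN N i) \<longlonglongrightarrow> q i" if i: "i < n" for i
    unfolding qN_def q_def
  proof (rule tendsto_sum)
    fix k assume "k \<in> {..<n}"
    then have k: "k < n" by simp
    show "(\<lambda>N. (if k = i then real N / (real N - 1) else 1) * (grid_coeff2 n N u i k * grid_coeff2 n N v i k))
      \<longlonglongrightarrow> gauss_coeff2 n u i k * gauss_coeff2 n v i k"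
      using tendsto_mult[OF NN tendsto_mult[OF lu(3)[OF _ i k] lv(3)[OF _ i k]], of k i] by simp
  qed
  have cor: "(\<lambda>N. grid_avg n N (\<lambda>x. u x * v x) - grid_avg n N u * grid_avg n N v) \<longlonglongrightarrow>
      (\<integral>x. u x * v x \<partial>gauss n) - (\<integral>x. u x \<partial>gauss n) * (\<integral>x. v x \<partial>gauss n)"
    using lv(4)[OF _ u] lu(1) lv(1) by (intro tendsto_diff tendsto_mult) auto
  define P where "P = {i. i < n \<and> 0 < a i \<and> 0 < b i}"
  have fP: "finite P" by (simp add: P_def)
  have "(\<Sum>i<n. r i * cor_gain (r i) L (a i) (b i) (q i)) = (\<Sum>i\<in>P. r i * cor_gain (r i) L (a i) (b i) (q i))"
    by (rule sum.mono_neutral_cong_right) (auto simp: P_def cor_gain_def)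
  also have "\<dots> \<le> (\<integral>x. u x * v x \<partial>gauss n) - (\<integral>x. u x \<partial>gauss n) * (\<integral>x. v x \<partial>gauss n)"
  proof (rule tendsto_le[OF sequentially_bot cor])
    define T where "T N i = aN N i * bN N i * exp (- (r i * (\<bar>qN N i\<bar> / (aN N i * bN N i)))
        - 5 * (r i)\<^sup>2 * (ln (L / aN N i) + ln (L / bN N i)))" for N i
    have pos: "\<forall>\<^sub>F N in sequentially. \<forall>i\<in>P. 0 < aN N i \<and> 0 < bN N i"
      using fP order_tendstoD(1)[OF a] order_tendstoD(1)[OF b]
      by (intro eventually_ball_finite ballI eventually_conj) (auto simp: P_def)
    have T: "(\<lambda>N. \<Sum>i\<in>P. r i * T N i) \<longlonglongrightarrow> (\<Sum>i\<in>P. r i * (a i * b i *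
        exp (- (r i * (\<bar>q i\<bar> / (a i * b i))) - 5 * (r i)\<^sup>2 * (ln (L / a i) + ln (L / b i)))))"
      unfolding T_def using L by (intro tendsto_sum tendsto_intros a b q) (auto simp: P_def)
    also have "(\<Sum>i\<in>P. r i * (a i * b i *
        exp (- (r i * (\<bar>q i\<bar> / (a i * b i))) - 5 * (r i)\<^sup>2 * (ln (L / a i) + ln (L / b i)))))
      = (\<Sum>i\<in>P. r i * cor_gain (r i) L (a i) (b i) (q i))"
      by (intro sum.cong) (auto simp: P_def cor_gain_def)
    finally show "(\<lambda>N. \<Sum>i\<in>P. r i * T N i) \<longlonglongrightarrow> (\<Sum>i\<in>P. r i * cor_gain (r i) L (a i) (b i) (q i))" .
    show "\<forall>\<^sub>F N in sequentially. (\<Sum>i\<in>P. r i * T N i) \<le> grid_avg n N (\<lambda>x. u x * v x) - grid_avg n N u * grid_avg n N v"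
      using pos eventually_ge_at_top[of 2]
    proof eventually_elim
      case (elim N)
      have "(\<Sum>i\<in>P. r i * T N i) = (\<Sum>i\<in>P. r i * cor_gain (r i) L (aN N i) (bN N i) (qN N i))"
        using elim by (intro sum.cong) (auto simp: T_def cor_gain_def)
      also have "\<dots> \<le> (\<Sum>i<n. r i * cor_gain (r i) L (aN N i) (bN N i) (qN N i))"
        by (rule sum_mono2) (use r in \<open>auto simp: P_def cor_gain_def\<close>)
      also have "\<dots> \<le> grid_avg n N (\<lambda>x. u x * v x) - grid_avg n N u * grid_avg n N v"
        using grid_cor_ge[OF elim(2) u(2) v(2) r] unfolding aN_def bN_def qN_def .
      finally show ?case .
    qed
  qed
  finally show ?thesis .
qed

section \<open>Harris' inequality\<close>

definition incr_on :: "'a set \<Rightarrow> (('a \<Rightarrow> real) \<Rightarrow> real) \<Rightarrow> bool" where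
  "incr_on I f \<longleftrightarrow> (\<forall>x \<in> I \<rightarrow>\<^sub>E UNIV. \<forall>i\<in>I. \<forall>t. x i \<le> t \<longrightarrow> f x \<le> f (x(i := t)))"

lemma incr_onD:
  "incr_on I f \<Longrightarrow> x \<in> I \<rightarrow>\<^sub>E UNIV \<Longrightarrow> i \<in> I \<Longrightarrow> x i \<le> t \<Longrightarrow> f x \<le> f (x(i := t))"
  by (auto simp: incr_on_def)

lemma PiE_UNIV_upd: "x \<in> I \<rightarrow>\<^sub>E UNIV \<Longrightarrow> x(i := t) \<in> insert i I \<rightarrow>\<^sub>E UNIV"
  by (auto simp: PiE_iff extensional_def)

lemma (in prob_space) integrable_01:
  assumes "f \<in> borel_measurable M" "\<And>x. x \<in> space M \<Longrightarrow> 0 \<le> f x \<and> f x \<le> (1::real)"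
  shows "integrable M f"
  using assms by (intro integrable_const_bound[where B = 1] AE_I2) auto

lemma (in prob_space) integral_01:
  assumes "f \<in> borel_measurable M" "\<And>x. x \<in> space M \<Longrightarrow> 0 \<le> f x \<and> f x \<le> (1::real)"
  shows "0 \<le> integral\<^sup>L M f \<and> integral\<^sup>L M f \<le> 1"
proof
  show "0 \<le> integral\<^sup>L M f" using assms by (intro integral_nonneg_AE AE_I2) auto
  have "integral\<^sup>L M f \<le> (\<integral>x. 1 \<partial>M)"
    using assms by (intro integral_mono integrable_01) auto
  then show "integral\<^sup>L M f \<le> 1" by (simp add: prob_space)
qed

text \<open>For two independent copies \<open>x\<close>, \<open>y\<close> the product
  \<open>(f x - f y) * (g x - g y)\<close> is nonnegative, and its mean is twice the covariance. The
  copies are integrated one after the other.\<close>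

lemma chebyshev_mono:
  fixes f g :: "real \<Rightarrow> real"
  assumes "prob_space M" and meas: "f \<in> borel_measurable M" "g \<in> borel_measurable M"
    and f01: "\<And>x. 0 \<le> f x \<and> f x \<le> 1" and g01: "\<And>x. 0 \<le> g x \<and> g x \<le> 1"
    and mono: "mono f" "mono g"
  shows "integral\<^sup>L M f * integral\<^sup>L M g \<le> (\<integral>x. f x * g x \<partial>M)"
proof -
  interpret prob_space M by fact
  have fg01: "0 \<le> f x * g x \<and> f x * g x \<le> 1" for x
    using f01[of x] g01[of x] by (simp add: mult_le_one)
  have int: "integrable M f" "integrable M g" "integrable M (\<lambda>x. f x * g x)"
    using meas f01 g01 fg01 by (auto intro!: integrable_01)
  define a b c where "a = integral\<^sup>L M f" and "b = integral\<^sup>L M g" and "c = (\<integral>x. f x * g x \<partial>M)"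
  have "0 \<le> f x * g x - f x * b - a * g x + c" for x
  proof -
    have "0 \<le> (\<integral>y. (f x - f y) * (g x - g y) \<partial>M)"
    proof (intro integral_nonneg_AE AE_I2)
      fix y show "0 \<le> (f x - f y) * (g x - g y)"
        using monoD[OF mono(1)] monoD[OF mono(2)] linear[of x y]
        by (auto intro: mult_nonneg_nonneg mult_nonpos_nonpos)
    qed
    also have "(\<integral>y. (f x - f y) * (g x - g y) \<partial>M) = (\<integral>y. f x * g x - f x * g y - (g x * f y - f y * g y) \<partial>M)"
      by (intro Bochner_Integration.integral_cong) (auto simp: algebra_simps)
    also have "\<dots> = f x * g x - f x * b - (g x * a - c)"
      using int by (simp add: a_def b_def c_def prob_space)
    finally show ?thesis by (simp add: algebra_simps)
  qed
  then have "0 \<le> (\<integral>x. f x * g x - f x * b - (a * g x - c) \<partial>M)"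
    by (intro integral_nonneg_AE AE_I2) (simp add: algebra_simps)
  also have "\<dots> = c - a * b - (a * b - c)"
    using int by (simp add: a_def b_def c_def prob_space)
  finally show ?thesis by (simp add: a_def b_def c_def)
qed

text \<open>One coordinate is integrated at a time: Chebyshev's inequality handles it with the
  others fixed, and the partial averages are again increasing. The marginals may differ because the
  inequality is applied to normal laws with arbitrary means.\<close>

lemma harris:
  fixes M :: "'a \<Rightarrow> real measure" and f g :: "('a \<Rightarrow> real) \<Rightarrow> real"
  assumes M: "\<And>i. prob_space (M i)" "\<And>i. sets (M i) = sets borel" and "finite I"
    and "f \<in> borel_measurable (Pi\<^sub>M I M)" "g \<in> borel_measurable (Pi\<^sub>M I M)"
    and "\<And>x. x \<in> I \<rightarrow>\<^sub>E UNIV \<Longrightarrow> 0 \<le> f x \<and> f x \<le> 1"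
    and "\<And>x. x \<in> I \<rightarrow>\<^sub>E UNIV \<Longrightarrow> 0 \<le> g x \<and> g x \<le> 1"
    and "incr_on I f" "incr_on I g"
  shows "integral\<^sup>L (Pi\<^sub>M I M) f * integral\<^sup>L (Pi\<^sub>M I M) g \<le> (\<integral>x. f x * g x \<partial>Pi\<^sub>M I M)"
proof -
  interpret P: product_prob_space M by (intro product_prob_spaceI M)
  have spM: "space (M i) = UNIV" for i using sets_eq_imp_space_eq[OF M(2)[of i]] by simp
  have spP: "space (Pi\<^sub>M I M) = I \<rightarrow>\<^sub>E UNIV" for I by (simp add: space_PiM spM)
  show ?thesis using assms(3-)
  proof (induction I arbitrary: f g rule: finite_induct)
    case empty
    interpret prob_space "Pi\<^sub>M {} M" by (intro prob_space_PiM M)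
    have *: "integral\<^sup>L (Pi\<^sub>M {} M) h = h (\<lambda>_. undefined)" for h :: "('a \<Rightarrow> real) \<Rightarrow> real"
      by (simp add: PiM_empty lebesgue_integral_count_space_finite)
    show ?case by (simp add: *)
  next
    case (insert i I)
    interpret I: prob_space "Pi\<^sub>M I M" by (intro prob_space_PiM M)
    interpret iI: prob_space "Pi\<^sub>M (insert i I) M" by (intro prob_space_PiM M)
    define F where "F h x = (\<integral>y. h (x(i := y)) \<partial>M i)" for h :: "('a \<Rightarrow> real) \<Rightarrow> real" and x
    have meas2: "(\<lambda>(x, y). h (x(i := y))) \<in> borel_measurable (Pi\<^sub>M I M \<Otimes>\<^sub>M M i)"
      if "h \<in> borel_measurable (Pi\<^sub>M (insert i I) M)" for h :: "('a \<Rightarrow> real) \<Rightarrow> real"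
      using measurable_comp[OF measurable_add_dim that] by (simp add: comp_def split_beta)
    have Fm: "F h \<in> borel_measurable (Pi\<^sub>M I M)" if "h \<in> borel_measurable (Pi\<^sub>M (insert i I) M)" for h
      unfolding F_def using P.M.borel_measurable_lebesgue_integral[OF meas2[OF that]] by simp
    have upd: "x(i := y) \<in> insert i I \<rightarrow>\<^sub>E UNIV" if "x \<in> I \<rightarrow>\<^sub>E UNIV" for x :: "'a \<Rightarrow> real" and y
      using that by (rule PiE_UNIV_upd)
    have hm: "(\<lambda>y. h (x(i := y))) \<in> borel_measurable (M i)"
      if "h \<in> borel_measurable (Pi\<^sub>M (insert i I) M)" "x \<in> I \<rightarrow>\<^sub>E UNIV" for h :: "('a \<Rightarrow> real) \<Rightarrow> real" and x
      using measurable_Pair2[OF meas2[OF that(1)]] that(2) by (simp add: spP)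
    have F01: "0 \<le> F h x \<and> F h x \<le> 1"
      if "h \<in> borel_measurable (Pi\<^sub>M (insert i I) M)" "\<And>x. x \<in> insert i I \<rightarrow>\<^sub>E UNIV \<Longrightarrow> 0 \<le> h x \<and> h x \<le> 1"
        "x \<in> I \<rightarrow>\<^sub>E UNIV" for h x
      unfolding F_def using that upd by (intro P.M.integral_01 hm) auto
    have Finc: "incr_on I (F h)"
      if h: "h \<in> borel_measurable (Pi\<^sub>M (insert i I) M)" "\<And>x. x \<in> insert i I \<rightarrow>\<^sub>E UNIV \<Longrightarrow> 0 \<le> h x \<and> h x \<le> 1"
        "incr_on (insert i I) h" for h
      unfolding incr_on_def
    proof (intro ballI allI impI)
      fix x :: "'a \<Rightarrow> real" and j t assume x: "x \<in> I \<rightarrow>\<^sub>E UNIV" and j: "j \<in> I" "x j \<le> t"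
      then have ji: "j \<noteq> i" using insert.hyps by auto
      have xt: "x(j := t) \<in> I \<rightarrow>\<^sub>E UNIV" using PiE_UNIV_upd[OF x, of j t] j(1) by (simp add: insert_absorb)
      show "F h x \<le> F h (x(j := t))"
        unfolding F_def
      proof (rule integral_mono)
        show "h (x(i := y)) \<le> h ((x(j := t))(i := y))" for y
          using incr_onD[OF h(3) upd[OF x, of y], of j t] j ji by (simp add: fun_upd_twist)
      qed (use h x xt upd in \<open>auto intro!: P.M.integrable_01 hm\<close>)
    qed
    have ins: "integral\<^sup>L (Pi\<^sub>M (insert i I) M) h = integral\<^sup>L (Pi\<^sub>M I M) (F h)"
      if "h \<in> borel_measurable (Pi\<^sub>M (insert i I) M)" "\<And>x. x \<in> insert i I \<rightarrow>\<^sub>E UNIV \<Longrightarrow> 0 \<le> h x \<and> h x \<le> 1" for h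
      unfolding F_def using insert.hyps that
      by (intro P.product_integral_insert) (auto intro!: iI.integrable_01 simp: spP)
    note f = insert.prems(1,3,5) and g = insert.prems(2,4,6)
    have fg: "(\<lambda>x. f x * g x) \<in> borel_measurable (Pi\<^sub>M (insert i I) M)"
      "\<And>x. x \<in> insert i I \<rightarrow>\<^sub>E UNIV \<Longrightarrow> 0 \<le> f x * g x \<and> f x * g x \<le> 1"
      using f g by (auto intro: mult_le_one)
    have "integral\<^sup>L (Pi\<^sub>M (insert i I) M) f * integral\<^sup>L (Pi\<^sub>M (insert i I) M) g
        = integral\<^sup>L (Pi\<^sub>M I M) (F f) * integral\<^sup>L (Pi\<^sub>M I M) (F g)"
      using ins[OF f(1,2)] ins[OF g(1,2)] by simp
    also have "\<dots> \<le> (\<integral>x. F f x * F g x \<partial>Pi\<^sub>M I M)"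
      by (intro insert.IH Fm F01 Finc f g)
    also have "\<dots> \<le> (\<integral>x. F (\<lambda>x. f x * g x) x \<partial>Pi\<^sub>M I M)"
    proof (rule integral_mono)
      fix x assume "x \<in> space (Pi\<^sub>M I M)"
      then have x: "x \<in> I \<rightarrow>\<^sub>E UNIV" by (simp add: spP)
      have mono: "mono (\<lambda>y. h (x(i := y)))" if "incr_on (insert i I) h" for h
        using incr_onD[OF that upd[OF x], of i] by (auto intro!: monoI)
      show "F f x * F g x \<le> F (\<lambda>x. f x * g x) x"
        unfolding F_def using f g upd[OF x]
        by (intro chebyshev_mono M hm mono x) auto
    next
      show "integrable (Pi\<^sub>M I M) (\<lambda>x. F f x * F g x)"
        using F01[OF f(1,2)] F01[OF g(1,2)] Fm[OF f(1)] Fm[OF g(1)]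
        by (intro I.integrable_01) (auto simp: spP intro: mult_le_one)
      show "integrable (Pi\<^sub>M I M) (F (\<lambda>x. f x * g x))"
        using F01[OF fg] Fm[OF fg(1)] by (intro I.integrable_01) (auto simp: spP)
    qed
    also have "\<dots> = (\<integral>x. f x * g x \<partial>Pi\<^sub>M (insert i I) M)"
      using ins[OF fg] by simp
    finally show ?case .
  qed
qed

text \<open>Serves two changes of measure: moving the mean of a single coordinate, and passing from
  the standard Gaussian to the smoothing kernel.\<close>

lemma PiM_density_prod:
  fixes M :: "'a \<Rightarrow> 'b measure" and h :: "'a \<Rightarrow> 'b \<Rightarrow> real"
  assumes I: "finite I" and M: "\<And>i. prob_space (M i)"
    and h: "\<And>i. h i \<in> borel_measurable (M i)" "\<And>i x. 0 \<le> h i x"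
    and P: "\<And>i. prob_space (density (M i) (h i))"
  shows "density (Pi\<^sub>M I M) (\<lambda>x. ennreal (\<Prod>i\<in>I. h i (x i))) = Pi\<^sub>M I (\<lambda>i. density (M i) (h i))"
proof -
  interpret M: product_prob_space M by (intro product_prob_spaceI M)
  interpret D: product_prob_space "\<lambda>i. density (M i) (h i)" by (intro product_prob_spaceI P)
  have [measurable]: "\<And>i. h i \<in> borel_measurable (M i)" by (rule h)
  show ?thesis
  proof (rule D.PiM_eqI[OF I])
    show "sets (density (Pi\<^sub>M I M) (\<lambda>x. ennreal (\<Prod>i\<in>I. h i (x i)))) = sets (Pi\<^sub>M I (\<lambda>i. density (M i) (h i)))"
      by (auto intro!: sets_PiM_cong)
    fix A assume "\<And>i. i \<in> I \<Longrightarrow> A i \<in> sets (density (M i) (h i))"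
    then have A: "\<And>i. i \<in> I \<Longrightarrow> A i \<in> sets (M i)" by simp
    have "emeasure (density (Pi\<^sub>M I M) (\<lambda>x. ennreal (\<Prod>i\<in>I. h i (x i)))) (Pi\<^sub>E I A)
      = (\<integral>\<^sup>+x. ennreal (\<Prod>i\<in>I. h i (x i)) * indicator (Pi\<^sub>E I A) x \<partial>Pi\<^sub>M I M)"
      using A I by (intro emeasure_density) (auto intro!: sets_PiM_I_finite)
    also have "\<dots> = (\<integral>\<^sup>+x. (\<Prod>i\<in>I. ennreal (h i (x i)) * indicator (A i) (x i)) \<partial>Pi\<^sub>M I M)"
    proof (rule nn_integral_cong)
      fix x assume x: "x \<in> space (Pi\<^sub>M I M)"
      have "indicator (Pi\<^sub>E I A) x = (\<Prod>i\<in>I. indicator (A i) (x i) :: ennreal)"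
        using x I by (cases "x \<in> Pi\<^sub>E I A") (auto simp: space_PiM PiE_iff indicator_def)
      then show "ennreal (\<Prod>i\<in>I. h i (x i)) * indicator (Pi\<^sub>E I A) x = (\<Prod>i\<in>I. ennreal (h i (x i)) * indicator (A i) (x i))"
        using h by (simp add: prod_ennreal prod.distrib)
    qed
    also have "\<dots> = (\<Prod>i\<in>I. \<integral>\<^sup>+x. ennreal (h i x) * indicator (A i) x \<partial>M i)"
      using A I by (intro M.product_nn_integral_prod) auto
    also have "\<dots> = (\<Prod>i\<in>I. emeasure (density (M i) (h i)) (A i))"
      using A by (intro prod.cong refl emeasure_density[symmetric]) auto
    finally show "emeasure (density (Pi\<^sub>M I M) (\<lambda>x. ennreal (\<Prod>i\<in>I. h i (x i)))) (Pi\<^sub>E I A)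
      = (\<Prod>i\<in>I. emeasure (density (M i) (h i)) (A i))" .
  qed
qed

section \<open>Gaussian smoothing\<close>

abbreviation normal_law :: "real \<Rightarrow> real \<Rightarrow> real measure" where
  "normal_law \<mu> s \<equiv> density lborel (\<lambda>x. ennreal (normal_density \<mu> s x))"

abbreviation normal_prod :: "nat \<Rightarrow> real \<Rightarrow> (nat \<Rightarrow> real) \<Rightarrow> (nat \<Rightarrow> real) measure" where
  "normal_prod n s w \<equiv> (\<Pi>\<^sub>M i\<in>{..<n}. normal_law (w i) s)"

lemma prob_space_normal_prod: "0 < s \<Longrightarrow> prob_space (normal_prod n s w)"
  by (intro prob_space_PiM prob_space_normal_density)

lemma sets_normal_prod: "sets (normal_prod n s w) = sets (\<Pi>\<^sub>M i\<in>{..<n}. borel)"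
  by (intro sets_PiM_cong) auto

lemma space_normal_prod: "space (normal_prod n s w) = {..<n} \<rightarrow>\<^sub>E UNIV"
  by (simp add: space_PiM)

lemma normal_law_eq_distr:
  assumes s: "0 < s"
  shows "normal_law \<mu> s = distr std_normal_distribution borel (\<lambda>a. \<mu> + s * a)"
proof -
  interpret prob_space std_normal_distribution by (rule prob_space_std_normal)
  have "distributed std_normal_distribution lborel (\<lambda>a. a) std_normal_density"
    unfolding distributed_def by (auto intro!: distr_id2)
  then have "distributed std_normal_distribution lborel (\<lambda>a. \<mu> + s * a) (normal_density (\<mu> + s * 0) (\<bar>s\<bar> * 1))"
    using s by (intro normal_density_affine) auto
  then have "distr std_normal_distribution lborel (\<lambda>a. \<mu> + s * a) = normal_law \<mu> s"
    using s by (simp add: distributed_distr_eq_density)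
  moreover have "distr std_normal_distribution lborel (\<lambda>a. \<mu> + s * a) = distr std_normal_distribution borel (\<lambda>a. \<mu> + s * a)"
    by (intro distr_cong) auto
  ultimately show ?thesis by simp
qed

lemma measurable_affine_gauss:
  "(\<lambda>a. \<lambda>i\<in>{..<n}. w i + s * a i) \<in> measurable (gauss n) (\<Pi>\<^sub>M i\<in>{..<n}. borel)"
  by (intro measurable_restrict) measurable

lemma normal_prod_eq_distr:
  assumes s: "0 < s"
  shows "normal_prod n s w = distr (gauss n) (\<Pi>\<^sub>M i\<in>{..<n}. borel) (\<lambda>a. \<lambda>i\<in>{..<n}. w i + s * a i)"
proof -
  interpret P: product_prob_space "\<lambda>i. normal_law (w i) s"
    by (intro product_prob_spaceI prob_space_normal_density s)
  interpret G: product_prob_space "\<lambda>i :: nat. std_normal_distribution"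
    by (intro product_prob_spaceI prob_space_std_normal)
  show ?thesis
  proof (rule P.PiM_eqI[symmetric, OF finite_lessThan])
    show "sets (distr (gauss n) (\<Pi>\<^sub>M i\<in>{..<n}. borel) (\<lambda>a. \<lambda>i\<in>{..<n}. w i + s * a i)) = sets (normal_prod n s w)"
      by (simp add: sets_normal_prod)
    fix A :: "nat \<Rightarrow> real set" assume "\<And>i. i \<in> {..<n} \<Longrightarrow> A i \<in> sets (normal_law (w i) s)"
    then have A: "\<And>i. i < n \<Longrightarrow> A i \<in> sets borel" by simp
    have pre: "(\<lambda>a. \<lambda>i\<in>{..<n}. w i + s * a i) -` Pi\<^sub>E {..<n} A \<inter> space (gauss n)
        = Pi\<^sub>E {..<n} (\<lambda>i. (\<lambda>a. w i + s * a) -` A i)"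
      by (auto simp: space_gauss PiE_iff)
    have m: "(\<lambda>a. w i + s * a) -` A i \<in> sets borel" if "i < n" for i
    proof -
      have "(\<lambda>a. w i + s * a) \<in> borel_measurable borel" by measurable
      from measurable_sets[OF this A[OF that]] show ?thesis by simp
    qed
    have "emeasure (distr (gauss n) (\<Pi>\<^sub>M i\<in>{..<n}. borel) (\<lambda>a. \<lambda>i\<in>{..<n}. w i + s * a i)) (Pi\<^sub>E {..<n} A)
      = emeasure (gauss n) (Pi\<^sub>E {..<n} (\<lambda>i. (\<lambda>a. w i + s * a) -` A i))"
      using A by (subst emeasure_distr[OF measurable_affine_gauss]) (auto simp: pre intro!: sets_PiM_I_finite)
    also have "\<dots> = (\<Prod>i<n. emeasure std_normal_distribution ((\<lambda>a. w i + s * a) -` A i))"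
      using m by (intro G.emeasure_PiM) auto
    also have "\<dots> = (\<Prod>i<n. emeasure (normal_law (w i) s) (A i))"
    proof (intro prod.cong refl)
      fix i assume "i \<in> {..<n}"
      then show "emeasure std_normal_distribution ((\<lambda>a. w i + s * a) -` A i) = emeasure (normal_law (w i) s) (A i)"
        unfolding normal_law_eq_distr[OF s] using A by (subst emeasure_distr) auto
    qed
    finally show "emeasure (distr (gauss n) (\<Pi>\<^sub>M i\<in>{..<n}. borel) (\<lambda>a. \<lambda>i\<in>{..<n}. w i + s * a i)) (Pi\<^sub>E {..<n} A)
      = (\<Prod>i<n. emeasure (normal_law (w i) s) (A i))" .
  qed
qed

lemma integral_normal_prod:
  fixes f :: "(nat \<Rightarrow> real) \<Rightarrow> real"
  assumes "0 < s" "f \<in> borel_measurable (\<Pi>\<^sub>M i\<in>{..<n}. borel)"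
  shows "integral\<^sup>L (normal_prod n s w) f = (\<integral>a. f (\<lambda>i\<in>{..<n}. w i + s * a i) \<partial>gauss n)"
  unfolding normal_prod_eq_distr[OF assms(1)] by (intro integral_distr measurable_affine_gauss assms)

lemma normal_law_moments:
  assumes s: "0 < s"
  shows "integrable (normal_law \<mu> s) (\<lambda>x. x)" "(\<integral>x. x \<partial>normal_law \<mu> s) = \<mu>"
    "integrable (normal_law \<mu> s) (\<lambda>x. (x - \<mu>)\<^sup>2)" "(\<integral>x. (x - \<mu>)\<^sup>2 \<partial>normal_law \<mu> s) = s\<^sup>2"
    "integrable (normal_law \<mu> s) (\<lambda>x. x\<^sup>2)" "(\<integral>x. x\<^sup>2 \<partial>normal_law \<mu> s) = \<mu>\<^sup>2 + s\<^sup>2"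
proof -
  interpret prob_space "normal_law \<mu> s" by (rule prob_space_normal_density[OF s])
  have [simp]: "measure (normal_law \<mu> s) UNIV = 1" using prob_space by simp
  show 1: "integrable (normal_law \<mu> s) (\<lambda>x. x)"
    using integrable_normal_moment_nz_1[OF s, of \<mu>] by (subst integrable_density) auto
  show 2: "(\<integral>x. x \<partial>normal_law \<mu> s) = \<mu>"
    using integral_normal_moment_nz_1[OF s, of \<mu>] by (subst integral_density) auto
  show 3: "integrable (normal_law \<mu> s) (\<lambda>x. (x - \<mu>)\<^sup>2)"
    using integrable_normal_moment[OF s, of \<mu> 2] by (subst integrable_density) auto
  show 4: "(\<integral>x. (x - \<mu>)\<^sup>2 \<partial>normal_law \<mu> s) = s\<^sup>2"
    using integral_normal_moment_even[OF s, of \<mu> 1] by (subst integral_density) (auto simp: fact_numeral)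
  have eq: "(\<lambda>x. x\<^sup>2) = (\<lambda>x. (x - \<mu>)\<^sup>2 + 2 * \<mu> * x - \<mu>\<^sup>2)"
    by (auto simp: power2_eq_square algebra_simps)
  show "integrable (normal_law \<mu> s) (\<lambda>x. x\<^sup>2)" unfolding eq using 1 3 by auto
  show "(\<integral>x. x\<^sup>2 \<partial>normal_law \<mu> s) = \<mu>\<^sup>2 + s\<^sup>2"
    unfolding eq using 1 2 3 4 by (simp add: prob_space power2_eq_square)
qed

text \<open>The ratio is \<open>exp (- y)\<close> with \<open>y\<close> the right-hand side, so this
  is \<open>1 - y \<le> exp (- y)\<close>. Its use is to bound the effect of a shift of the
  mean.\<close>

lemma one_minus_normal_ratio:
  assumes s: "0 < s"
  shows "1 - normal_density \<mu> s x / normal_density \<nu> s x \<le> (\<nu> - \<mu>) * (x - \<nu>) / s\<^sup>2 + (\<nu> - \<mu>)\<^sup>2 / (2 * s\<^sup>2)"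
proof -
  define y where "y = (\<nu> - \<mu>) * (x - \<nu>) / s\<^sup>2 + (\<nu> - \<mu>)\<^sup>2 / (2 * s\<^sup>2)"
  have "normal_density \<mu> s x / normal_density \<nu> s x = exp (- (x - \<mu>)\<^sup>2 / (2 * s\<^sup>2)) / exp (- (x - \<nu>)\<^sup>2 / (2 * s\<^sup>2))"
    using s by (simp add: normal_density_def)
  also have "\<dots> = exp (- (x - \<mu>)\<^sup>2 / (2 * s\<^sup>2) - - (x - \<nu>)\<^sup>2 / (2 * s\<^sup>2))"
    by (rule exp_diff[symmetric])
  also have "- (x - \<mu>)\<^sup>2 / (2 * s\<^sup>2) - - (x - \<nu>)\<^sup>2 / (2 * s\<^sup>2) = - y"
    unfolding y_def using s by (simp add: divide_simps) (simp add: power2_eq_square algebra_simps)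
  finally have "normal_density \<mu> s x / normal_density \<nu> s x = exp (- y)" .
  then show ?thesis using exp_ge_add_one_self[of "- y"] unfolding y_def[symmetric] by simp
qed

lemma normal_prod_change_mean:
  assumes s: "0 < s" and i: "i < n"
  shows "normal_prod n s w = density (normal_prod n s (w(i := t)))
    (\<lambda>x. ennreal (normal_density (w i) s (x i) / normal_density t s (x i)))"
proof -
  define h where "h j x = (if j = i then normal_density (w i) s x / normal_density t s x else 1)" for j :: nat and x
  have pos: "0 < normal_density \<mu> s x" for \<mu> x using normal_density_pos[OF s] .
  have h0: "0 \<le> h j x" for j x using pos[of "w i" x] pos[of t x] by (simp add: h_def)
  have hm: "h j \<in> borel_measurable (normal_law \<mu> s)" for j \<mu>
    unfolding h_def by (cases "j = i") auto
  have d: "density (normal_law ((w(i := t)) j) s) (h j) = normal_law (w j) s" for j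
  proof -
    have "density (normal_law ((w(i := t)) j) s) (h j) = density lborel (\<lambda>x. ennreal (normal_density ((w(i := t)) j) s x) * ennreal (h j x))"
      using hm by (subst density_density_eq) auto
    also have "\<dots> = normal_law (w j) s"
    proof (intro density_cong AE_I2)
      fix x show "ennreal (normal_density ((w(i := t)) j) s x) * ennreal (h j x) = ennreal (normal_density (w j) s x)"
        using pos[of t x] pos[of "w j" x] by (simp add: h_def ennreal_mult[symmetric])
    qed (use hm in auto)
    finally show ?thesis .
  qed
  have "density (normal_prod n s (w(i := t))) (\<lambda>x. ennreal (\<Prod>j\<in>{..<n}. h j (x j)))
      = Pi\<^sub>M {..<n} (\<lambda>j. density (normal_law ((w(i := t)) j) s) (h j))"
  proof (rule PiM_density_prod)
    show "prob_space (density (normal_law ((w(i := t)) j) s) (h j))" for j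
      unfolding d by (rule prob_space_normal_density[OF s])
  qed (use h0 hm in \<open>auto intro!: prob_space_normal_density s\<close>)
  also have "\<dots> = normal_prod n s w" by (simp only: d)
  also have "(\<lambda>x. \<Prod>j\<in>{..<n}. h j (x j)) = (\<lambda>x. normal_density (w i) s (x i) / normal_density t s (x i))"
  proof
    fix x :: "nat \<Rightarrow> real"
    have "(\<Prod>j\<in>{..<n}. h j (x j)) = (\<Prod>j\<in>{..<n}. if j = i then normal_density (w i) s (x i) / normal_density t s (x i) else 1)"
      by (intro prod.cong) (auto simp: h_def)
    then show "(\<Prod>j\<in>{..<n}. h j (x j)) = normal_density (w i) s (x i) / normal_density t s (x i)"
      using i by simp
  qed
  finally show ?thesis by simp
qed

text \<open>Monotonicity follows by adding the same noise to both means. For the upper bound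
  \<open>f\<close> may be discontinuous, so the shift is moved from the argument of \<open>f\<close>
  to the density of the normal law.\<close>

lemma lipschitz_incr_normal_average:
  assumes s: "0 < s" and f: "f \<in> borel_measurable (\<Pi>\<^sub>M i\<in>{..<n}. borel)"
    and f01: "\<And>x. x \<in> {..<n} \<rightarrow>\<^sub>E UNIV \<Longrightarrow> 0 \<le> f x \<and> f x \<le> 1" and inc: "incr_on {..<n} f"
  shows "lipschitz_incr n (2 / s) (\<lambda>w. integral\<^sup>L (normal_prod n s w) f)"
  unfolding lipschitz_incr_def
proof (intro ballI allI impI conjI)
  fix w :: "nat \<Rightarrow> real" and i t assume w: "w \<in> {..<n} \<rightarrow>\<^sub>E UNIV" and i: "i < n" and t: "w i \<le> t"
  define w' where "w' = w(i := t)"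
  interpret G: prob_space "gauss n" by (rule prob_space_gauss)
  interpret N: prob_space "normal_prod n s w" by (rule prob_space_normal_prod[OF s])
  interpret N': prob_space "normal_prod n s w'" by (rule prob_space_normal_prod[OF s])
  have fN: "f \<in> borel_measurable (normal_prod n s w)" for w
    using f by (simp add: measurable_cong_sets[OF sets_normal_prod refl])
  have f01': "0 \<le> f x \<and> f x \<le> 1" if "x \<in> space (normal_prod n s w)" for x w
    using f01 that by (simp add: space_normal_prod)
  have int: "integrable (gauss n) (\<lambda>a. f (\<lambda>i\<in>{..<n}. w i + s * a i))" for w
    using measurable_compose[OF measurable_affine_gauss f] f01 by (intro G.integrable_01) auto
  show "integral\<^sup>L (normal_prod n s w) f \<le> integral\<^sup>L (normal_prod n s (w(i := t))) f"
    unfolding integral_normal_prod[OF s f]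
  proof (rule integral_mono[OF int int])
    fix a :: "nat \<Rightarrow> real"
    have "(\<lambda>j\<in>{..<n}. (w(i := t)) j + s * a j) = (\<lambda>j\<in>{..<n}. w j + s * a j)(i := t + s * a i)"
      using i by (auto simp: fun_eq_iff)
    then show "f (\<lambda>j\<in>{..<n}. w j + s * a j) \<le> f (\<lambda>j\<in>{..<n}. (w(i := t)) j + s * a j)"
      using incr_onD[OF inc, of "\<lambda>j\<in>{..<n}. w j + s * a j" i "t + s * a i"] i t by auto
  qed
  define \<delta> where "\<delta> = t - w i"
  have \<delta>: "0 \<le> \<delta>" using t by (simp add: \<delta>_def)
  define I where "I = integral\<^sup>L (normal_prod n s w) f"
  define I' where "I' = integral\<^sup>L (normal_prod n s w') f"
  have I: "0 \<le> I" "I' \<le> 1"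
    unfolding I_def I'_def using N.integral_01[OF fN f01'] N'.integral_01[OF fN f01'] by auto
  have "I' - I \<le> 2 / s * \<delta>"
  \<comment> \<open>A shift of more than \<open>s\<close> costs nothing, since averages of
    \<open>f\<close> differ by at most 1.\<close>
  proof (cases "\<delta> \<le> s")
    case False
    then have "1 \<le> \<delta> / s" using s by simp
    also have "\<dots> \<le> 2 / s * \<delta>" using \<delta> s by (simp add: field_simps)
    finally show ?thesis using I by linarith
  next
    case True
    define \<rho> where "\<rho> x = normal_density (w i) s x / normal_density t s x" for x
    \<comment> \<open>The arithmetic-geometric mean inequality replaces the signed
      \<open>x - t\<close> by a nonnegative quadratic, so that \<open>f \<le> 1\<close> can then be
      used. The mean of \<open>B\<close> is \<open>\<delta> / s + (\<delta> / s)^2 / 2\<close>, at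
      most \<open>3/2 * \<delta> / s\<close> in this case.\<close>
    define B where "B x = \<delta> / s\<^sup>2 * (((x - t)\<^sup>2 / s + s) / 2) + \<delta>\<^sup>2 / (2 * s\<^sup>2)" for x
    have \<rho>0: "0 \<le> \<rho> x" for x by (simp add: \<rho>_def)
    have B0: "0 \<le> B x" for x unfolding B_def using \<delta> s by simp
    have \<rho>B: "1 - \<rho> x \<le> B x" for x
    proof -
      have "0 \<le> (x - t - s)\<^sup>2" by simp
      then have "(x - t) * (2 * s) \<le> (x - t)\<^sup>2 + s * s" by (simp add: power2_eq_square algebra_simps)
      then have "x - t \<le> ((x - t)\<^sup>2 / s + s) / 2" using s by (simp add: field_simps)
      then have "\<delta> / s\<^sup>2 * (x - t) \<le> \<delta> / s\<^sup>2 * (((x - t)\<^sup>2 / s + s) / 2)"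
        using \<delta> by (intro mult_left_mono) auto
      then show ?thesis
        using one_minus_normal_ratio[OF s, of "w i" x t] by (simp add: \<rho>_def B_def \<delta>_def)
    qed
    have xi: "(\<lambda>x. x i) \<in> borel_measurable (normal_prod n s w')"
      using measurable_component_singleton[of i "{..<n}" "\<lambda>_. borel"] i
      by (simp add: measurable_cong_sets[OF sets_normal_prod refl])
    have \<rho>m: "(\<lambda>x. \<rho> (x i)) \<in> borel_measurable (normal_prod n s w')"
      unfolding \<rho>_def using xi by measurable
    have I_eq: "I = (\<integral>x. \<rho> (x i) * f x \<partial>normal_prod n s w')"
      unfolding I_def normal_prod_change_mean[OF s i, of w t] w'_def[symmetric] \<rho>_def[symmetric]
      using \<rho>m \<rho>0 fN by (subst integral_density) auto
    have int1: "integrable (normal_prod n s w') (\<lambda>x. \<rho> (x i) * f x)"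
    proof -
      have "integrable (density (normal_prod n s w') (\<lambda>x. ennreal (\<rho> (x i)))) f"
        unfolding \<rho>_def w'_def normal_prod_change_mean[OF s i, of w t, symmetric]
        by (rule N.integrable_01[OF fN f01'])
      then show ?thesis using \<rho>m \<rho>0 fN by (subst (asm) integrable_density) auto
    qed
    have int2: "integrable (normal_prod n s w') f"
      by (rule N'.integrable_01[OF fN f01'])
    have Bint: "integrable (normal_law t s) B" "integral\<^sup>L (normal_law t s) B = \<delta> / s + \<delta>\<^sup>2 / (2 * s\<^sup>2)"
    proof -
      interpret P: prob_space "normal_law t s" by (rule prob_space_normal_density[OF s])
      have [simp]: "measure (normal_law t s) UNIV = 1" using P.prob_space by simp
      show "integrable (normal_law t s) B"
        unfolding B_def using normal_law_moments(3)[OF s, of t] by auto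
      show "integral\<^sup>L (normal_law t s) B = \<delta> / s + \<delta>\<^sup>2 / (2 * s\<^sup>2)"
        unfolding B_def using normal_law_moments(3,4)[OF s, of t] s
        by (simp add: power2_eq_square)
    qed
    have Bm: "B \<in> borel_measurable (normal_law (w' i) s)" using Bint(1) by (auto simp: B_def)
    have w'i: "w' i = t" by (simp add: w'_def)
    have BP: "integrable (normal_prod n s w') (\<lambda>x. B (x i))" "(\<integral>x. B (x i) \<partial>normal_prod n s w') = \<delta> / s + \<delta>\<^sup>2 / (2 * s\<^sup>2)"
    proof -
      note C = integral_PiM_component[of "{..<n}" "\<lambda>i. normal_law (w' i) s" i B,
          OF prob_space_normal_density[OF s] finite_lessThan _ Bm]
      have "i \<in> {..<n}" using i by simp
      note C = C[OF this]
      show "integrable (normal_prod n s w') (\<lambda>x. B (x i))"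
        using Bint(1) by (intro C(2)) (simp only: w'i)
      show "(\<integral>x. B (x i) \<partial>normal_prod n s w') = \<delta> / s + \<delta>\<^sup>2 / (2 * s\<^sup>2)"
        unfolding C(1) w'i by (rule Bint(2))
    qed
    have "I' - I = (\<integral>x. f x - \<rho> (x i) * f x \<partial>normal_prod n s w')"
      unfolding I_eq I'_def using int1 int2 by simp
    also have "\<dots> \<le> (\<integral>x. B (x i) \<partial>normal_prod n s w')"
    proof (rule integral_mono)
      fix x assume x: "x \<in> space (normal_prod n s w')"
      have "f x - \<rho> (x i) * f x = (1 - \<rho> (x i)) * f x" by (simp add: algebra_simps)
      also have "\<dots> \<le> B (x i) * f x" using \<rho>B f01'[OF x] by (intro mult_right_mono) auto
      also have "\<dots> \<le> B (x i) * 1" using B0 f01'[OF x] by (intro mult_left_mono) auto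
      finally show "f x - \<rho> (x i) * f x \<le> B (x i)" by simp
    qed (use int1 int2 BP in auto)
    also have "\<dots> = \<delta> / s + \<delta> / s * (\<delta> / s) / 2" using BP(2) by (simp add: power2_eq_square)
    also have "\<dots> \<le> \<delta> / s + \<delta> / s * 1 / 2"
      using \<delta> s True by (intro add_left_mono divide_right_mono mult_left_mono) auto
    also have "\<dots> \<le> 2 / s * \<delta>" using \<delta> s by (simp add: field_simps)
    finally show ?thesis .
  qed
  then show "integral\<^sup>L (normal_prod n s (w(i := t))) f \<le> integral\<^sup>L (normal_prod n s w) f + 2 / s * (t - w i)"
    by (simp add: I_def I'_def w'_def \<delta>_def)
qed

text \<open>The mean of \<open>f\<close> at \<open>r * w\<close> plus \<open>s\<close> times a
  standard Gaussian vector. For \<open>r^2 + s^2 = 1\<close> and \<open>0 < r < 1\<close> this is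
  the Ornstein-Uhlenbeck semigroup at time \<open>- ln r\<close>.\<close>

definition smooth :: "nat \<Rightarrow> real \<Rightarrow> real \<Rightarrow> ((nat \<Rightarrow> real) \<Rightarrow> real) \<Rightarrow> (nat \<Rightarrow> real) \<Rightarrow> real" where
  "smooth n r s f w = integral\<^sup>L (normal_prod n s (\<lambda>i\<in>{..<n}. r * w i)) f"

lemma lipschitz_incr_smooth:
  assumes r: "0 < r" and s: "0 < s" and f: "f \<in> borel_measurable (\<Pi>\<^sub>M i\<in>{..<n}. borel)"
    and f01: "\<And>x. x \<in> {..<n} \<rightarrow>\<^sub>E UNIV \<Longrightarrow> 0 \<le> f x \<and> f x \<le> 1" and inc: "incr_on {..<n} f"
  shows "lipschitz_incr n (2 * r / s) (smooth n r s f)"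
  unfolding lipschitz_incr_def
proof (intro ballI allI impI)
  fix w :: "nat \<Rightarrow> real" and i t assume w: "w \<in> {..<n} \<rightarrow>\<^sub>E UNIV" and i: "i < n" and t: "w i \<le> t"
  define v where "v = (\<lambda>i\<in>{..<n}. r * w i)"
  have "(\<lambda>j\<in>{..<n}. r * (w(i := t)) j) = v(i := r * t)"
    using i by (auto simp: v_def fun_eq_iff)
  moreover have "v i \<le> r * t" using i r t by (simp add: v_def)
  moreover have "2 * r / s * (t - w i) = 2 / s * (r * t - v i)"
    using i s by (simp add: v_def field_simps)
  moreover have "v \<in> {..<n} \<rightarrow>\<^sub>E UNIV" by (simp add: v_def)
  ultimately show "smooth n r s f w \<le> smooth n r s f (w(i := t)) \<and>
      smooth n r s f (w(i := t)) \<le> smooth n r s f w + 2 * r / s * (t - w i)"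
    using lipschitz_incrD[OF lipschitz_incr_normal_average[OF s f f01 inc], of v i "r * t"] i
    by (simp only: smooth_def v_def[symmetric])
qed

lemma smooth_01:
  assumes s: "0 < s" and f: "f \<in> borel_measurable (\<Pi>\<^sub>M i\<in>{..<n}. borel)"
    and f01: "\<And>x. x \<in> {..<n} \<rightarrow>\<^sub>E UNIV \<Longrightarrow> 0 \<le> f x \<and> f x \<le> 1"
  shows "0 \<le> smooth n r s f w \<and> smooth n r s f w \<le> 1"
proof -
  interpret prob_space "normal_prod n s (\<lambda>i\<in>{..<n}. r * w i)" by (rule prob_space_normal_prod[OF s])
  show ?thesis unfolding smooth_def
    using f f01 by (intro integral_01) (auto simp: space_normal_prod measurable_cong_sets[OF sets_normal_prod refl])
qed

section \<open>The Mehler kernel and its action on Hermite coefficients\<close>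

definition mehler :: "nat \<Rightarrow> real \<Rightarrow> real \<Rightarrow> (nat \<Rightarrow> real) \<Rightarrow> (nat \<Rightarrow> real) \<Rightarrow> real" where
  "mehler n r s w x = (\<Prod>i<n. normal_density (r * w i) s (x i) / std_normal_density (x i))"

lemma mehler_nonneg: "0 < s \<Longrightarrow> 0 \<le> mehler n r s w x"
  by (auto simp: mehler_def intro!: prod_nonneg)

text \<open>Substituting \<open>s^2 = 1 - r^2\<close> turns the exponent of one factor into
  \<open>(2 * r * a * b - r^2 * a^2 - r^2 * b^2) / (2 * s^2)\<close>, which is symmetric. This is
  the reversibility of the semigroup.\<close>

lemma mehler_sym:
  assumes s: "0 < s" and rs: "r\<^sup>2 + s\<^sup>2 = 1"
  shows "mehler n r s w x = mehler n r s x w"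
  unfolding mehler_def
proof (rule prod.cong[OF refl])
  fix i
  have 1: "normal_density (r * a) s b / std_normal_density b
      = 1 / s * exp ((2 * r * a * b - r\<^sup>2 * a\<^sup>2 - r\<^sup>2 * b\<^sup>2) / (2 * s\<^sup>2))" for a b
  proof -
    have "normal_density (r * a) s b / std_normal_density b
        = 1 / s * (exp (- (b - r * a)\<^sup>2 / (2 * s\<^sup>2)) / exp (- b\<^sup>2 / 2))"
      using s by (simp add: normal_density_def real_sqrt_mult)
    also have "exp (- (b - r * a)\<^sup>2 / (2 * s\<^sup>2)) / exp (- b\<^sup>2 / 2) = exp (- (b - r * a)\<^sup>2 / (2 * s\<^sup>2) - - b\<^sup>2 / 2)"
      by (rule exp_diff[symmetric])
    also have "- (b - r * a)\<^sup>2 / (2 * s\<^sup>2) - - b\<^sup>2 / 2 = (2 * r * a * b - r\<^sup>2 * a\<^sup>2 - r\<^sup>2 * b\<^sup>2) / (2 * s\<^sup>2)"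
    proof -
      have "- b\<^sup>2 / 2 = - (b\<^sup>2 * s\<^sup>2) / (2 * s\<^sup>2)" using s by simp
      moreover have "s\<^sup>2 = 1 - r\<^sup>2" using rs by simp
      ultimately have "- (b - r * a)\<^sup>2 / (2 * s\<^sup>2) - - b\<^sup>2 / 2
          = (- (b - r * a)\<^sup>2 + b\<^sup>2 * (1 - r\<^sup>2)) / (2 * s\<^sup>2)"
        by (simp add: add_divide_distrib diff_divide_distrib)
      also have "- (b - r * a)\<^sup>2 + b\<^sup>2 * (1 - r\<^sup>2) = 2 * r * a * b - r\<^sup>2 * a\<^sup>2 - r\<^sup>2 * b\<^sup>2"
        by (simp add: power2_eq_square algebra_simps)
      finally show ?thesis .
    qed
    finally show ?thesis .
  qed
  show "normal_density (r * w i) s (x i) / std_normal_density (x i)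
      = normal_density (r * x i) s (w i) / std_normal_density (w i)"
    unfolding 1 by (simp add: algebra_simps)
qed

lemma normal_prod_eq_density:
  assumes s: "0 < s"
  shows "normal_prod n s (\<lambda>i\<in>{..<n}. r * w i) = density (gauss n) (\<lambda>x. ennreal (mehler n r s w x))"
proof -
  have d: "density std_normal_distribution (\<lambda>x. ennreal (normal_density \<mu> s x / std_normal_density x)) = normal_law \<mu> s" for \<mu>
  proof (subst density_density_eq)
    show "density lborel (\<lambda>x. ennreal (std_normal_density x) * ennreal (normal_density \<mu> s x / std_normal_density x)) = normal_law \<mu> s"
    proof (intro density_cong AE_I2)
      fix x
      have "0 < std_normal_density x" by (rule normal_density_pos) simp
      then show "ennreal (std_normal_density x) * ennreal (normal_density \<mu> s x / std_normal_density x) = ennreal (normal_density \<mu> s x)"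
        by (simp add: ennreal_mult[symmetric])
    qed auto
  qed auto
  have "density (gauss n) (\<lambda>x. ennreal (mehler n r s w x))
      = Pi\<^sub>M {..<n} (\<lambda>i. density std_normal_distribution (\<lambda>x. ennreal (normal_density (r * w i) s x / std_normal_density x)))"
    unfolding mehler_def
  proof (rule PiM_density_prod)
    show "prob_space (density std_normal_distribution (\<lambda>x. ennreal (normal_density (r * w i) s x / std_normal_density x)))" for i
      unfolding d by (rule prob_space_normal_density[OF s])
  qed (auto intro: prob_space_std_normal)
  also have "\<dots> = normal_prod n s (\<lambda>i\<in>{..<n}. r * w i)"
    unfolding d by (intro PiM_cong) auto
  finally show ?thesis by simp
qed

lemma measurable_mehler:
  "(\<lambda>p. mehler n r s (fst p) (snd p)) \<in> borel_measurable (gauss n \<Otimes>\<^sub>M gauss n)"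
proof -
  have [measurable]: "(\<lambda>p. fst p i) \<in> borel_measurable (gauss n \<Otimes>\<^sub>M gauss n)"
    "(\<lambda>p. snd p i) \<in> borel_measurable (gauss n \<Otimes>\<^sub>M gauss n)" if "i < n" for i
    using measurable_compose[OF measurable_fst measurable_gauss_component[OF that]]
      measurable_compose[OF measurable_snd measurable_gauss_component[OF that]] by auto
  show ?thesis
    unfolding mehler_def normal_density_def
    by (intro borel_measurable_prod) measurable
qed

lemma measurable_mehler1: "mehler n r s w \<in> borel_measurable (gauss n)"
  unfolding mehler_def normal_density_def by (intro borel_measurable_prod) measurable

lemma integral_normal_prod_mehler:
  fixes h :: "(nat \<Rightarrow> real) \<Rightarrow> real"
  assumes s: "0 < s" and h: "h \<in> borel_measurable (gauss n)"
  shows "integral\<^sup>L (normal_prod n s (\<lambda>i\<in>{..<n}. r * w i)) h = (\<integral>x. mehler n r s w x * h x \<partial>gauss n)"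
    and "integrable (normal_prod n s (\<lambda>i\<in>{..<n}. r * w i)) h \<longleftrightarrow> integrable (gauss n) (\<lambda>x. mehler n r s w x * h x)"
  unfolding normal_prod_eq_density[OF s] using measurable_mehler1 h mehler_nonneg[OF s]
  by (simp_all add: integral_density integrable_density)

lemma measurable_smooth:
  assumes s: "0 < s" and f: "f \<in> borel_measurable (gauss n)"
  shows "smooth n r s f \<in> borel_measurable (gauss n)"
proof -
  interpret G: prob_space "gauss n" by (rule prob_space_gauss)
  have "(\<lambda>p. mehler n r s (fst p) (snd p) * f (snd p)) \<in> borel_measurable (gauss n \<Otimes>\<^sub>M gauss n)"
    by (intro borel_measurable_times measurable_mehler measurable_compose[OF measurable_snd f])
  then have "(\<lambda>w. \<integral>x. mehler n r s w x * f x \<partial>gauss n) \<in> borel_measurable (gauss n)"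
    by (intro G.borel_measurable_lebesgue_integral) (simp add: split_beta)
  then show ?thesis
    unfolding smooth_def[abs_def] integral_normal_prod_mehler(1)[OF s f] .
qed

text \<open>Fubini and the symmetry of the kernel. The function \<open>h\<close> is only integrable,
  so that unbounded Hermite polynomials can be inserted; the bound on \<open>f\<close> provides the
  absolute integrability.\<close>

lemma smooth_adjoint:
  assumes s: "0 < s" and rs: "r\<^sup>2 + s\<^sup>2 = 1" and f: "f \<in> borel_measurable (\<Pi>\<^sub>M i\<in>{..<n}. borel)"
    and f01: "\<And>x. x \<in> {..<n} \<rightarrow>\<^sub>E UNIV \<Longrightarrow> 0 \<le> f x \<and> f x \<le> 1"
    and h: "integrable (gauss n) h"
  shows "(\<integral>w. h w * smooth n r s f w \<partial>gauss n)
    = (\<integral>x. integral\<^sup>L (normal_prod n s (\<lambda>i\<in>{..<n}. r * x i)) h * f x \<partial>gauss n)"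
proof -
  interpret G: prob_space "gauss n" by (rule prob_space_gauss)
  interpret GG: pair_prob_space "gauss n" "gauss n" ..
  have fg: "f \<in> borel_measurable (gauss n)"
    using f by (simp add: measurable_cong_sets[OF sets_gauss refl])
  have hm: "h \<in> borel_measurable (gauss n)" using h by simp
  note sm = smooth_01[OF s f f01, of r]
  define \<phi> where "\<phi> w x = h w * (mehler n r s w x * f x)" for w x
  have \<phi>m: "(\<lambda>p. \<phi> (fst p) (snd p)) \<in> borel_measurable (gauss n \<Otimes>\<^sub>M gauss n)"
    unfolding \<phi>_def
    by (intro borel_measurable_times measurable_mehler measurable_compose[OF measurable_snd fg]
        measurable_compose[OF measurable_fst hm])
  have int_x: "integrable (gauss n) (\<lambda>x. mehler n r s w x * f x)" for w
  proof -
    interpret N: prob_space "normal_prod n s (\<lambda>i\<in>{..<n}. r * w i)" by (rule prob_space_normal_prod[OF s])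
    have "integrable (normal_prod n s (\<lambda>i\<in>{..<n}. r * w i)) f"
      using f f01 by (intro N.integrable_01) (auto simp: space_normal_prod measurable_cong_sets[OF sets_normal_prod refl])
    then show ?thesis using integral_normal_prod_mehler(2)[OF s fg] by blast
  qed
  have sm_eq: "(\<integral>x. mehler n r s w x * f x \<partial>gauss n) = smooth n r s f w" for w
    by (simp only: smooth_def integral_normal_prod_mehler(1)[OF s fg])
  have norm_eq: "(\<integral>x. norm (\<phi> w x) \<partial>gauss n) = \<bar>h w\<bar> * smooth n r s f w" for w
  proof -
    have "(\<integral>x. norm (\<phi> w x) \<partial>gauss n) = (\<integral>x. \<bar>h w\<bar> * (mehler n r s w x * f x) \<partial>gauss n)"
      using f01 mehler_nonneg[OF s]
      by (intro Bochner_Integration.integral_cong) (auto simp: \<phi>_def abs_mult space_gauss)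
    then show ?thesis by (simp add: sm_eq)
  qed
  have "integrable (gauss n \<Otimes>\<^sub>M gauss n) (\<lambda>p. \<phi> (fst p) (snd p))"
  proof (rule GG.Fubini_integrable[OF \<phi>m])
    show "integrable (gauss n) (\<lambda>w. \<integral>x. norm (\<phi> (fst (w, x)) (snd (w, x))) \<partial>gauss n)"
      unfolding fst_conv snd_conv norm_eq
    proof (rule Bochner_Integration.integrable_bound[OF h])
      show "(\<lambda>w. \<bar>h w\<bar> * smooth n r s f w) \<in> borel_measurable (gauss n)"
        by (intro borel_measurable_times borel_measurable_abs hm measurable_smooth s fg)
      show "AE w in gauss n. norm (\<bar>h w\<bar> * smooth n r s f w) \<le> norm (h w)"
        using sm by (intro AE_I2) (simp add: abs_mult mult_left_le)
    qed
    show "AE w in gauss n. integrable (gauss n) (\<lambda>x. \<phi> (fst (w, x)) (snd (w, x)))"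
      using int_x by (simp add: \<phi>_def)
  qed
  then have "integrable (gauss n \<Otimes>\<^sub>M gauss n) (case_prod \<phi>)"
    by (simp add: split_beta')
  then have "(\<integral>x. (\<integral>w. \<phi> w x \<partial>gauss n) \<partial>gauss n) = (\<integral>w. (\<integral>x. \<phi> w x \<partial>gauss n) \<partial>gauss n)"
    by (rule GG.Fubini_integral)
  moreover have "(\<integral>x. \<phi> w x \<partial>gauss n) = h w * smooth n r s f w" for w
    by (simp add: \<phi>_def sm_eq)
  moreover have "(\<integral>w. \<phi> w x \<partial>gauss n) = integral\<^sup>L (normal_prod n s (\<lambda>i\<in>{..<n}. r * x i)) h * f x" for x
  proof -
    have "(\<integral>w. \<phi> w x \<partial>gauss n) = (\<integral>w. mehler n r s x w * h w * f x \<partial>gauss n)"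
      by (intro Bochner_Integration.integral_cong refl) (simp add: \<phi>_def mehler_sym[OF s rs, of n x])
    then show ?thesis unfolding integral_normal_prod_mehler(1)[OF s hm] by simp
  qed
  ultimately show ?thesis by simp
qed

lemma normal_prod_moments:
  assumes s: "0 < s" and i: "i < n" and k: "k < n"
  shows "(\<integral>x. x i \<partial>normal_prod n s w) = w i"
    and "(\<integral>x. x i * x k \<partial>normal_prod n s w) = w i * w k + (if i = k then s\<^sup>2 else 0)"
    and "integrable (normal_prod n s w) (\<lambda>x. x i * x k)"
proof -
  interpret P: product_prob_space "\<lambda>i. normal_law (w i) s"
    by (intro product_prob_spaceI prob_space_normal_density s)
  have ps: "\<And>j. j \<in> {..<n} \<Longrightarrow> prob_space (normal_law (w j) s)" by (rule prob_space_normal_density[OF s])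
  have [simp]: "measure (normal_law (w j) s) UNIV = 1" for j
    using prob_space.prob_space[OF prob_space_normal_density[OF s]] by simp
  show "(\<integral>x. x i \<partial>normal_prod n s w) = w i"
    using integral_PiM_component(1)[of "{..<n}" "\<lambda>i. normal_law (w i) s" i "\<lambda>x. x", OF ps] i normal_law_moments(2)[OF s, of "w i"] by simp
  define g where "g j t = (if j = i then t else 1) * (if j = k then t else (1::real))" for j t
  have g_eq: "x i * x k = (\<Prod>j<n. g j (x j))" for x :: "nat \<Rightarrow> real"
  proof -
    have "(\<Prod>j<n. g j (x j)) = (\<Prod>j<n. if j = i then x i else 1) * (\<Prod>j<n. if j = k then x k else 1)"
      unfolding g_def prod.distrib[symmetric] by (intro prod.cong) auto
    then show ?thesis using i k by simp
  qed
  have gi: "integrable (normal_law (w j) s) (g j)" for j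
    using normal_law_moments(1,5)[OF s, of "w j"] by (cases "j = i"; cases "j = k") (auto simp: g_def[abs_def] power2_eq_square)
  show "integrable (normal_prod n s w) (\<lambda>x. x i * x k)"
    unfolding g_eq by (intro P.product_integrable_prod gi) auto
  have "(\<integral>x. x i * x k \<partial>normal_prod n s w) = (\<Prod>j<n. integral\<^sup>L (normal_law (w j) s) (g j))"
    unfolding g_eq by (intro P.product_integral_prod gi) auto
  also have "\<dots> = w i * w k + (if i = k then s\<^sup>2 else 0)"
  proof (cases "i = k")
    case True
    have "(\<Prod>j<n. integral\<^sup>L (normal_law (w j) s) (g j)) = (\<Prod>j<n. if j = i then (w i)\<^sup>2 + s\<^sup>2 else 1)"
      using True normal_law_moments(6)[OF s, of "w i"]
      by (intro prod.cong) (auto simp: g_def[abs_def] power2_eq_square)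
    then show ?thesis using i True by (simp add: power2_eq_square)
  next
    case False
    have "(\<Prod>j<n. integral\<^sup>L (normal_law (w j) s) (g j)) = (\<Prod>j<n. (if j = i then w i else 1) * (if j = k then w k else 1))"
      using False normal_law_moments(2)[OF s] by (intro prod.cong) (auto simp: g_def[abs_def])
    then show ?thesis using i k False by (simp add: prod.distrib)
  qed
  finally show "(\<integral>x. x i * x k \<partial>normal_prod n s w) = w i * w k + (if i = k then s\<^sup>2 else 0)" .
qed

lemma integrable_gauss_component: "i < n \<Longrightarrow> integrable (gauss n) (\<lambda>x. x i)"
  by (intro integral_PiM_component(2)) (auto intro!: prob_space_std_normal integrable_std_normal_powers)

text \<open>Hermite polynomials of degree \<open>d\<close> are eigenfunctions with eigenvalue
  \<open>r^d\<close>, and adjointness moves the smoothing onto them. On the diagonal the variance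
  enters through \<open>r^2 * x^2 + s^2 - 1 = r^2 * (x^2 - 1)\<close>.\<close>

lemma smooth_moments:
  assumes s: "0 < s" and rs: "r\<^sup>2 + s\<^sup>2 = 1" and f: "f \<in> borel_measurable (\<Pi>\<^sub>M i\<in>{..<n}. borel)"
    and f01: "\<And>x. x \<in> {..<n} \<rightarrow>\<^sub>E UNIV \<Longrightarrow> 0 \<le> f x \<and> f x \<le> 1"
  shows "(\<integral>x. smooth n r s f x \<partial>gauss n) = (\<integral>x. f x \<partial>gauss n)"
    and "i < n \<Longrightarrow> gauss_coeff1 n (smooth n r s f) i = r * gauss_coeff1 n f i"
    and "i < n \<Longrightarrow> k < n \<Longrightarrow> gauss_coeff2 n (smooth n r s f) i k = r\<^sup>2 * gauss_coeff2 n f i k"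
proof -
  interpret G: prob_space "gauss n" by (rule prob_space_gauss)
  have adj: "(\<integral>w. h w * smooth n r s f w \<partial>gauss n)
    = (\<integral>x. integral\<^sup>L (normal_prod n s (\<lambda>i\<in>{..<n}. r * x i)) h * f x \<partial>gauss n)"
    if "integrable (gauss n) h" for h
    by (rule smooth_adjoint[OF s rs f f01 that])
  have N1: "measure (normal_prod n s w) (space (normal_prod n s w)) = 1" for w
    by (rule prob_space.prob_space[OF prob_space_normal_prod[OF s]])
  show "(\<integral>x. smooth n r s f x \<partial>gauss n) = (\<integral>x. f x \<partial>gauss n)"
    using adj[of "\<lambda>_. 1"] N1 by simp
  show "gauss_coeff1 n (smooth n r s f) i = r * gauss_coeff1 n f i" if i: "i < n"
    unfolding gauss_coeff1_def adj[OF integrable_gauss_component[OF i]] normal_prod_moments(1)[OF s i i]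
    using i by (simp add: mult.assoc)
  show "gauss_coeff2 n (smooth n r s f) i k = r\<^sup>2 * gauss_coeff2 n f i k" if i: "i < n" and k: "k < n"
  proof -
    have "integrable (gauss n) (\<lambda>x. x i * x k)"
    proof (rule integrable_gauss_quadratic[OF _ i k])
      show "\<bar>x i * x k\<bar> \<le> 1 + (x i)\<^sup>2 + (x k)\<^sup>2" for x :: "nat \<Rightarrow> real"
        using abs_mult_le_sum_squares[of "x i" "x k"] by simp
    qed (intro borel_measurable_times measurable_gauss_component i k)
    then have "integrable (gauss n) (\<lambda>x. x i * x k - (if i = k then 1 else 0))" by auto
    note A = adj[OF this]
    have "(\<integral>w. w i * w k - (if i = k then 1 else 0) \<partial>normal_prod n s (\<lambda>i\<in>{..<n}. r * x i))
        = r\<^sup>2 * (x i * x k - (if i = k then 1 else 0))" for x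
    proof -
      interpret N: prob_space "normal_prod n s (\<lambda>i\<in>{..<n}. r * x i)" by (rule prob_space_normal_prod[OF s])
      have "(\<integral>w. w i * w k - (if i = k then 1 else 0) \<partial>normal_prod n s (\<lambda>i\<in>{..<n}. r * x i))
        = (\<integral>w. w i * w k \<partial>normal_prod n s (\<lambda>i\<in>{..<n}. r * x i)) - (if i = k then 1 else 0)"
      proof -
        have "(\<integral>w. c \<partial>normal_prod n s (\<lambda>i\<in>{..<n}. r * x i)) = c" for c :: real
          unfolding lebesgue_integral_const N1 by simp
        then show ?thesis
          by (simp only: Bochner_Integration.integral_diff[OF normal_prod_moments(3)[OF s i k] N.integrable_const])
      qed
      also have "\<dots> = (r * x i) * (r * x k) + (if i = k then s\<^sup>2 else 0) - (if i = k then 1 else 0)"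
        using normal_prod_moments(2)[OF s i k] i k by simp
      also have "\<dots> = r\<^sup>2 * (x i * x k - (if i = k then 1 else 0))"
        using rs by (auto simp: power2_eq_square algebra_simps)
      finally show ?thesis .
    qed
    then show ?thesis unfolding gauss_coeff2_def A by (simp add: mult.assoc)
  qed
qed

text \<open>Harris' inequality at each point compares the product of the smoothed functions with the
  smoothed product, whose mean is that of the product itself.\<close>

lemma smooth_mult_le:
  assumes s: "0 < s" and rs: "r\<^sup>2 + s\<^sup>2 = 1"
    and f: "f \<in> borel_measurable (\<Pi>\<^sub>M i\<in>{..<n}. borel)" "\<And>x. x \<in> {..<n} \<rightarrow>\<^sub>E UNIV \<Longrightarrow> 0 \<le> f x \<and> f x \<le> 1" "incr_on {..<n} f"
    and g: "g \<in> borel_measurable (\<Pi>\<^sub>M i\<in>{..<n}. borel)" "\<And>x. x \<in> {..<n} \<rightarrow>\<^sub>E UNIV \<Longrightarrow> 0 \<le> g x \<and> g x \<le> 1" "incr_on {..<n} g"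
  shows "(\<integral>x. smooth n r s f x * smooth n r s g x \<partial>gauss n) \<le> (\<integral>x. f x * g x \<partial>gauss n)"
proof -
  interpret G: prob_space "gauss n" by (rule prob_space_gauss)
  have fg: "(\<lambda>x. f x * g x) \<in> borel_measurable (\<Pi>\<^sub>M i\<in>{..<n}. borel)"
    "\<And>x. x \<in> {..<n} \<rightarrow>\<^sub>E UNIV \<Longrightarrow> 0 \<le> f x * g x \<and> f x * g x \<le> 1"
    using f g by (auto intro: mult_le_one)
  have ms: "smooth n r s h \<in> borel_measurable (gauss n)" if "h \<in> borel_measurable (\<Pi>\<^sub>M i\<in>{..<n}. borel)" for h
    using that by (intro measurable_smooth s) (simp add: measurable_cong_sets[OF sets_gauss refl])
  have "(\<integral>x. smooth n r s f x * smooth n r s g x \<partial>gauss n) \<le> (\<integral>x. smooth n r s (\<lambda>x. f x * g x) x \<partial>gauss n)"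
  proof (rule integral_mono)
    show "smooth n r s f x * smooth n r s g x \<le> smooth n r s (\<lambda>x. f x * g x) x" for x
      unfolding smooth_def using f g
      by (intro harris) (auto intro: prob_space_normal_density s simp: measurable_cong_sets[OF sets_normal_prod refl])
    show "integrable (gauss n) (\<lambda>x. smooth n r s f x * smooth n r s g x)"
      using smooth_01[OF s f(1,2), of r] smooth_01[OF s g(1,2), of r]
      by (intro G.integrable_01 borel_measurable_times ms f g) (auto intro: mult_le_one)
    show "integrable (gauss n) (smooth n r s (\<lambda>x. f x * g x))"
      using smooth_01[OF s fg, of r] by (intro G.integrable_01 ms fg) auto
  qed
  also have "\<dots> = (\<integral>x. f x * g x \<partial>gauss n)" by (rule smooth_moments(1)[OF s rs fg])
  finally show ?thesis .
qed

section \<open>Increasing functions without measurability assumptions\<close>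

lemma incr_on_mono:
  assumes f: "incr_on I f" and I: "finite I" and xy: "x \<in> I \<rightarrow>\<^sub>E UNIV" "y \<in> I \<rightarrow>\<^sub>E UNIV" "\<And>i. i \<in> I \<Longrightarrow> x i \<le> y i"
  shows "f x \<le> f y"
proof -
  define z where "z J i = (if i \<in> J then y i else x i)" for J i
  have "f x \<le> f (z J)" if "J \<subseteq> I" for J
    using finite_subset[OF that I] that
  proof (induction J rule: finite_induct)
    case empty
    have "z {} = x" by (simp add: z_def fun_eq_iff)
    then show ?case by simp
  next
    case (insert j J)
    have "z J \<in> I \<rightarrow>\<^sub>E UNIV" using xy by (auto simp: z_def PiE_iff extensional_def)
    moreover have "z (insert j J) = (z J)(j := y j)" by (auto simp: z_def fun_eq_iff)
    moreover have "z J j \<le> y j" using insert xy by (auto simp: z_def)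
    ultimately have "f (z J) \<le> f (z (insert j J))" using incr_onD[OF f] insert.prems by auto
    then show ?case using insert by auto
  qed
  from this[of I] have "f x \<le> f (z I)" by simp
  moreover have "z I = y" using xy by (auto simp: z_def fun_eq_iff PiE_iff extensional_def)
  ultimately show ?thesis by simp
qed

definition rat_points :: "nat \<Rightarrow> (nat \<Rightarrow> real) set" where
  "rat_points n = {..<n} \<rightarrow>\<^sub>E \<rat>"

text \<open>Using only rational points strictly above \<open>x\<close> makes every strict sublevel
  set a countable union of open boxes, hence Borel, whatever the increasing \<open>f\<close>
  is.\<close>

definition upper_env :: "nat \<Rightarrow> ((nat \<Rightarrow> real) \<Rightarrow> real) \<Rightarrow> (nat \<Rightarrow> real) \<Rightarrow> real" where
  "upper_env n f x = Inf (f ` {q \<in> rat_points n. \<forall>i<n. x i < q i})"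

definition lower_env :: "nat \<Rightarrow> ((nat \<Rightarrow> real) \<Rightarrow> real) \<Rightarrow> (nat \<Rightarrow> real) \<Rightarrow> real" where
  "lower_env n f x = Sup (f ` {q \<in> rat_points n. \<forall>i<n. q i < x i})"

lemma countable_rat_points: "countable (rat_points n)"
  unfolding rat_points_def by (intro countable_PiE countable_rat) auto

lemma rat_point_between:
  assumes "\<And>i. i < n \<Longrightarrow> x i < y i"
  shows "\<exists>q\<in>rat_points n. \<forall>i<n. x i < q i \<and> q i < (y i :: real)"
proof -
  have "\<exists>q. q \<in> \<rat> \<and> x i < q \<and> q < y i" if "i < n" for i
    using Rats_dense_in_real[OF assms[OF that]] by blast
  then obtain q where q: "\<And>i. i < n \<Longrightarrow> q i \<in> \<rat> \<and> x i < q i \<and> q i < y i" by metis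
  then show ?thesis
    by (intro bexI[of _ "restrict q {..<n}"]) (auto simp: rat_points_def)
qed

context
  fixes n :: nat and f :: "(nat \<Rightarrow> real) \<Rightarrow> real"
  assumes inc: "incr_on {..<n} f"
    and f01: "\<And>x. x \<in> {..<n} \<rightarrow>\<^sub>E UNIV \<Longrightarrow> 0 \<le> f x \<and> f x \<le> 1"
begin

lemma rat_points_PiE: "q \<in> rat_points n \<Longrightarrow> q \<in> {..<n} \<rightarrow>\<^sub>E UNIV"
  by (auto simp: rat_points_def PiE_iff)

lemma f_rat01: "q \<in> rat_points n \<Longrightarrow> 0 \<le> f q \<and> f q \<le> 1"
  using f01[OF rat_points_PiE] by blast

lemma bdd_rat: "Q \<subseteq> rat_points n \<Longrightarrow> bdd_below (f ` Q)" "Q \<subseteq> rat_points n \<Longrightarrow> bdd_above (f ` Q)"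
  using f_rat01 by (auto intro!: bdd_belowI[of _ 0] bdd_aboveI[of _ 1])

lemma rat_above: "{q \<in> rat_points n. \<forall>i<n. x i < q i} \<noteq> {}"
  using rat_point_between[of n x "\<lambda>i. x i + 1"] by auto

lemma rat_below: "{q \<in> rat_points n. \<forall>i<n. q i < x i} \<noteq> {}"
  using rat_point_between[of n "\<lambda>i. x i - 1" x] by auto

lemma upper_env_le: "q \<in> rat_points n \<Longrightarrow> (\<And>i. i < n \<Longrightarrow> x i < q i) \<Longrightarrow> upper_env n f x \<le> f q"
  unfolding upper_env_def by (intro cINF_lower bdd_rat) auto

lemma lower_env_ge: "q \<in> rat_points n \<Longrightarrow> (\<And>i. i < n \<Longrightarrow> q i < x i) \<Longrightarrow> f q \<le> lower_env n f x"
  unfolding lower_env_def by (intro cSUP_upper bdd_rat) auto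

lemma env_bounds:
  assumes x: "x \<in> {..<n} \<rightarrow>\<^sub>E UNIV"
  shows "lower_env n f x \<le> f x" "f x \<le> upper_env n f x"
proof -
  have mono: "f y \<le> f z" if "y \<in> {..<n} \<rightarrow>\<^sub>E UNIV" "z \<in> {..<n} \<rightarrow>\<^sub>E UNIV" "\<forall>i<n. y i < z i" for y z
    by (rule incr_on_mono[OF inc finite_lessThan that(1,2)]) (use that(3) in \<open>simp add: less_imp_le\<close>)
  show "lower_env n f x \<le> f x"
    unfolding lower_env_def
  proof (rule cSUP_least[OF rat_below[of x]])
    fix q assume q: "q \<in> {q \<in> rat_points n. \<forall>i<n. q i < x i}"
    then show "f q \<le> f x" using mono[OF rat_points_PiE x, of q] by simp
  qed
  show "f x \<le> upper_env n f x"
    unfolding upper_env_def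
  proof (rule cINF_greatest[OF rat_above[of x]])
    fix q assume q: "q \<in> {q \<in> rat_points n. \<forall>i<n. x i < q i}"
    then show "f x \<le> f q" using mono[OF x rat_points_PiE, of q] by simp
  qed
qed

lemma upper_env_01: "0 \<le> upper_env n f x \<and> upper_env n f x \<le> 1"
proof
  show "0 \<le> upper_env n f x"
    unfolding upper_env_def using rat_above f_rat01 by (intro cINF_greatest) auto
  obtain q where "q \<in> rat_points n" "\<forall>i<n. x i < q i" using rat_above[of x] by auto
  then show "upper_env n f x \<le> 1" using upper_env_le[of q x] f_rat01[of q] by auto
qed

lemma lower_env_01: "0 \<le> lower_env n f x \<and> lower_env n f x \<le> 1"
proof
  show "lower_env n f x \<le> 1"
    unfolding lower_env_def using rat_below f_rat01 by (intro cSUP_least) auto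
  obtain q where "q \<in> rat_points n" "\<forall>i<n. q i < x i" using rat_below[of x] by auto
  then show "0 \<le> lower_env n f x" using lower_env_ge[of q x] f_rat01[of q] by fastforce
qed

lemma upper_env_incr: "incr_on {..<n} (upper_env n f)"
  unfolding incr_on_def
proof (intro ballI allI impI)
  fix x :: "nat \<Rightarrow> real" and i t assume "i \<in> {..<n}" and t: "x i \<le> t"
  show "upper_env n f x \<le> upper_env n f (x(i := t))"
    unfolding upper_env_def
  proof (rule cINF_superset_mono[OF rat_above bdd_rat(1)])
    have "x j \<le> (x(i := t)) j" for j using t by simp
    then show "{q \<in> rat_points n. \<forall>j<n. (x(i := t)) j < q j} \<subseteq> {q \<in> rat_points n. \<forall>j<n. x j < q j}"
      using order_le_less_trans by blast
  qed auto
qed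

lemma upper_env_less_iff: "upper_env n f x < a \<longleftrightarrow> (\<exists>q\<in>rat_points n. (\<forall>i<n. x i < q i) \<and> f q < a)"
proof -
  have "f ` {q \<in> rat_points n. \<forall>i<n. x i < q i} \<noteq> {}" using rat_above[of x] by blast
  moreover have "bdd_below (f ` {q \<in> rat_points n. \<forall>i<n. x i < q i})" by (rule bdd_rat) blast
  ultimately show ?thesis unfolding upper_env_def by (subst cInf_less_iff) blast+
qed

lemma less_lower_env_iff: "a < lower_env n f x \<longleftrightarrow> (\<exists>q\<in>rat_points n. (\<forall>i<n. q i < x i) \<and> a < f q)"
proof -
  have "f ` {q \<in> rat_points n. \<forall>i<n. q i < x i} \<noteq> {}" using rat_below[of x] by blast
  moreover have "bdd_above (f ` {q \<in> rat_points n. \<forall>i<n. q i < x i})" by (rule bdd_rat) blast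
  ultimately show ?thesis unfolding lower_env_def by (subst less_cSup_iff) blast+
qed

lemma measurable_upper_env: "upper_env n f \<in> borel_measurable (\<Pi>\<^sub>M i\<in>{..<n}. borel)"
  unfolding borel_measurable_iff_less
proof
  fix a
  have "{x \<in> space (\<Pi>\<^sub>M i\<in>{..<n}. borel). upper_env n f x < a}
      = (\<Union>q\<in>{q \<in> rat_points n. f q < a}. Pi\<^sub>E {..<n} (\<lambda>i. {..<q i}))"
    unfolding upper_env_less_iff by (fastforce simp: space_PiM PiE_iff)
  also have "\<dots> \<in> sets (\<Pi>\<^sub>M i\<in>{..<n}. borel)"
    by (intro sets.countable_UN' countable_subset[OF _ countable_rat_points]) (auto intro!: sets_PiM_I_finite)
  finally show "{x \<in> space (\<Pi>\<^sub>M i\<in>{..<n}. borel). upper_env n f x < a} \<in> sets (\<Pi>\<^sub>M i\<in>{..<n}. borel)" .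
qed

lemma measurable_lower_env: "lower_env n f \<in> borel_measurable (\<Pi>\<^sub>M i\<in>{..<n}. borel)"
  unfolding borel_measurable_iff_greater
proof
  fix a
  have "{x \<in> space (\<Pi>\<^sub>M i\<in>{..<n}. borel). a < lower_env n f x}
      = (\<Union>q\<in>{q \<in> rat_points n. a < f q}. Pi\<^sub>E {..<n} (\<lambda>i. {q i<..}))"
    unfolding less_lower_env_iff by (fastforce simp: space_PiM PiE_iff)
  also have "\<dots> \<in> sets (\<Pi>\<^sub>M i\<in>{..<n}. borel)"
    by (intro sets.countable_UN' countable_subset[OF _ countable_rat_points]) (auto intro!: sets_PiM_I_finite)
  finally show "{x \<in> space (\<Pi>\<^sub>M i\<in>{..<n}. borel). a < lower_env n f x} \<in> sets (\<Pi>\<^sub>M i\<in>{..<n}. borel)" .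
qed

text \<open>
  A small shift pushes the upper envelope below the lower one, and Gaussian averages depend
  continuously on the shift; hence the two envelopes have the same integral.
\<close>

lemma AE_eq_upper_env: "AE x in gauss n. f x = upper_env n f x"
proof -
  interpret G: prob_space "gauss n" by (rule prob_space_gauss)
  have meas: "upper_env n f \<in> borel_measurable (gauss n)" "lower_env n f \<in> borel_measurable (gauss n)"
    using measurable_upper_env measurable_lower_env by (simp_all add: measurable_cong_sets[OF sets_gauss refl])
  have int: "integrable (gauss n) (upper_env n f)" "integrable (gauss n) (lower_env n f)"
    using meas upper_env_01 lower_env_01 by (auto intro!: G.integrable_01)
  have sm: "upper_env n f (\<lambda>i\<in>{..<n}. - h + 1 * a i) \<le> lower_env n f a" if "0 < h" for h a
  proof -
    have "\<exists>q\<in>rat_points n. \<forall>i<n. - h + 1 * a i < q i \<and> q i < a i"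
      by (rule rat_point_between) (use that in simp)
    then obtain q where q: "q \<in> rat_points n" "\<forall>i<n. - h + 1 * a i < q i \<and> q i < a i" by blast
    then have "upper_env n f (\<lambda>i\<in>{..<n}. - h + 1 * a i) \<le> f q" by (intro upper_env_le) auto
    also have "\<dots> \<le> lower_env n f a" using q by (intro lower_env_ge) auto
    finally show ?thesis .
  qed
  define U where "U w = integral\<^sup>L (normal_prod n 1 w) (upper_env n f)" for w
  have U_eq: "U w = (\<integral>a. upper_env n f (\<lambda>i\<in>{..<n}. w i + 1 * a i) \<partial>gauss n)" for w
    unfolding U_def by (rule integral_normal_prod[OF _ measurable_upper_env]) simp
  have lip: "lipschitz_incr n (2 / 1) U"
    unfolding U_def[abs_def]
    by (rule lipschitz_incr_normal_average[OF _ measurable_upper_env _ upper_env_incr]) (auto simp: upper_env_01)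
  define z where "z h = (\<lambda>i\<in>{..<n}. - h :: real)" for h
  have U0: "U (z 0) = integral\<^sup>L (gauss n) (upper_env n f)"
    unfolding U_eq
  proof (intro Bochner_Integration.integral_cong refl arg_cong[of _ _ "upper_env n f"])
    fix a assume "a \<in> space (gauss n)"
    then show "(\<lambda>i\<in>{..<n}. z 0 i + 1 * a i) = a"
      by (auto simp: z_def space_gauss PiE_iff extensional_def fun_eq_iff)
  qed
  have U1: "U (z h) \<le> integral\<^sup>L (gauss n) (lower_env n f)" if "0 < h" for h
    unfolding U_eq
  proof (rule integral_mono)
    have eq: "(\<lambda>i\<in>{..<n}. z h i + 1 * a i) = (\<lambda>i\<in>{..<n}. - h + 1 * a i)" for a
      by (auto simp: z_def)
    show "upper_env n f (\<lambda>i\<in>{..<n}. z h i + 1 * a i) \<le> lower_env n f a" for a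
      unfolding eq by (rule sm[OF that])
    show "integrable (gauss n) (\<lambda>a. upper_env n f (\<lambda>i\<in>{..<n}. z h i + 1 * a i))"
      by (rule G.integrable_01[OF measurable_compose[OF measurable_affine_gauss measurable_upper_env]])
        (rule upper_env_01)
  qed (rule int)
  have "integral\<^sup>L (gauss n) (upper_env n f) \<le> integral\<^sup>L (gauss n) (lower_env n f)"
  proof (rule field_le_epsilon)
    fix e :: real assume e: "0 < e"
    \<comment> \<open>Moving \<open>n\<close> coordinates by \<open>h\<close> changes
      \<open>U\<close> by at most \<open>2 * n * h\<close>; the added 1 keeps the denominator
      positive for \<open>n = 0\<close>.\<close>
    define h where "h = e / (2 * real n + 1)"
    have h: "0 < h" using e by (simp add: h_def)
    have "\<bar>U (z 0) - U (z h)\<bar> \<le> 2 / 1 * (\<Sum>i<n. \<bar>z 0 i - z h i\<bar>)"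
      by (rule lipschitz_incr_abs_le[OF lip]) (auto simp: z_def)
    also have "\<dots> = 2 * real n * h" using h by (simp add: z_def)
    also have "\<dots> \<le> (2 * real n + 1) * h" using h by (simp add: algebra_simps)
    also have "\<dots> = e" by (simp add: h_def add_nonneg_eq_0_iff)
    finally show "integral\<^sup>L (gauss n) (upper_env n f) \<le> integral\<^sup>L (gauss n) (lower_env n f) + e"
      using U1[OF h] unfolding U0 by linarith
  qed
  moreover have le: "lower_env n f x \<le> upper_env n f x" if "x \<in> space (gauss n)" for x
    using env_bounds[of x] that by (auto simp: space_gauss)
  then have "integral\<^sup>L (gauss n) (lower_env n f) \<le> integral\<^sup>L (gauss n) (upper_env n f)"
    by (intro integral_mono int) auto
  ultimately have "(\<integral>x. upper_env n f x - lower_env n f x \<partial>gauss n) = 0"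
    using int by simp
  then have "AE x in gauss n. upper_env n f x - lower_env n f x = 0"
    using int le by (subst (asm) integral_nonneg_eq_0_iff_AE) auto
  with AE_space show ?thesis
  proof eventually_elim
    case (elim x)
    then show ?case using env_bounds[of x] by (simp add: space_gauss)
  qed
qed

end

text \<open>Preimages under \<open>f\<close> and \<open>F\<close> differ by a subset of a null set,
  and the completion contains all of these.\<close>

lemma borel_measurable_completion_AE:
  fixes f F :: "'a \<Rightarrow> real"
  assumes F: "F \<in> borel_measurable M" and AE: "AE x in M. f x = F x"
  shows "f \<in> borel_measurable (completion M)"
proof (rule measurableI)
  fix S :: "real set" assume S: "S \<in> sets borel"
  show "f -` S \<inter> space (completion M) \<in> sets (completion M)"
  proof (rule completion.in_sets_AE)
    show "F -` S \<inter> space (completion M) \<in> sets (completion M)"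
      using measurable_sets[OF F S] by (auto intro: sets_completionI_sets)
    show "AE x in completion M. (x \<in> F -` S \<inter> space (completion M)) = (x \<in> f -` S \<inter> space (completion M))"
      using AE_completion[OF AE] by eventually_elim auto
  qed auto
qed auto

lemma integral_completion_AE:
  fixes f F h :: "'a \<Rightarrow> real"
  assumes F: "F \<in> borel_measurable M" and AE: "AE x in M. f x = F x" and h: "h \<in> borel_measurable M"
  shows "(\<integral>x. h x * f x \<partial>completion M) = (\<integral>x. h x * F x \<partial>M)"
proof -
  have "(\<integral>x. h x * f x \<partial>completion M) = (\<integral>x. h x * F x \<partial>completion M)"
  proof (rule integral_cong_AE)
    show "(\<lambda>x. h x * f x) \<in> borel_measurable (completion M)"
      by (intro borel_measurable_times measurable_completion h borel_measurable_completion_AE[OF F AE])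
    show "(\<lambda>x. h x * F x) \<in> borel_measurable (completion M)"
      by (intro measurable_completion borel_measurable_times h F)
    show "AE x in completion M. h x * f x = h x * F x"
      using AE_completion[OF AE] by eventually_elim simp
  qed
  also have "\<dots> = (\<integral>x. h x * F x \<partial>M)"
    by (intro integral_completion borel_measurable_times h F)
  finally show ?thesis .
qed

section \<open>Bounds for degree-1 coefficients and the choice of the noise level\<close>

lemma gauss_coeff1_nonneg:
  assumes u: "u \<in> borel_measurable (gauss n)" "lipschitz_incr n L u"
    "\<And>x. x \<in> {..<n} \<rightarrow>\<^sub>E UNIV \<Longrightarrow> 0 \<le> u x \<and> u x \<le> 1" and i: "i < n"
  shows "0 \<le> gauss_coeff1 n u i"
proof (rule LIMSEQ_le_const)
  show "(\<lambda>N. grid_avg n N (\<lambda>x. x i * u x)) \<longlonglongrightarrow> gauss_coeff1 n u i"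
    using i by (intro grid_limits(2)[OF _ u]) auto
  show "\<exists>N. \<forall>m\<ge>N. 0 \<le> grid_avg n m (\<lambda>x. x i * u x)"
    using grid_avg_coord_nonneg[OF u(2) i] by blast
qed

text \<open>\<open>\<bar>x\<bar> \<le> (1 + x^2) / 2\<close>, and the right-hand side has Gaussian
  mean 1. The crude bound suffices: it gives \<open>p \<le> 1\<close>, so that
  \<open>ln (exp 1 / p)\<close> is at least 1.\<close>

lemma gauss_coeff1_le_1:
  assumes u: "u \<in> borel_measurable (gauss n)"
    "\<And>x. x \<in> {..<n} \<rightarrow>\<^sub>E UNIV \<Longrightarrow> 0 \<le> u x \<and> u x \<le> 1" and i: "i < n"
  shows "gauss_coeff1 n u i \<le> 1"
proof -
  interpret G: prob_space "gauss n" by (rule prob_space_gauss)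
  have b: "\<bar>x i * u x\<bar> \<le> 1/2 + (x i)\<^sup>2 / 2" if "x \<in> {..<n} \<rightarrow>\<^sub>E UNIV" for x
  proof -
    have "\<bar>x i * u x\<bar> \<le> \<bar>x i\<bar> * 1"
      unfolding abs_mult using u(2)[OF that] by (intro mult_left_mono) auto
    moreover have "0 \<le> (\<bar>x i\<bar> - 1)\<^sup>2" by simp
    then have "2 * \<bar>x i\<bar> \<le> (x i)\<^sup>2 + 1" by (simp add: power2_diff)
    ultimately show ?thesis by linarith
  qed
  have i': "i \<in> {..<n}" and pw: "(\<lambda>x. x\<^sup>2) \<in> borel_measurable std_normal_distribution"
    using i by simp_all
  note comp = integral_PiM_component[of "{..<n}" "\<lambda>_. std_normal_distribution", OF prob_space_std_normal finite_lessThan i' pw]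
  have sq: "integrable (gauss n) (\<lambda>x. (x i)\<^sup>2)" "(\<integral>x. (x i)\<^sup>2 \<partial>gauss n) = 1"
    by (rule comp(2)[OF integrable_std_normal_powers(2)]) (simp only: comp(1) integral_std_normal_powers(2))
  have int: "integrable (gauss n) (\<lambda>x. x i * u x)"
  proof (rule integrable_gauss_quadratic[OF _ i i])
    show "(\<lambda>x. x i * u x) \<in> borel_measurable (gauss n)"
      by (intro borel_measurable_times measurable_gauss_component u i)
    show "\<bar>x i * u x\<bar> \<le> 1 + (x i)\<^sup>2 + (x i)\<^sup>2" if "x \<in> {..<n} \<rightarrow>\<^sub>E UNIV" for x
      using b[OF that] zero_le_power2[of "x i"] by linarith
  qed
  have "gauss_coeff1 n u i \<le> (\<integral>x. 1/2 + (x i)\<^sup>2 / 2 \<partial>gauss n)"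
    unfolding gauss_coeff1_def using b sq int by (intro integral_mono) (auto simp: space_gauss abs_le_iff)
  also have "\<dots> = 1" using sq by (simp add: G.prob_space)
  finally show ?thesis .
qed

text \<open>
  The noise level \<open>\<rho>\<close> is chosen so that both error terms in the exponent of \<^const>\<open>cor_gain\<close> are at
  most 1; the factors 3/5, 81/625 and 3/2 come from smoothing with correlation 3/5.
\<close>

lemma noise_level_choice:
  fixes A B q :: real
  assumes A: "0 < A" "A \<le> 1" and B: "0 < B" "B \<le> 1"
  defines "p \<equiv> A * B"
  defines "m \<equiv> if q = 0 then 1 / sqrt (ln (exp 1 / p)) else min (1 / sqrt (ln (exp 1 / p))) (p / \<bar>q\<bar>)"
  defines "a \<equiv> 3/5 * A" and "b \<equiv> 3/5 * B" and "Q \<equiv> 81/625 * q" and "\<rho> \<equiv> m / 4"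
  shows "0 \<le> \<rho> \<and> \<rho> \<le> 1/4"
    and "9/100 * exp (-2) * (if q = 0 then p / sqrt (ln (exp 1 / p)) else min (p / sqrt (ln (exp 1 / p))) (p\<^sup>2 / \<bar>q\<bar>))
      \<le> \<rho> * cor_gain \<rho> (3/2) a b Q"
proof -
  have p: "0 < p" "p \<le> 1" using A B by (auto simp: p_def mult_le_one)
  define l where "l = ln (exp 1 / p)"
  have l_eq: "l = 1 - ln p" using p by (simp add: l_def ln_div)
  have lp: "ln p \<le> 0" using p by simp
  have l: "1 \<le> l" using lp by (simp add: l_eq)
  have sl: "1 \<le> sqrt l" using l by simp
  have m0: "0 \<le> m" using p sl by (simp add: m_def l_def[symmetric])
  have m1: "m \<le> 1 / sqrt l" by (simp add: m_def l_def[symmetric])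
  have mq: "m * \<bar>q\<bar> \<le> p"
  proof (cases "q = 0")
    case False
    then have "m \<le> p / \<bar>q\<bar>" by (simp add: m_def)
    then show ?thesis using False by (simp add: pos_le_divide_eq)
  qed (use p in simp)
  have "1 / sqrt l \<le> 1" using sl by simp
  with m1 have "m \<le> 1" by linarith
  then show "0 \<le> \<rho> \<and> \<rho> \<le> 1/4" using m0 by (simp add: \<rho>_def)
  have ab: "a * b = 9/25 * p" by (simp add: a_def b_def p_def)
  have e1: "\<rho> * (\<bar>Q\<bar> / (a * b)) \<le> 1"
  proof -
    \<comment> \<open>Smoothing turns \<open>q / p\<close> into
      \<open>(81/625) / (9/25) = 9/25\<close> times itself, and the choice \<open>m / 4\<close>
      gives 9/100.\<close>
    have "\<rho> * (\<bar>Q\<bar> / (a * b)) = 9/100 * (m * \<bar>q\<bar> / p)"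
      unfolding ab \<rho>_def Q_def by (simp add: abs_mult)
    also have "\<dots> \<le> 9/100 * 1" using mq p by (intro mult_left_mono) auto
    also have "\<dots> \<le> 1" by simp
    finally show ?thesis .
  qed
  have e2: "5 * \<rho>\<^sup>2 * (ln ((3/2) / a) + ln ((3/2) / b)) \<le> 1"
  proof -
    have "ln ((3/2) / a) + ln ((3/2) / b) = ln ((3/2) / a * ((3/2) / b))"
      using A B by (subst ln_mult) (auto simp: a_def b_def)
    also have "(3/2) / a * ((3/2) / b) = (5/2)\<^sup>2 / p"
      using A B by (simp add: a_def b_def p_def power2_eq_square)
    also have "ln ((5/2)\<^sup>2 / p) = 2 * ln (5/2) - ln p"
      using p by (simp add: ln_div ln_realpow)
    \<comment> \<open>With \<open>2 * ln (5/2) \<le> 3\<close> the two logarithms add up to at most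
      \<open>3 - ln p \<le> 3 * l\<close>. The error is then at most
      \<open>15/16 * (m^2 * l)\<close>, so the divisor 4 in \<rho> is large enough.\<close>
    also have "ln (5/2 :: real) \<le> 3/2" using ln_le_minus_one[of "5/2"] by simp
    finally have s: "ln ((3/2) / a) + ln ((3/2) / b) \<le> 3 * l" using lp by (simp add: l_eq)
    have "m\<^sup>2 \<le> (1 / sqrt l)\<^sup>2" using m0 m1 by (intro power_mono) auto
    then have "m\<^sup>2 * l \<le> 1" using l by (simp add: power_divide pos_le_divide_eq)
    then have "5 / 16 * (m\<^sup>2 * (3 * l)) \<le> 1" by simp
    moreover have "5 * \<rho>\<^sup>2 * (ln ((3/2) / a) + ln ((3/2) / b)) \<le> 5 * \<rho>\<^sup>2 * (3 * l)"
      using s by (intro mult_left_mono) auto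
    moreover have "5 * \<rho>\<^sup>2 * (3 * l) = 5 / 16 * (m\<^sup>2 * (3 * l))"
      by (simp add: \<rho>_def power2_eq_square)
    ultimately show ?thesis by linarith
  qed
  have "9/100 * exp (-2) * (if q = 0 then p / sqrt (ln (exp 1 / p)) else min (p / sqrt (ln (exp 1 / p))) (p\<^sup>2 / \<bar>q\<bar>))
      = 9/100 * exp (-2) * (p * m)"
    unfolding m_def using p by (simp add: min_mult_distrib_left power2_eq_square)
  also have "\<dots> = \<rho> * (a * b * exp (-2))" unfolding ab \<rho>_def by simp
  also have "\<dots> \<le> \<rho> * (a * b * exp (- (\<rho> * (\<bar>Q\<bar> / (a * b))) - 5 * \<rho>\<^sup>2 * (ln ((3/2) / a) + ln ((3/2) / b))))"
  proof (intro mult_left_mono)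
    show "exp (- 2) \<le> exp (- (\<rho> * (\<bar>Q\<bar> / (a * b))) - 5 * \<rho>\<^sup>2 * (ln ((3/2) / a) + ln ((3/2) / b)))"
      unfolding exp_le_cancel_iff using e1 e2 by linarith
    show "0 \<le> a * b" unfolding ab using p by simp
    show "0 \<le> \<rho>" using m0 by (simp add: \<rho>_def)
  qed
  also have "\<dots> = \<rho> * cor_gain \<rho> (3/2) a b Q"
    using A B by (simp add: cor_gain_def a_def b_def)
  finally show "9/100 * exp (-2) * (if q = 0 then p / sqrt (ln (exp 1 / p)) else min (p / sqrt (ln (exp 1 / p))) (p\<^sup>2 / \<bar>q\<bar>))
      \<le> \<rho> * cor_gain \<rho> (3/2) a b Q" .
qed

lemma gauss_cor_ge_cor_bound_terms:
  fixes F G :: "(nat \<Rightarrow> real) \<Rightarrow> real"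
  assumes n: "0 < n"
    and F: "F \<in> borel_measurable (\<Pi>\<^sub>M i\<in>{..<n}. borel)" "\<And>x. x \<in> {..<n} \<rightarrow>\<^sub>E UNIV \<Longrightarrow> 0 \<le> F x \<and> F x \<le> 1" "incr_on {..<n} F"
    and G: "G \<in> borel_measurable (\<Pi>\<^sub>M i\<in>{..<n}. borel)" "\<And>x. x \<in> {..<n} \<rightarrow>\<^sub>E UNIV \<Longrightarrow> 0 \<le> G x \<and> G x \<le> 1" "incr_on {..<n} G"
  defines "A \<equiv> gauss_coeff1 n F" and "B \<equiv> gauss_coeff1 n G"
    and "q \<equiv> \<lambda>i. \<Sum>k<n. gauss_coeff2 n F i k * gauss_coeff2 n G i k"
  shows "9/100 * exp (-2) * (\<Sum>i<n. cor_bound_term (A i * B i) (q i))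
    \<le> (\<integral>x. F x * G x \<partial>gauss n) - (\<integral>x. F x \<partial>gauss n) * (\<integral>x. G x \<partial>gauss n)"
proof -
  define u where "u = smooth n (3/5) (4/5) F"
  define v where "v = smooth n (3/5) (4/5) G"
  have s: "(0::real) < 4/5" and r: "(0::real) < 3/5" and rs: "(3/5)\<^sup>2 + (4/5)\<^sup>2 = (1::real)"
    by (simp_all add: power2_eq_square)
  have to_gauss: "h \<in> borel_measurable (gauss n) \<longleftrightarrow> h \<in> borel_measurable (\<Pi>\<^sub>M i\<in>{..<n}. borel)"
    for h :: "(nat \<Rightarrow> real) \<Rightarrow> real"
    by (simp only: measurable_cong_sets[OF sets_gauss refl])
  have um: "u \<in> borel_measurable (gauss n)" and vm: "v \<in> borel_measurable (gauss n)"
    unfolding u_def v_def using F(1) G(1) by (simp_all only: measurable_smooth[OF s] to_gauss[symmetric])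
  have ulip: "lipschitz_incr n (3/2) u" and vlip: "lipschitz_incr n (3/2) v"
    using lipschitz_incr_smooth[OF r s F] lipschitz_incr_smooth[OF r s G] by (simp_all add: u_def v_def)
  have u01: "0 \<le> u x \<and> u x \<le> 1" and v01: "0 \<le> v x \<and> v x \<le> 1" for x
    unfolding u_def v_def by (rule smooth_01[OF s F(1,2)] smooth_01[OF s G(1,2)]; assumption)+
  have a: "gauss_coeff1 n u i = 3/5 * A i" and b: "gauss_coeff1 n v i = 3/5 * B i" if "i < n" for i
    unfolding u_def v_def A_def B_def
    by (rule smooth_moments(2)[OF s rs F(1,2) that] smooth_moments(2)[OF s rs G(1,2) that]; assumption)+
  have Q: "(\<Sum>k<n. gauss_coeff2 n u i k * gauss_coeff2 n v i k) = 81/625 * q i" if "i < n" for i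
    unfolding q_def sum_distrib_left
  proof (intro sum.cong refl)
    fix k assume "k \<in> {..<n}"
    then have k: "k < n" by simp
    have "gauss_coeff2 n u i k = (3/5)\<^sup>2 * gauss_coeff2 n F i k"
      unfolding u_def by (rule smooth_moments(3)[OF s rs F(1,2) that k])
    moreover have "gauss_coeff2 n v i k = (3/5)\<^sup>2 * gauss_coeff2 n G i k"
      unfolding v_def by (rule smooth_moments(3)[OF s rs G(1,2) that k])
    ultimately show "gauss_coeff2 n u i k * gauss_coeff2 n v i k
      = 81/625 * (gauss_coeff2 n F i k * gauss_coeff2 n G i k)"
      by (simp only:) (simp add: power2_eq_square)
  qed
  \<comment> \<open>\<open>F\<close> itself need not be Lipschitz, so the sign is read off from the
    smoothed functions, whose degree-1 coefficients are 3/5 of the original ones.\<close>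
  have A0: "0 \<le> A i" and B0: "0 \<le> B i" if "i < n" for i
    using gauss_coeff1_nonneg[OF um ulip u01 that] gauss_coeff1_nonneg[OF vm vlip v01 that]
    unfolding a[OF that] b[OF that] by simp_all
  have A1: "A i \<le> 1" and B1: "B i \<le> 1" if "i < n" for i
    unfolding A_def B_def using F(1) G(1)
    by (auto intro!: gauss_coeff1_le_1 F(2) G(2) that simp only: to_gauss)
  define m where "m i = (if q i = 0 then 1 / sqrt (ln (exp 1 / (A i * B i)))
      else min (1 / sqrt (ln (exp 1 / (A i * B i)))) (A i * B i / \<bar>q i\<bar>))" for i
  \<comment> \<open>If a coefficient vanishes, level 0 makes the contribution 0, in agreement with
    the convention of \<open>cor_bound_term\<close>.\<close>
  define \<rho> where "\<rho> i = (if 0 < A i \<and> 0 < B i then m i / 4 else 0)" for i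
  have \<rho>: "0 \<le> \<rho> i \<and> \<rho> i \<le> 1/4" if "i < n" for i
    using noise_level_choice(1)[of "A i" "B i" "q i"] A1[OF that] B1[OF that] by (simp add: \<rho>_def m_def)
  have "9/100 * exp (-2) * (\<Sum>i<n. cor_bound_term (A i * B i) (q i))
    \<le> (\<Sum>i<n. \<rho> i * cor_gain (\<rho> i) (3/2) (3/5 * A i) (3/5 * B i) (81/625 * q i))"
    unfolding sum_distrib_left
  proof (rule sum_mono)
    fix i assume "i \<in> {..<n}"
    then have i: "i < n" by simp
    show "9/100 * exp (-2) * cor_bound_term (A i * B i) (q i)
      \<le> \<rho> i * cor_gain (\<rho> i) (3/2) (3/5 * A i) (3/5 * B i) (81/625 * q i)"
    proof (cases "0 < A i \<and> 0 < B i")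
      case True
      then have \<rho>m: "\<rho> i = m i / 4" and pos: "A i * B i \<noteq> 0"
        by (auto simp: \<rho>_def)
      show ?thesis
        unfolding cor_bound_term_def if_not_P[OF pos] \<rho>m m_def
        by (rule noise_level_choice(2)) (use True A1[OF i] B1[OF i] in auto)
    next
      case False
      then have "A i * B i = 0" using A0[OF i] B0[OF i] by auto
      then show ?thesis using False by (auto simp: cor_bound_term_def \<rho>_def)
    qed
  qed
  also have "\<dots> = (\<Sum>i<n. \<rho> i * cor_gain (\<rho> i) (3/2) (gauss_coeff1 n u i) (gauss_coeff1 n v i)
      (\<Sum>k<n. gauss_coeff2 n u i k * gauss_coeff2 n v i k))"
    by (intro sum.cong refl) (simp only: a b Q lessThan_iff)
  also have "\<dots> \<le> (\<integral>x. u x * v x \<partial>gauss n) - (\<integral>x. u x \<partial>gauss n) * (\<integral>x. v x \<partial>gauss n)"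
    by (rule gauss_cor_ge[OF n um ulip u01 vm vlip v01 \<rho>]) simp_all
  also have "\<dots> \<le> (\<integral>x. F x * G x \<partial>gauss n) - (\<integral>x. F x \<partial>gauss n) * (\<integral>x. G x \<partial>gauss n)"
    using smooth_mult_le[OF s rs F G] smooth_moments(1)[OF s rs F(1,2)] smooth_moments(1)[OF s rs G(1,2)]
    by (simp add: u_def v_def)
  finally show ?thesis .
qed

lemma increasing_fun_iff: "increasing_fun n f \<longleftrightarrow> incr_on {..<n} f"
  unfolding increasing_fun_def incr_on_def Ball_def lessThan_iff by blast

text \<open>The unit vector selects column \<open>i\<close>. Its entry \<open>k\<close> is rewritten
  with the indices in the order used by \<open>gauss_coeff2\<close>, which is allowed because the
  integrand is symmetric in them.\<close>

lemma hermite2_column_prod: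
  assumes "i < n"
  shows "scalar_prod (hermite2 n f *\<^sub>v unit_vec n i) (hermite2 n g *\<^sub>v unit_vec n i)
    = (\<Sum>k<n. (\<integral>x. (x i * x k - (if i = k then 1 else 0)) * f x \<partial>std_gaussian n)
      * (\<integral>x. (x i * x k - (if i = k then 1 else 0)) * g x \<partial>std_gaussian n))"
proof -
  have col: "(hermite2 n h *\<^sub>v unit_vec n i) $ k
      = (\<integral>x. (x i * x k - (if i = k then 1 else 0)) * h x \<partial>std_gaussian n)" if "k < n" for h k
    using assms that by (simp add: hermite2_def mult.commute eq_commute[of i k])
  have "dim_vec (hermite2 n g *\<^sub>v unit_vec n i) = n" by (simp add: hermite2_def)
  then have eq: "scalar_prod (hermite2 n f *\<^sub>v unit_vec n i) (hermite2 n g *\<^sub>v unit_vec n i)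
    = (\<Sum>k<n. (hermite2 n f *\<^sub>v unit_vec n i) $ k * (hermite2 n g *\<^sub>v unit_vec n i) $ k)"
    by (simp only: scalar_prod_def atLeast0LessThan)
  show ?thesis
    unfolding eq by (intro sum.cong refl arg_cong2[where f = "(*)"] col) auto
qed

theorem theorem8:
  "\<exists>c::real. c > 0 \<and>
     (\<forall>n::nat. n \<ge> 1 \<longrightarrow>
       (\<forall>f g :: (nat \<Rightarrow> real) \<Rightarrow> real.
          f \<in> ({..<n} \<rightarrow>\<^sub>E UNIV) \<rightarrow> {0..1} \<longrightarrow>
          g \<in> ({..<n} \<rightarrow>\<^sub>E UNIV) \<rightarrow> {0..1} \<longrightarrow>
          increasing_fun n f \<longrightarrow> increasing_fun n g \<longrightarrow>
          gaussian_cor n f g \<ge>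
            c * (\<Sum>i<n. cor_bound_term
                  (vec_index (hermite1 n f) i * vec_index (hermite1 n g) i)
                  (scalar_prod (hermite2 n f *\<^sub>v unit_vec n i) (hermite2 n g *\<^sub>v unit_vec n i)))))"
proof (intro exI[of _ "9/100 * exp (-2) :: real"] conjI allI impI)
  show "0 < 9/100 * exp (-2 :: real)" by simp
  fix n :: nat and f g :: "(nat \<Rightarrow> real) \<Rightarrow> real"
  assume n: "1 \<le> n" and f: "f \<in> ({..<n} \<rightarrow>\<^sub>E UNIV) \<rightarrow> {0..1}" and g: "g \<in> ({..<n} \<rightarrow>\<^sub>E UNIV) \<rightarrow> {0..1}"
    and "increasing_fun n f" "increasing_fun n g"
  then have inc: "incr_on {..<n} f" "incr_on {..<n} g" by (simp_all only: increasing_fun_iff)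
  have f01: "0 \<le> f x \<and> f x \<le> 1" if "x \<in> {..<n} \<rightarrow>\<^sub>E UNIV" for x using funcset_mem[OF f that] by simp
  have g01: "0 \<le> g x \<and> g x \<le> 1" if "x \<in> {..<n} \<rightarrow>\<^sub>E UNIV" for x using funcset_mem[OF g that] by simp
  \<comment> \<open>The upper envelopes are Borel, increasing, valued between 0 and 1, and almost
    everywhere equal to the given functions, so all integrals over the completed measure pass to
    them unchanged.\<close>
  define F where "F = upper_env n f"
  define G where "G = upper_env n g"
  have Fm: "F \<in> borel_measurable (\<Pi>\<^sub>M i\<in>{..<n}. borel)" and Gm: "G \<in> borel_measurable (\<Pi>\<^sub>M i\<in>{..<n}. borel)"
    unfolding F_def G_def by (rule measurable_upper_env[OF inc(1) f01] measurable_upper_env[OF inc(2) g01]; assumption)+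
  then have Fg: "F \<in> borel_measurable (gauss n)" and Gg: "G \<in> borel_measurable (gauss n)"
    by (simp_all only: measurable_cong_sets[OF sets_gauss refl])
  have F01: "0 \<le> F x \<and> F x \<le> 1" and G01: "0 \<le> G x \<and> G x \<le> 1" for x
    unfolding F_def G_def by (rule upper_env_01[OF inc(1) f01] upper_env_01[OF inc(2) g01]; assumption)+
  have Finc: "incr_on {..<n} F" and Ginc: "incr_on {..<n} G"
    unfolding F_def G_def by (rule upper_env_incr[OF inc(1) f01] upper_env_incr[OF inc(2) g01]; assumption)+
  have AEf: "AE x in gauss n. f x = F x" and AEg: "AE x in gauss n. g x = G x"
    unfolding F_def G_def by (rule AE_eq_upper_env[OF inc(1) f01] AE_eq_upper_env[OF inc(2) g01]; assumption)+
  have If: "(\<integral>x. h x * f x \<partial>std_gaussian n) = (\<integral>x. h x * F x \<partial>gauss n)"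
    and Ig: "(\<integral>x. h x * g x \<partial>std_gaussian n) = (\<integral>x. h x * G x \<partial>gauss n)"
    if "h \<in> borel_measurable (gauss n)" for h
    unfolding std_gaussian_def using that
    by (auto intro: integral_completion_AE[OF Fg AEf] integral_completion_AE[OF Gg AEg])
  have "AE x in gauss n. f x * g x = F x * G x"
    using AEf AEg by eventually_elim simp
  from integral_completion_AE[OF borel_measurable_times[OF Fg Gg] this, of "\<lambda>_. 1"]
  have Ifg: "(\<integral>x. f x * g x \<partial>std_gaussian n) = (\<integral>x. F x * G x \<partial>gauss n)"
    by (simp add: std_gaussian_def)
  have cor: "gaussian_cor n f g = (\<integral>x. F x * G x \<partial>gauss n) - (\<integral>x. F x \<partial>gauss n) * (\<integral>x. G x \<partial>gauss n)"
    using If[of "\<lambda>_. 1"] Ig[of "\<lambda>_. 1"] by (simp add: gaussian_cor_def Ifg)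
  have h1: "vec_index (hermite1 n f) i = gauss_coeff1 n F i"
    "vec_index (hermite1 n g) i = gauss_coeff1 n G i" if "i < n" for i
    using that by (simp_all add: hermite1_def gauss_coeff1_def If Ig measurable_gauss_component)
  have quad: "(\<lambda>x. x i * x k - (if i = k then 1 else 0)) \<in> borel_measurable (gauss n)" if "i < n" "k < n" for i k
    by (intro borel_measurable_diff borel_measurable_times measurable_gauss_component that) simp
  have h2: "scalar_prod (hermite2 n f *\<^sub>v unit_vec n i) (hermite2 n g *\<^sub>v unit_vec n i)
    = (\<Sum>k<n. gauss_coeff2 n F i k * gauss_coeff2 n G i k)" if "i < n" for i
    unfolding hermite2_column_prod[OF that] gauss_coeff2_def
    by (intro sum.cong refl arg_cong2[where f = "(*)"] If Ig quad that) auto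
  have "9/100 * exp (-2) * (\<Sum>i<n. cor_bound_term
        (vec_index (hermite1 n f) i * vec_index (hermite1 n g) i)
        (scalar_prod (hermite2 n f *\<^sub>v unit_vec n i) (hermite2 n g *\<^sub>v unit_vec n i)))
    = 9/100 * exp (-2) * (\<Sum>i<n. cor_bound_term (gauss_coeff1 n F i * gauss_coeff1 n G i)
        (\<Sum>k<n. gauss_coeff2 n F i k * gauss_coeff2 n G i k))"
    by (intro arg_cong2[where f = "(*)"] refl sum.cong) (simp only: h1 h2 lessThan_iff)
  also have "\<dots> \<le> gaussian_cor n f g"
    unfolding cor using n
    by (intro gauss_cor_ge_cor_bound_terms Fm Gm F01 G01 Finc Ginc) auto
  finally show "9/100 * exp (-2) * (\<Sum>i<n. cor_bound_term
        (vec_index (hermite1 n f) i * vec_index (hermite1 n g) i)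
        (scalar_prod (hermite2 n f *\<^sub>v unit_vec n i) (hermite2 n g *\<^sub>v unit_vec n i))) \<le> gaussian_cor n f g" .
qed

end
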